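(* Let $n\ge1$, $s\in(0,1)$, $u\in H^s(\mathbb R^n)$ and $\mathbf v\in\mathbf H^s(\mathbb R^n)$. Then the truncated fractional divergence and gradient converge pointwise almost everywhere to the untruncated ones as $\delta\to\infty$: for almost every $\mathbf x\in\mathbb R^n$, $$\operatorname{div}^s_\delta\mathbf v(\mathbf x)\to\operatorname{div}^s\mathbf v(\mathbf x),\qquad\operatorname{grad}^s_\delta u(\mathbf x)\to\operatorname{grad}^su(\mathbf x)\qquad\text{as }\delta\to\infty.$$
   Context: Integrals are in the principal value sense. $\mathbf H^s(\mathbb R^n)$ denotes vector fields with all components in $H^s(\mathbb R^n)$. The operators are $$\operatorname{grad}^su(\mathbf x)=\int_{\mathbb R^n}[u(\mathbf x)-u(\mathbf y)]\frac{\mathbf x-\mathbf y}{|\mathbf x-\mathbf y|}\frac{d\mathbf y}{|\mathbf x-\mathbf y|^{n+s}},\qquad \operatorname{div}^s\mathbf v(\mathbf x)=\int_{\mathbb R^n}[\mathbf v(\mathbf x)-\mathbf v(\mathbf y)]\cdot\frac{\mathbf x-\mathbf y}{|\mathbf x-\mathbf y|}\frac{d\mathbf y}{|\mathbf x-\mathbf y|^{n+s}},$$ and $\operatorname{grad}^s_\delta u$, $\operatorname{div}^s_\delta\mathbf v$ are obtained by multiplying the integrands by the indicator $\mathbf 1(|\mathbf x-\mathbf y|\le\delta)$, $\delta>0$. *)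

theory Defs
  imports "HOL-Analysis.Analysis"
begin

text \<open>Functions are honest functions, not classes modulo null sets. For \<open>0 < s < 1\<close> the space
  \<open>H\<^sup>s\<close> consists of the square-integrable functions with finite Gagliardo (Sobolev--Slobodeckij)
  seminorm. The integrand vanishes on the diagonal, since \<open>0 / 0 = 0\<close>.\<close>

definition Hs :: "real \<Rightarrow> (real ^ 'n \<Rightarrow> real) set" where
  "Hs s = {u. u \<in> borel_measurable lebesgue
      \<and> integrable lebesgue (\<lambda>x. (u x)\<^sup>2)
      \<and> (\<integral>\<^sup>+x. \<integral>\<^sup>+y. ennreal ((u x - u y)\<^sup>2 / norm (x - y) powr (real CARD('n) + 2 * s))
            \<partial>lebesgue \<partial>lebesgue) < \<infinity>}"

definition Hs_vec :: "real \<Rightarrow> (real ^ 'n \<Rightarrow> real ^ 'n) set" where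
  "Hs_vec s = {v. \<forall>i. (\<lambda>x. v x $ i) \<in> Hs s}"

text \<open>Principal value at the singularity \<open>x\<close>. The integrals over \<open>\<bar>x - y\<bar> > \<epsilon>\<close> are required to converge
  absolutely, so that no default value of the Bochner integral enters the limit.\<close>

definition has_pv_integral ::
  "('a::euclidean_space \<Rightarrow> 'b::{banach, second_countable_topology}) \<Rightarrow> 'b \<Rightarrow> 'a \<Rightarrow> bool" where
  "has_pv_integral f I x \<longleftrightarrow>
     (\<forall>\<epsilon>>0. set_integrable lebesgue {y. norm (x - y) > \<epsilon>} f) \<and>
     ((\<lambda>\<epsilon>. set_lebesgue_integral lebesgue {y. norm (x - y) > \<epsilon>} f) \<longlongrightarrow> I) (at_right 0)"

definition pv_integrable ::
  "('a::euclidean_space \<Rightarrow> 'b::{banach, second_countable_topology}) \<Rightarrow> 'a \<Rightarrow> bool" where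
  "pv_integrable f x \<longleftrightarrow> (\<exists>I. has_pv_integral f I x)"

definition pv_integral ::
  "('a::euclidean_space \<Rightarrow> 'b::{banach, second_countable_topology}) \<Rightarrow> 'a \<Rightarrow> 'b" where
  "pv_integral f x = (THE I. has_pv_integral f I x)"

definition grad_integrand :: "real \<Rightarrow> (real ^ 'n \<Rightarrow> real) \<Rightarrow> real ^ 'n \<Rightarrow> real ^ 'n \<Rightarrow> real ^ 'n" where
  "grad_integrand s u x y =
     ((u x - u y) / norm (x - y) powr (real CARD('n) + s)) *\<^sub>R ((x - y) /\<^sub>R norm (x - y))"

definition div_integrand :: "real \<Rightarrow> (real ^ 'n \<Rightarrow> real ^ 'n) \<Rightarrow> real ^ 'n \<Rightarrow> real ^ 'n \<Rightarrow> real" where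
  "div_integrand s v x y =
     ((v x - v y) \<bullet> ((x - y) /\<^sub>R norm (x - y))) / norm (x - y) powr (real CARD('n) + s)"

definition grad_integrand_trunc ::
  "real \<Rightarrow> real \<Rightarrow> (real ^ 'n \<Rightarrow> real) \<Rightarrow> real ^ 'n \<Rightarrow> real ^ 'n \<Rightarrow> real ^ 'n" where
  "grad_integrand_trunc \<delta> s u x y =
     indicat_real {y. norm (x - y) \<le> \<delta>} y *\<^sub>R grad_integrand s u x y"

definition div_integrand_trunc ::
  "real \<Rightarrow> real \<Rightarrow> (real ^ 'n \<Rightarrow> real ^ 'n) \<Rightarrow> real ^ 'n \<Rightarrow> real ^ 'n \<Rightarrow> real" where
  "div_integrand_trunc \<delta> s v x y =
     indicat_real {y. norm (x - y) \<le> \<delta>} y * div_integrand s v x y"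

definition frac_grad :: "real \<Rightarrow> (real ^ 'n \<Rightarrow> real) \<Rightarrow> real ^ 'n \<Rightarrow> real ^ 'n" where
  "frac_grad s u x = pv_integral (grad_integrand s u x) x"

definition frac_div :: "real \<Rightarrow> (real ^ 'n \<Rightarrow> real ^ 'n) \<Rightarrow> real ^ 'n \<Rightarrow> real" where
  "frac_div s v x = pv_integral (div_integrand s v x) x"

definition frac_grad_trunc ::
  "real \<Rightarrow> real \<Rightarrow> (real ^ 'n \<Rightarrow> real) \<Rightarrow> real ^ 'n \<Rightarrow> real ^ 'n" where
  "frac_grad_trunc \<delta> s u x = pv_integral (grad_integrand_trunc \<delta> s u x) x"

definition frac_div_trunc ::
  "real \<Rightarrow> real \<Rightarrow> (real ^ 'n \<Rightarrow> real ^ 'n) \<Rightarrow> real ^ 'n \<Rightarrow> real" where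
  "frac_div_trunc \<delta> s v x = pv_integral (div_integrand_trunc \<delta> s v x) x"

end

theory Submission
  imports Defs
begin

text \<open>The tail over \<open>\<bar>x - y\<bar> > \<delta>\<close> converges absolutely and vanishes as \<open>\<delta> \<rightarrow> \<infinity>\<close> by dominated convergence, so
  everything rests on the existence of the principal value at the singularity for almost every \<open>x\<close>. The
  integrand need not be absolutely integrable there. Cut the odd kernel \<open>z\<^sub>i / \<bar>z\<bar>\<^bsup>n+s+1\<^esup>\<close> into Lipschitz pieces
  \<open>K\<^sub>j\<close> supported in \<open>\<bar>z\<bar> \<le> 2\<^bsup>-j\<^esup>\<close>. Since the pieces have mean zero, the inner product of \<open>K\<^sub>j * u\<close> and \<open>K\<^sub>k * u\<close> is at most
  a constant times \<open>2\<^bsup>-(1-s)|j-k|\<^esup>\<close> times the Gagliardo energy of \<open>u\<close> at the coarser of the two scales. Hence the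
  partial sums converge in \<open>L\<^sup>2\<close> to some \<open>g\<close>. At almost every point the normalised mean oscillation of \<open>u\<close>
  over balls of radius \<open>2\<^bsup>-j\<^esup>\<close> tends to zero, and it controls the difference between the partial sum up to
  \<open>J\<close> and both the average of \<open>g\<close> at scale \<open>2\<^bsup>-J\<^esup>\<close> and the sharply truncated integral. The Lebesgue
  differentiation theorem for \<open>g\<close> then yields the limit.\<close>

section \<open>Shifts and the energy identity for odd kernels\<close>

text \<open>For almost every \<open>x\<close> the Gagliardo seminorm makes
  \<open>(u x - u y)^2 / |x - y|^(n + 2s)\<close> integrable in \<open>y\<close>. Cauchy--Schwarz
  would then need \<open>|z|^(-n)\<close> to be integrable near 0, which fails by a logarithm: the
  dyadic shells contribute a square-summable sequence where a summable one is wanted. The oddness of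
  the kernel has to supply the rest. It does so through a competition of two factors per scale:
  testing a mean-zero kernel against a Lipschitz function gains 1/2, while homogeneity of degree
  \<open>-(n + s)\<close> costs \<open>q = 2 powr s\<close>, and \<open>q / 2\<close> is below 1
  exactly when \<open>s < 1\<close>. The same ratio serves twice, once for the L2 convergence and
  once for comparing partial sums with averages, so that no maximal inequality is used for the
  passage to single points. In place of Cauchy--Schwarz the estimates use
  \<open>|a| \<le> \<theta> + a^2 / \<theta>\<close> with a free parameter.\<close>

lemma lborel_distr_reflect: "distr lborel borel (\<lambda>x. t - x) = (lborel :: 'a::euclidean_space measure)"
proof -
  have "(lborel :: 'a measure) = density (distr lborel borel (\<lambda>x. t + (-1) *\<^sub>R x)) (\<lambda>_. ennreal (\<bar>-1\<bar> ^ DIM('a)))"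
    using lborel_affine[of "-1" t] by simp
  then show ?thesis
    by (simp add: density_1)
qed

lemma nn_integral_lborel_reflect:
  fixes f :: "'a::euclidean_space \<Rightarrow> ennreal"
  assumes [measurable]: "f \<in> borel_measurable borel"
  shows "(\<integral>\<^sup>+x. f (t - x) \<partial>lborel) = (\<integral>\<^sup>+x. f x \<partial>lborel)"
  by (subst (2) lborel_distr_reflect[of t, symmetric]) (simp add: nn_integral_distr)

lemma
  fixes f :: "'a::euclidean_space \<Rightarrow> 'b::{banach, second_countable_topology}"
  assumes [measurable]: "f \<in> borel_measurable borel"
  shows integral_lborel_reflect: "(\<integral>x. f (t - x) \<partial>lborel) = (\<integral>x. f x \<partial>lborel)"
    and integrable_lborel_reflect_iff: "integrable lborel (\<lambda>x. f (t - x)) \<longleftrightarrow> integrable lborel f"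
proof -
  show "(\<integral>x. f (t - x) \<partial>lborel) = (\<integral>x. f x \<partial>lborel)"
    by (subst (2) lborel_distr_reflect[of t, symmetric]) (simp add: integral_distr)
  show "integrable lborel (\<lambda>x. f (t - x)) \<longleftrightarrow> integrable lborel f"
    by (subst (2) lborel_distr_reflect[of t, symmetric]) (simp add: integrable_distr_eq)
qed

lemma
  fixes f :: "'a::euclidean_space \<Rightarrow> 'b::{banach, second_countable_topology}"
  assumes [measurable]: "f \<in> borel_measurable borel"
  shows integral_lborel_translate: "(\<integral>x. f (x - t) \<partial>lborel) = (\<integral>x. f x \<partial>lborel)"
    and integrable_lborel_translate_iff: "integrable lborel (\<lambda>x. f (x - t)) \<longleftrightarrow> integrable lborel f"
proof -
  show "(\<integral>x. f (x - t) \<partial>lborel) = (\<integral>x. f x \<partial>lborel)"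
    by (subst (2) lborel_distr_plus[of "-t", symmetric]) (simp add: integral_distr)
  show "integrable lborel (\<lambda>x. f (x - t)) \<longleftrightarrow> integrable lborel f"
    by (subst (2) lborel_distr_plus[of "-t", symmetric]) (simp add: integrable_distr_eq)
qed

lemma integral_odd_eq_0:
  fixes f :: "'a::euclidean_space \<Rightarrow> real"
  assumes [measurable]: "f \<in> borel_measurable borel" and "\<And>x. f (- x) = - f x"
  shows "(\<integral>x. f x \<partial>lborel) = 0"
  using integral_lborel_reflect[of f 0] assms(2) by simp

lemma abs_le_one_plus_square: "\<bar>a\<bar> \<le> 1 + (a::real)\<^sup>2"
proof -
  have "0 \<le> (\<bar>a\<bar> - 1)\<^sup>2" "0 \<le> a\<^sup>2" by auto
  then show ?thesis by (simp add: power2_diff)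
qed

lemma integrable_bounded_support:
  fixes k :: "'a::euclidean_space \<Rightarrow> real"
  assumes [measurable]: "k \<in> borel_measurable borel"
    and "\<And>z. \<bar>k z\<bar> \<le> M" "\<And>z. z \<notin> cball 0 \<rho> \<Longrightarrow> k z = 0"
  shows "integrable lborel k"
proof (rule Bochner_Integration.integrable_bound)
  show "integrable lborel (\<lambda>z. M * indicator (cball 0 \<rho>) z :: real)"
    by (intro integrable_mult_right integrable_real_indicator) (auto simp: emeasure_lborel_cball_finite[unfolded infinity_ennreal_def])
  show "AE z in lborel. norm (k z) \<le> norm (M * indicator (cball 0 \<rho>) z :: real)"
  proof (intro AE_I2)
    fix z
    show "norm (k z) \<le> norm (M * indicator (cball 0 \<rho>) z :: real)"
      using assms(2,3)[of z] by (cases "z \<in> cball 0 \<rho>") auto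
  qed
qed simp

text \<open>Square integrability has to control a first power. The bound
  \<open>\<bar>a\<bar> \<le> 1 + a\<^sup>2\<close> splits the task: the constant is paid by the
  bounded support of \<open>k\<close>, the square by its bound \<open>M\<close>. The constant
  \<open>c\<close> leaves room for subtracting a reference value.\<close>

lemma integrable_conv_bounded_support:
  fixes k f :: "'a::euclidean_space \<Rightarrow> real"
  assumes [measurable]: "k \<in> borel_measurable borel" "f \<in> borel_measurable borel"
    and sq: "integrable lborel (\<lambda>x. (f x)\<^sup>2)"
    and k: "\<And>z. \<bar>k z\<bar> \<le> M" "\<And>z. z \<notin> cball 0 \<rho> \<Longrightarrow> k z = 0"
  shows "integrable lborel (\<lambda>z. k z * (f (x - z) - c))"
proof (rule Bochner_Integration.integrable_bound)
  have "integrable lborel (\<lambda>z. (f (x - z))\<^sup>2)"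
    using integrable_lborel_reflect_iff[of "\<lambda>x. (f x)\<^sup>2" x] sq by simp
  then show "integrable lborel (\<lambda>z. (1 + \<bar>c\<bar>) * \<bar>k z\<bar> + M * (f (x - z))\<^sup>2)"
    using k by (intro Bochner_Integration.integrable_add integrable_mult_right integrable_abs
      integrable_bounded_support[of k M \<rho>]) auto
  show "AE z in lborel. norm (k z * (f (x - z) - c)) \<le> norm ((1 + \<bar>c\<bar>) * \<bar>k z\<bar> + M * (f (x - z))\<^sup>2)"
  proof (intro AE_I2)
    fix z
    have "norm (k z * (f (x - z) - c)) \<le> \<bar>k z\<bar> * (1 + \<bar>c\<bar> + (f (x - z))\<^sup>2)"
      using abs_le_one_plus_square[of "f (x - z)"] by (auto simp: abs_mult intro!: mult_left_mono)
    also have "\<dots> \<le> (1 + \<bar>c\<bar>) * \<bar>k z\<bar> + M * (f (x - z))\<^sup>2"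
      using k(1)[of z] by (simp add: algebra_simps mult_right_mono)
    finally show "norm (k z * (f (x - z) - c)) \<le> norm ((1 + \<bar>c\<bar>) * \<bar>k z\<bar> + M * (f (x - z))\<^sup>2)"
      by simp
  qed
qed simp

text \<open>Squared L2 distance of \<open>u\<close> from its translate by \<open>h\<close>.
  Integrated against \<open>norm h powr - (n + 2 * s)\<close> it is the Gagliardo energy, so this is
  the form in which the energy enters the L2 estimates.\<close>

definition sq_shift :: "('a::euclidean_space \<Rightarrow> real) \<Rightarrow> 'a \<Rightarrow> real" where
  "sq_shift u h = (\<integral>x. (u x - u (x - h))\<^sup>2 \<partial>lborel)"

context
  fixes u :: "'a::euclidean_space \<Rightarrow> real"
  assumes u[measurable]: "u \<in> borel_measurable borel" and u2: "integrable lborel (\<lambda>x. (u x)\<^sup>2)"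
begin

lemma integrable_translate_square: "integrable lborel (\<lambda>x. (u (x - h))\<^sup>2)"
  using integrable_lborel_translate_iff[of "\<lambda>x. (u x)\<^sup>2" h] u2 by simp

lemma integrable_translate_prod: "integrable lborel (\<lambda>x. u (x - z) * u (x - w))"
proof (rule Bochner_Integration.integrable_bound)
  show "integrable lborel (\<lambda>x. (u (x - z))\<^sup>2 + (u (x - w))\<^sup>2)"
    by (intro Bochner_Integration.integrable_add integrable_translate_square)
  show "AE x in lborel. norm (u (x - z) * u (x - w)) \<le> norm ((u (x - z))\<^sup>2 + (u (x - w))\<^sup>2)"
  proof (intro AE_I2)
    fix x
    have "2 * \<bar>u (x - z) * u (x - w)\<bar> \<le> (u (x - z))\<^sup>2 + (u (x - w))\<^sup>2"
      using sum_squares_bound[of "\<bar>u (x - z)\<bar>" "\<bar>u (x - w)\<bar>"] by (simp add: abs_mult)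
    then show "norm (u (x - z) * u (x - w)) \<le> norm ((u (x - z))\<^sup>2 + (u (x - w))\<^sup>2)" by simp
  qed
qed simp

lemma integrable_sq_diff: "integrable lborel (\<lambda>x. (u x - u (x - h))\<^sup>2)"
  using integrable_translate_prod[of 0 h] u2 integrable_translate_square[of h]
  by (auto simp: power2_diff mult.assoc intro!: Bochner_Integration.integrable_add Bochner_Integration.integrable_diff)

lemma sq_shift_nonneg: "0 \<le> sq_shift u h"
  unfolding sq_shift_def by simp

lemma sq_shift_measurable[measurable]: "sq_shift u \<in> borel_measurable borel"
  unfolding sq_shift_def[abs_def] by measurable

lemma sq_shift_uminus: "sq_shift u (- h) = sq_shift u h"
  using integral_lborel_translate[of "\<lambda>x. (u (x + h) - u x)\<^sup>2" h]
  by (simp add: sq_shift_def power2_commute)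

text \<open>Writing \<open>2ab = a^2 + b^2 - (a - b)^2\<close> expresses the autocorrelation through
  \<open>sq_shift\<close>, since both squares have the same integral by translation
  invariance.\<close>

lemma integral_translate_prod:
  "(\<integral>x. u (x - z) * u (x - w) \<partial>lborel) = (\<integral>x. (u x)\<^sup>2 \<partial>lborel) - sq_shift u (z - w) / 2"
proof -
  have "sq_shift u (z - w) = (\<integral>x. (u (x - w) - u (x - w - (z - w)))\<^sup>2 \<partial>lborel)"
    unfolding sq_shift_def
    using integral_lborel_translate[of "\<lambda>x. (u x - u (x - (z - w)))\<^sup>2" w] by simp
  also have "\<dots> = (\<integral>x. (u (x - w))\<^sup>2 + (u (x - z))\<^sup>2 - 2 * (u (x - z) * u (x - w)) \<partial>lborel)"
    by (simp add: power2_diff algebra_simps)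
  also have "\<dots> = (\<integral>x. (u (x - w))\<^sup>2 \<partial>lborel) + (\<integral>x. (u (x - z))\<^sup>2 \<partial>lborel)
      - 2 * (\<integral>x. u (x - z) * u (x - w) \<partial>lborel)"
    using integrable_translate_square integrable_translate_prod[of z w] by simp
  also have "\<dots> = 2 * (\<integral>x. (u x)\<^sup>2 \<partial>lborel) - 2 * (\<integral>x. u (x - z) * u (x - w) \<partial>lborel)"
    using integral_lborel_translate[of "\<lambda>x. (u x)\<^sup>2"] by simp
  finally show ?thesis by (simp add: field_simps)
qed

lemma sq_shift_le: "sq_shift u h \<le> 4 * (\<integral>x. (u x)\<^sup>2 \<partial>lborel)"
proof -
  have "sq_shift u h \<le> (\<integral>x. 2 * (u x)\<^sup>2 + 2 * (u (x - h))\<^sup>2 \<partial>lborel)"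
    unfolding sq_shift_def
  proof (intro integral_mono integrable_sq_diff Bochner_Integration.integrable_add integrable_mult_right u2 integrable_translate_square)
    fix x
    show "(u x - u (x - h))\<^sup>2 \<le> 2 * (u x)\<^sup>2 + 2 * (u (x - h))\<^sup>2"
      using zero_le_power2[of "u x + u (x - h)"] by (simp add: power2_sum power2_diff)
  qed
  also have "\<dots> = 4 * (\<integral>x. (u x)\<^sup>2 \<partial>lborel)"
    using integral_lborel_translate[of "\<lambda>x. (u x)\<^sup>2" h] u2 integrable_translate_square[of h] by simp
  finally show ?thesis .
qed

lemma integrable_kernel_sq_shift:
  assumes "integrable lborel k"
  shows "integrable lborel (\<lambda>h. k h * sq_shift u (h - w))"
    and "integrable lborel (\<lambda>h. k h * sq_shift u (w - h))"
proof -
  have [measurable]: "k \<in> borel_measurable borel" using assms by measurable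
  have i: "integrable lborel (\<lambda>h. 4 * (\<integral>x. (u x)\<^sup>2 \<partial>lborel) * k h)"
    using assms by simp
  have "norm (k h * sq_shift u z) \<le> norm (4 * (\<integral>x. (u x)\<^sup>2 \<partial>lborel) * k h)" for h z
    using sq_shift_le[of z] sq_shift_nonneg[of z] by (simp add: abs_mult mult.commute[of _ "\<bar>k h\<bar>"] mult_left_mono)
  then show "integrable lborel (\<lambda>h. k h * sq_shift u (h - w))"
    and "integrable lborel (\<lambda>h. k h * sq_shift u (w - h))"
    by (auto intro!: Bochner_Integration.integrable_bound[OF i])
qed

text \<open>Supplies the Fubini hypothesis for two integrable kernels with a bounded coupling. The
  couplings used are built from autocorrelations or from \<open>sq_shift\<close>, both bounded by
  multiples of the integral of the square of \<open>u\<close>.\<close>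

lemma integrable_pair_kernel:
  fixes H1 H2 :: "'a \<Rightarrow> real"
  assumes H1: "integrable lborel H1" and H2: "integrable lborel H2"
    and [measurable]: "c \<in> borel_measurable (lborel \<Otimes>\<^sub>M lborel)" and c: "\<And>p. \<bar>c p\<bar> \<le> (M::real)"
  shows "integrable (lborel \<Otimes>\<^sub>M lborel) (\<lambda>(w, z). H1 w * H2 z * c (w, z))"
proof (rule Bochner_Integration.integrable_bound)
  have [measurable]: "H1 \<in> borel_measurable borel" "H2 \<in> borel_measurable borel" using H1 H2 by auto
  show "integrable (lborel \<Otimes>\<^sub>M lborel) (\<lambda>(w, z). M * H1 w * H2 z)"
    using H1 H2 by (intro lborel_pair.Fubini_integrable) (auto simp: abs_mult)
  show "AE p in lborel \<Otimes>\<^sub>M lborel. norm (case p of (w, z) \<Rightarrow> H1 w * H2 z * c (w, z))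
     \<le> norm (case p of (w, z) \<Rightarrow> M * H1 w * H2 z)"
  proof (intro AE_I2)
    fix p :: "'a \<times> 'a"
    have "\<bar>c p\<bar> \<le> \<bar>M\<bar>" using c[of p] by linarith
    then have "\<bar>H1 (fst p)\<bar> * (\<bar>H2 (snd p)\<bar> * \<bar>c p\<bar>) \<le> \<bar>H1 (fst p)\<bar> * (\<bar>H2 (snd p)\<bar> * \<bar>M\<bar>)"
      by (intro mult_left_mono) auto
    then show "norm (case p of (w, z) \<Rightarrow> H1 w * H2 z * c (w, z)) \<le> norm (case p of (w, z) \<Rightarrow> M * H1 w * H2 z)"
      by (cases p) (simp add: abs_mult mult_ac)
  qed
  show "(\<lambda>(w, z). H1 w * H2 z * c (w, z)) \<in> borel_measurable (lborel \<Otimes>\<^sub>M lborel)" by measurable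
qed

text \<open>Polarisation: the \<open>L\<^sup>2\<close> norm of \<open>u\<close> drops out because an odd kernel has mean zero, and only
  differences of \<open>u\<close> survive.\<close>

lemma energy_identity:
  fixes H :: "'a \<Rightarrow> real"
  assumes H: "integrable lborel H" and odd: "\<And>z. H (- z) = - H z"
  defines "F \<equiv> \<lambda>x. \<integral>z. H z * u (x - z) \<partial>lborel"
  shows "integrable lborel (\<lambda>x. (F x)\<^sup>2)"
    and "(\<integral>x. (F x)\<^sup>2 \<partial>lborel) = - (\<integral>w. H w * (\<integral>z. H z * sq_shift u (z - w) \<partial>lborel) \<partial>lborel) / 2"
proof -
  have [measurable]: "H \<in> borel_measurable borel" using H by auto
  define A where "A = (\<integral>x. (u x)\<^sup>2 \<partial>lborel)"
  \<comment> \<open>The square of the convolution is an integral over a pair \<open>(w, z)\<close>.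
    Performing the \<open>x\<close>-integral first turns it into an autocorrelation;
    \<open>P\<close> is the joint integrand for this exchange.\<close>
  define P :: "('a \<times> 'a) \<times> 'a \<Rightarrow> real"
    where "P = (\<lambda>(p, x). (H (fst p) * H (snd p)) * (u (x - snd p) * u (x - fst p)))"
  have [measurable]: "P \<in> borel_measurable (lborel \<Otimes>\<^sub>M lborel)"
    unfolding P_def lborel_prod[symmetric] by measurable
  have "integrable lborel (\<lambda>(w, z). \<bar>H w\<bar> * \<bar>H z\<bar> * (\<lambda>(w, z). \<integral>x. \<bar>u (x - z) * u (x - w)\<bar> \<partial>lborel) (w, z))"
    unfolding lborel_prod[symmetric]
  proof (rule integrable_pair_kernel)
    fix p :: "'a \<times> 'a"
    obtain w z where p: "p = (w, z)" by (cases p)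
    have "(\<integral>x. \<bar>u (x - z) * u (x - w)\<bar> \<partial>lborel) \<le> (\<integral>x. (u (x - z))\<^sup>2 + (u (x - w))\<^sup>2 \<partial>lborel)"
    proof (intro integral_mono integrable_abs integrable_translate_prod Bochner_Integration.integrable_add integrable_translate_square)
      fix x
      have "2 * \<bar>u (x - z) * u (x - w)\<bar> \<le> (u (x - z))\<^sup>2 + (u (x - w))\<^sup>2"
        using sum_squares_bound[of "\<bar>u (x - z)\<bar>" "\<bar>u (x - w)\<bar>"] by (simp add: abs_mult)
      then show "\<bar>u (x - z) * u (x - w)\<bar> \<le> (u (x - z))\<^sup>2 + (u (x - w))\<^sup>2" by simp
    qed
    also have "\<dots> = 2 * A"
      using integral_lborel_translate[of "\<lambda>x. (u x)\<^sup>2"] integrable_translate_square by (simp add: A_def)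
    finally show "\<bar>case p of (w, z) \<Rightarrow> \<integral>x. \<bar>u (x - z) * u (x - w)\<bar> \<partial>lborel\<bar> \<le> 2 * A"
      by (simp add: p)
  qed (use H in auto)
  then have "integrable lborel (\<lambda>p. \<integral>x. norm (P (p, x)) \<partial>lborel)"
    by (simp add: P_def abs_mult case_prod_unfold)
  then have intP: "integrable (lborel \<Otimes>\<^sub>M lborel) P"
  proof (rule lborel_pair.Fubini_integrable[rotated])
    show "AE p in lborel. integrable lborel (\<lambda>x. P (p, x))"
      unfolding P_def prod.case by (intro AE_I2 integrable_mult_right integrable_translate_prod)
  qed measurable
  have "AE x in lborel. integrable lborel (\<lambda>p. P (p, x))"
    using lborel_pair.AE_integrable_snd[of "\<lambda>p x. P (p, x)"] intP by simp
  \<comment> \<open>Fubini identifies the two expressions where \<open>P\<close> is integrable in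
    \<open>(w, z)\<close>, that is for almost every \<open>x\<close>, which is enough under the
    integral.\<close>
  then have F: "AE x in lborel. (\<integral>p. P (p, x) \<partial>lborel) = (F x)\<^sup>2"
  proof (eventually_elim)
    case (elim x)
    then have i: "integrable (lborel \<Otimes>\<^sub>M lborel) (\<lambda>(w, z). P ((w, z), x))"
      by (simp add: lborel_prod case_prod_unfold)
    have "(\<integral>p. P (p, x) \<partial>lborel) = (\<integral>w. \<integral>z. P ((w, z), x) \<partial>lborel \<partial>lborel)"
      using lborel_pair.integral_fst[OF i] by (simp add: lborel_prod case_prod_unfold)
    also have "\<dots> = (\<integral>w. H w * u (x - w) * F x \<partial>lborel)"
    proof (intro Bochner_Integration.integral_cong refl)
      fix w
      have "(\<integral>z. P ((w, z), x) \<partial>lborel) = (\<integral>z. (H w * u (x - w)) * (H z * u (x - z)) \<partial>lborel)"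
        by (simp add: P_def mult_ac)
      then show "(\<integral>z. P ((w, z), x) \<partial>lborel) = H w * u (x - w) * F x"
        by (simp add: F_def)
    qed
    also have "\<dots> = (F x)\<^sup>2"
      by (simp add: F_def power2_eq_square)
    finally show ?case .
  qed
  have "integrable lborel (\<lambda>x. \<integral>p. P (p, x) \<partial>lborel)"
    using lborel_pair.integrable_snd[of "\<lambda>p x. P (p, x)"] intP by simp
  moreover have [measurable]: "F \<in> borel_measurable borel"
    unfolding F_def by measurable
  ultimately show "integrable lborel (\<lambda>x. (F x)\<^sup>2)"
    using integrable_cong_AE[OF _ _ F] by simp
  have "(\<integral>x. (F x)\<^sup>2 \<partial>lborel) = (\<integral>x. \<integral>p. P (p, x) \<partial>lborel \<partial>lborel)"
    using F by (intro integral_cong_AE) auto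
  also have "\<dots> = (\<integral>p. \<integral>x. P (p, x) \<partial>lborel \<partial>lborel)"
    using lborel_pair.Fubini_integral[of "\<lambda>p x. P (p, x)"] intP by simp
  also have "\<dots> = (\<integral>p. (case p of (w, z) \<Rightarrow> H w * H z * (A - sq_shift u (z - w) / 2)) \<partial>(lborel \<Otimes>\<^sub>M lborel))"
    unfolding lborel_prod
    by (intro Bochner_Integration.integral_cong refl)
      (auto simp: P_def integral_translate_prod A_def)
  also have "\<dots> = (\<integral>w. \<integral>z. H w * H z * (A - sq_shift u (z - w) / 2) \<partial>lborel \<partial>lborel)"
  proof (rule lborel_pair.integral_fst[symmetric])
    have "\<bar>A - sq_shift u h / 2\<bar> \<le> A" for h
      using sq_shift_nonneg[of h] sq_shift_le[of h] by (simp add: A_def abs_le_iff)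
    then have "integrable (lborel \<Otimes>\<^sub>M lborel)
        (\<lambda>(w, z). H w * H z * (\<lambda>(w, z). A - sq_shift u (z - w) / 2) (w, z))"
      by (intro integrable_pair_kernel[where M = A] H) auto
    then show "integrable (lborel \<Otimes>\<^sub>M lborel) (\<lambda>(w, z). H w * H z * (A - sq_shift u (z - w) / 2))"
      by simp
  qed
  also have "\<dots> = (\<integral>w. - (H w * (\<integral>z. H z * sq_shift u (z - w) \<partial>lborel)) / 2 \<partial>lborel)"
  proof (intro Bochner_Integration.integral_cong refl)
    fix w
    have "(\<integral>z. H w * H z * (A - sq_shift u (z - w) / 2) \<partial>lborel)
        = (\<integral>z. (H w * A) * H z - (H w / 2) * (H z * sq_shift u (z - w)) \<partial>lborel)"
      by (simp add: algebra_simps)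
    also have "\<dots> = (H w * A) * (\<integral>z. H z \<partial>lborel) - (H w / 2) * (\<integral>z. H z * sq_shift u (z - w) \<partial>lborel)"
      using H integrable_kernel_sq_shift(1)[OF H, of w] by simp
    also have "(\<integral>z. H z \<partial>lborel) = 0"
      by (rule integral_odd_eq_0) (use odd in auto)
    finally show "(\<integral>z. H w * H z * (A - sq_shift u (z - w) / 2) \<partial>lborel)
        = - (H w * (\<integral>z. H z * sq_shift u (z - w) \<partial>lborel)) / 2" by simp
  qed
  also have "\<dots> = - (\<integral>w. H w * (\<integral>z. H z * sq_shift u (z - w) \<partial>lborel) \<partial>lborel) / 2"
    by simp
  finally show "(\<integral>x. (F x)\<^sup>2 \<partial>lborel)
      = - (\<integral>w. H w * (\<integral>z. H z * sq_shift u (z - w) \<partial>lborel) \<partial>lborel) / 2" .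
qed

end

section \<open>Almost orthogonality of dyadic kernels\<close>

text \<open>If \<open>f\<close> is not integrable, its Bochner integral is 0 by convention and the
  bound still holds because \<open>g\<close> is nonnegative. Later estimates therefore only have to
  establish integrability of the majorant.\<close>

lemma abs_integral_le:
  fixes f g :: "'a \<Rightarrow> real"
  assumes "integrable M g" "\<And>x. \<bar>f x\<bar> \<le> g x"
  shows "\<bar>\<integral>x. f x \<partial>M\<bar> \<le> (\<integral>x. g x \<partial>M)"
proof (cases "integrable M f")
  case True
  then have "\<bar>\<integral>x. f x \<partial>M\<bar> \<le> (\<integral>x. \<bar>f x\<bar> \<partial>M)" by simp
  also have "\<dots> \<le> (\<integral>x. g x \<partial>M)" using True assms by (intro integral_mono) auto
  finally show ?thesis .
next
  case False
  then have "(\<integral>x. f x \<partial>M) = 0" by (rule not_integrable_integral_eq)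
  moreover have "0 \<le> g x" for x using assms(2)[of x] by linarith
  ultimately show ?thesis by (simp add: Bochner_Integration.integral_nonneg)
qed

text \<open>A Schur-type summation. Each pair is charged to its smaller index, so that every row
  becomes a geometric series times one \<open>e j\<close>; symmetry accounts for the factor
  2.\<close>

lemma sum_geometric_offdiagonal_le:
  fixes e :: "nat \<Rightarrow> real"
  assumes "finite I" "0 \<le> r" "r < 1" "\<And>j. 0 \<le> e j"
    and b: "\<And>j k. j \<le> k \<Longrightarrow> \<bar>B j k\<bar> \<le> D * r ^ (k - j) * e j" and sym: "\<And>j k. B j k = B k j"
    and "0 \<le> D"
  shows "(\<Sum>j\<in>I. \<Sum>k\<in>I. \<bar>B j k\<bar>) \<le> 2 * D / (1 - r) * (\<Sum>j\<in>I. e j)"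
proof -
  define g where "g j k = (if j \<le> k then D * r ^ (k - j) * e j else 0)" for j k
  have g0: "0 \<le> g j k" for j k using assms by (simp add: g_def)
  have "\<bar>B j k\<bar> \<le> g j k + g k j" for j k
    using b[of j k] b[of k j] sym[of j k] g0[of j k] g0[of k j] by (cases "j \<le> k") (auto simp: g_def)
  then have "(\<Sum>j\<in>I. \<Sum>k\<in>I. \<bar>B j k\<bar>) \<le> (\<Sum>j\<in>I. \<Sum>k\<in>I. g j k + g k j)"
    by (intro sum_mono)
  also have "\<dots> = 2 * (\<Sum>j\<in>I. \<Sum>k\<in>I. g j k)"
    using sum.swap[of g I I] by (simp add: sum.distrib)
  also have "(\<Sum>j\<in>I. \<Sum>k\<in>I. g j k) \<le> (\<Sum>j\<in>I. D / (1 - r) * e j)"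
  proof (intro sum_mono)
    fix j
    have "(\<Sum>k\<in>I. g j k) = D * e j * (\<Sum>k\<in>{k\<in>I. j \<le> k}. r ^ (k - j))"
      using \<open>finite I\<close> by (simp add: g_def sum.inter_filter[symmetric] sum_distrib_left mult_ac)
    also have "(\<Sum>k\<in>{k\<in>I. j \<le> k}. r ^ (k - j)) = (\<Sum>i\<in>(\<lambda>k. k - j) ` {k\<in>I. j \<le> k}. r ^ i)"
      by (subst sum.reindex) (auto simp: inj_on_def)
    also have "\<dots> \<le> (\<Sum>i. r ^ i)"
      using assms by (intro sum_le_suminf summable_geometric) auto
    also have "\<dots> = 1 / (1 - r)"
      using assms by (intro suminf_geometric) auto
    finally show "(\<Sum>k\<in>I. g j k) \<le> D / (1 - r) * e j"
      using assms by (simp add: mult_left_mono)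
  qed
  finally show ?thesis by (simp add: sum_distrib_left mult.assoc)
qed

lemma measure_cball_dyadic:
  "0 \<le> R \<Longrightarrow> measure lborel (cball (0::'a::euclidean_space) (R / 2 ^ j))
    = measure lborel (cball (0::'a) R) / (2 ^ DIM('a)) ^ j"
  by (simp add: content_cball power_divide mult.commute flip: power_mult)

lemma borel_measurable_lipschitz:
  fixes f :: "'a::euclidean_space \<Rightarrow> real"
  assumes "\<And>x y. \<bar>f x - f y\<bar> \<le> L * norm (x - y)" "0 \<le> L"
  shows "f \<in> borel_measurable borel"
proof -
  have "L-lipschitz_on UNIV f"
    using assms by (intro lipschitz_onI) (auto simp: dist_norm)
  then show ?thesis
    by (intro borel_measurable_continuous_onI lipschitz_on_continuous_on)
qed

text \<open>Models the pieces of an odd kernel of homogeneity \<open>-(n + s)\<close> with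
  \<open>q = 2 powr s\<close>: amplitude \<open>(2 ^ n * q) ^ j\<close> on the ball of radius
  \<open>1 / 2 ^ j\<close>, and by scaling one more factor \<open>2 ^ j\<close> in the Lipschitz
  constant. The condition \<open>q < 2\<close> says that smoothness wins over singularity.\<close>

locale dyadic_kernels =
  fixes K :: "nat \<Rightarrow> 'a::euclidean_space \<Rightarrow> real" and q C :: real
  assumes q: "1 \<le> q" "q < 2" and C: "0 \<le> C"
    and odd: "\<And>j z. K j (- z) = - K j z"
    and lip: "\<And>j z w. \<bar>K j z - K j w\<bar> \<le> C * (2 ^ DIM('a) * q * 2) ^ j * norm (z - w)"
    and supp: "\<And>j z. 1 / 2 ^ j < norm z \<Longrightarrow> K j z = 0"
begin

definition A where "A = 2 ^ DIM('a) * q"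
text \<open>The radius leaves room for the support of a kernel, of radius \<open>1 / 2 ^ j\<close>,
  moved by vectors of length up to \<open>DIM('a) / 2 ^ j\<close>. This length bounds the cubes that
  later carry the averages.\<close>

definition R where "R = real DIM('a) + 1"
definition V where "V = measure lborel (cball (0::'a) R)"

abbreviation ball_dyadic where "ball_dyadic j \<equiv> cball (0::'a) (R / 2 ^ j)"

lemma A_pos: "0 < A" using q by (simp add: A_def)
lemma V_nonneg: "0 \<le> V" by (simp add: V_def)
lemma R_ge: "2 \<le> R" "1 \<le> R" "real DIM('a) + 1 \<le> R"
  using DIM_positive[where 'a='a] by (auto simp: R_def simp del: DIM_positive)

lemma measure_ball: "measure lborel (ball_dyadic j) = V / (2 ^ DIM('a)) ^ j"
  using R_ge by (simp add: measure_cball_dyadic V_def)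

lemma ball_dyadic_finite: "emeasure lborel (ball_dyadic j) < \<infinity>"
  by (rule emeasure_lborel_cball_finite)

lemma integrable_indicator_ball[simp]: "integrable lborel (\<lambda>z. indicator (ball_dyadic j) z :: real)"
  using ball_dyadic_finite[of j] by (intro integrable_real_indicator) auto

lemma integral_indicator_ball: "(\<integral>z. indicator (ball_dyadic j) z \<partial>lborel) = V / (2 ^ DIM('a)) ^ j"
  using measure_ball[of j] by simp

lemma K_measurable[measurable]: "K j \<in> borel_measurable borel"
  using lip C q by (intro borel_measurable_lipschitz[of "K j" "C * (2 ^ DIM('a) * q * 2) ^ j"]) auto

lemma K_0: "K j 0 = 0" using odd[of j 0] by simp

text \<open>Oddness forces \<open>K j 0 = 0\<close>, so the Lipschitz constant times the radius of
  the support bounds the amplitude.\<close>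

lemma K_bound: "\<bar>K j z\<bar> \<le> C * A ^ j"
proof (cases "1 / 2 ^ j < norm z")
  case True
  then show ?thesis using supp[OF True] C A_pos by simp
next
  case False
  have "\<bar>K j z\<bar> \<le> C * (A * 2) ^ j * norm z"
    using lip[of j z 0] by (simp add: K_0 A_def)
  also have "\<dots> \<le> C * (A * 2) ^ j * (1 / 2 ^ j)"
    using False C A_pos by (intro mult_left_mono) auto
  finally show ?thesis by (simp add: power_mult_distrib)
qed

lemma K_outside: "z \<notin> cball 0 (1 / 2 ^ j) \<Longrightarrow> K j z = 0"
  by (rule supp) simp

lemma K_bound_indicator: "\<bar>K j z\<bar> \<le> C * A ^ j * indicator (ball_dyadic j) z"
  using K_bound[of j z] supp[of j z] R_ge divide_right_mono[of 1 R "2 ^ j"] by (fastforce simp: indicator_def)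

lemma K_integrable[simp]: "integrable lborel (K j)"
  using integrable_bounded_support[of "K j", OF _ K_bound K_outside] by simp

lemma integral_K: "(\<integral>z. K j z \<partial>lborel) = 0"
  by (rule integral_odd_eq_0) (use odd in auto)

text \<open>The first moment is what remains when a mean-zero kernel is tested against a Lipschitz
  function. The volume of the ball cancels \<open>A ^ j\<close> up to \<open>q ^ j\<close>, and
  \<open>norm z\<close> contributes \<open>1 / 2 ^ j\<close>.\<close>

lemma
  shows integrable_K_norm: "integrable lborel (\<lambda>z. \<bar>K j z\<bar> * norm z)"
    and integral_K_norm_le: "(\<integral>z. \<bar>K j z\<bar> * norm z \<partial>lborel) \<le> C * V * (q / 2) ^ j"
proof -
  have le: "\<bar>K j z\<bar> * norm z \<le> C * A ^ j / 2 ^ j * indicator (ball_dyadic j) z" for z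
  proof (cases "1 / 2 ^ j < norm z")
    case True
    then show ?thesis using supp[OF True] C A_pos by simp
  next
    case False
    then have "\<bar>K j z\<bar> * norm z \<le> (C * A ^ j * indicator (ball_dyadic j) z) * (1 / 2 ^ j)"
      using K_bound_indicator by (intro mult_mono) (auto simp: C A_pos less_imp_le)
    then show ?thesis by simp
  qed
  have i: "integrable lborel (\<lambda>z. C * A ^ j / 2 ^ j * indicator (ball_dyadic j) z)"
    by (intro integrable_mult_right) simp
  show 1: "integrable lborel (\<lambda>z. \<bar>K j z\<bar> * norm z)"
    by (rule Bochner_Integration.integrable_bound[OF i])
      (use le order_trans[OF le abs_ge_self] in \<open>auto simp: abs_mult\<close>)
  have "(\<integral>z. \<bar>K j z\<bar> * norm z \<partial>lborel) \<le> (\<integral>z. C * A ^ j / 2 ^ j * indicator (ball_dyadic j) z \<partial>lborel)"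
    by (intro integral_mono 1 i le)
  also have "\<dots> = C * A ^ j / 2 ^ j * (V / (2 ^ DIM('a)) ^ j)"
    using integral_indicator_ball[of j] by simp
  also have "\<dots> = C * V * (q / 2) ^ j"
    by (simp add: A_def power_mult_distrib power_divide)
  finally show "(\<integral>z. \<bar>K j z\<bar> * norm z \<partial>lborel) \<le> C * V * (q / 2) ^ j" .
qed

text \<open>The enlarged ball absorbs the shift: outside it both \<open>z\<close> and
  \<open>z + w\<close> lie outside the support, and inside the Lipschitz bound applies.\<close>

lemma K_increment:
  assumes "norm w \<le> real DIM('a) / 2 ^ j"
  shows "\<bar>K j (z + w) - K j z\<bar> \<le> C * (A * 2) ^ j * norm w * indicator (ball_dyadic j) z"
proof (cases "z \<in> ball_dyadic j")
  case True
  then show ?thesis using lip[of j "z + w" z] by (simp add: A_def)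
next
  case False
  then have "R / 2 ^ j < norm z" by simp
  moreover have "(real DIM('a) + 1) / 2 ^ j \<le> R / 2 ^ j" using R_ge by (intro divide_right_mono) auto
  ultimately have *: "real DIM('a) / 2 ^ j + 1 / 2 ^ j < norm z" by (simp add: add_divide_distrib)
  have "norm z - norm w \<le> norm (z + w)" by (metis norm_diff_ineq add.commute)
  with * assms have "1 / 2 ^ j < norm (z + w)" by linarith
  moreover have "1 / 2 ^ j < norm z" using * by (smt (verit) divide_nonneg_nonneg of_nat_0_le_iff zero_le_power)
  ultimately show ?thesis using False by (simp add: supp)
qed

end

section \<open>Interaction of two scales on a square-integrable function\<close>

locale dyadic_kernels_fun = dyadic_kernels K q C
  for K :: "nat \<Rightarrow> 'a::euclidean_space \<Rightarrow> real" and q C :: real +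
  fixes u :: "'a \<Rightarrow> real"
  assumes u[measurable]: "u \<in> borel_measurable borel" and u2: "integrable lborel (\<lambda>x. (u x)\<^sup>2)"
begin

text \<open>The part of the Gagliardo energy carried by differences over distances of order \<open>1 / 2 ^ j\<close>.\<close>

definition e where "e j = (A * q) ^ j * (\<integral>h. indicator (ball_dyadic j) h * sq_shift u h \<partial>lborel)"

text \<open>By polarisation of \<open>energy_identity\<close> this is -2 times the L2 inner product
  of \<open>T j\<close> and \<open>T k\<close>.\<close>

definition form where
  "form j k = (\<integral>w. K k w * (\<integral>z. K j z * sq_shift u (z - w) \<partial>lborel) \<partial>lborel)"

definition T where "T j x = (\<integral>z. K j z * u (x - z) \<partial>lborel)"

lemma [measurable]: "sq_shift u \<in> borel_measurable borel"
  by (rule sq_shift_measurable[OF u u2])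

lemmas integrable_kernel = integrable_kernel_sq_shift[OF u u2]
lemmas rho_nonneg = sq_shift_nonneg[OF u u2]

lemma e_nonneg: "0 \<le> e j"
  unfolding e_def using A_pos q rho_nonneg
  by (intro mult_nonneg_nonneg zero_le_power Bochner_Integration.integral_nonneg) auto

lemma form_sym: "form j k = form k j"
proof -
  have "form j k = (\<integral>w. \<integral>z. K k w * K j z * sq_shift u (z - w) \<partial>lborel \<partial>lborel)"
    by (simp add: form_def mult.assoc)
  also have "\<dots> = (\<integral>z. \<integral>w. K k w * K j z * sq_shift u (z - w) \<partial>lborel \<partial>lborel)"
  proof (rule lborel_pair.Fubini_integral[symmetric])
    have "integrable (lborel \<Otimes>\<^sub>M lborel) (\<lambda>(w, z). K k w * K j z * (\<lambda>(w, z). sq_shift u (z - w)) (w, z))"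
      using rho_nonneg sq_shift_le[OF u u2]
      by (intro integrable_pair_kernel[OF u u2, where M = "4 * (\<integral>x. (u x)\<^sup>2 \<partial>lborel)"]) auto
    then show "integrable (lborel \<Otimes>\<^sub>M lborel) (\<lambda>(w, z). K k w * K j z * sq_shift u (z - w))" by simp
  qed
  also have "\<dots> = (\<integral>z. \<integral>w. K j z * (K k w * sq_shift u (w - z)) \<partial>lborel \<partial>lborel)"
    using sq_shift_uminus[OF u u2] by (intro Bochner_Integration.integral_cong refl) (metis minus_diff_eq mult.assoc mult.commute)
  finally show ?thesis by (simp add: form_def)
qed

text \<open>Almost orthogonality: the fine kernel \<open>K k\<close> is tested against increments of the coarse kernel
  \<open>K j\<close>, which gains \<open>2\<^sup>j / 2\<^sup>k\<close> and costs \<open>q ^ (k - j)\<close>.\<close>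

lemma form_bound:
  assumes "j \<le> k"
  shows "\<bar>form j k\<bar> \<le> C\<^sup>2 * V * (q / 2) ^ (k - j) * e j"
proof -
  define I where "I = (\<integral>h. indicator (ball_dyadic j) h * sq_shift u h \<partial>lborel)"
  have iI: "integrable lborel (\<lambda>h. indicator (ball_dyadic j) h * sq_shift u h)"
    using integrable_kernel(1)[of "indicator (ball_dyadic j)" 0] by simp
  have I0: "0 \<le> I" unfolding I_def using rho_nonneg by (intro Bochner_Integration.integral_nonneg) auto
  \<comment> \<open>\<open>sq_shift u\<close> is even and \<open>K j\<close> is odd. Subtracting
    this zero replaces the translated kernel by its increment, to which the Lipschitz bound
    applies.\<close>
  have odd0: "(\<integral>h. K j h * sq_shift u h \<partial>lborel) = 0"
    by (rule integral_odd_eq_0) (auto simp: odd sq_shift_uminus[OF u u2])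
  have inner: "\<bar>\<integral>z. K j z * sq_shift u (z - w) \<partial>lborel\<bar> \<le> C * (A * 2) ^ j * norm w * I"
    if w: "norm w \<le> 1 / 2 ^ k" for w
  proof -
    have "1 / 2 ^ k \<le> (1 / 2 ^ j :: real)"
      using assms by (intro divide_left_mono power_increasing) auto
    also have "\<dots> \<le> real DIM('a) / 2 ^ j" 
      using DIM_positive[where 'a='a] by (intro divide_right_mono) (auto simp: Suc_le_eq simp del: DIM_positive)
    finally have w': "norm w \<le> real DIM('a) / 2 ^ j" using w by linarith
    have iw: "integrable lborel (\<lambda>h. K j (h + w) * sq_shift u h)"
      using integrable_kernel(1)[of "K j" w] integrable_lborel_translate_iff[of "\<lambda>h. K j (h + w) * sq_shift u h" w]
      by simp
    have "(\<integral>z. K j z * sq_shift u (z - w) \<partial>lborel) = (\<integral>h. K j (h + w) * sq_shift u h \<partial>lborel)"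
      using integral_lborel_translate[of "\<lambda>h. K j (h + w) * sq_shift u h" w] by simp
    also have "\<dots> = (\<integral>h. (K j (h + w) - K j h) * sq_shift u h \<partial>lborel)"
      using odd0 iw integrable_kernel(1)[of "K j" 0] by (simp add: left_diff_distrib)
    finally have "\<bar>\<integral>z. K j z * sq_shift u (z - w) \<partial>lborel\<bar>
        \<le> (\<integral>h. C * (A * 2) ^ j * norm w * (indicator (ball_dyadic j) h * sq_shift u h) \<partial>lborel)"
    proof (simp only:, intro abs_integral_le)
      show "integrable lborel (\<lambda>h. C * (A * 2) ^ j * norm w * (indicator (ball_dyadic j) h * sq_shift u h))"
        by (intro integrable_mult_right iI)
      show "\<bar>(K j (h + w) - K j h) * sq_shift u h\<bar>
          \<le> C * (A * 2) ^ j * norm w * (indicator (ball_dyadic j) h * sq_shift u h)" for h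
        using mult_right_mono[OF K_increment[OF w', of h] rho_nonneg[of h]] rho_nonneg[of h]
        by (simp add: abs_mult mult.assoc)
    qed
    then show ?thesis by (simp add: I_def)
  qed
  have "\<bar>form j k\<bar> \<le> (\<integral>w. (C * (A * 2) ^ j * I) * (\<bar>K k w\<bar> * norm w) \<partial>lborel)"
    unfolding form_def
  proof (rule abs_integral_le)
    show "integrable lborel (\<lambda>w. (C * (A * 2) ^ j * I) * (\<bar>K k w\<bar> * norm w))"
      by (intro integrable_mult_right integrable_K_norm)
    fix w
    show "\<bar>K k w * (\<integral>z. K j z * sq_shift u (z - w) \<partial>lborel)\<bar> \<le> (C * (A * 2) ^ j * I) * (\<bar>K k w\<bar> * norm w)"
    proof (cases "1 / 2 ^ k < norm w")
      case True
      then show ?thesis by (simp add: supp)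
    next
      case False
      then have "\<bar>K k w\<bar> * \<bar>\<integral>z. K j z * sq_shift u (z - w) \<partial>lborel\<bar> \<le> \<bar>K k w\<bar> * (C * (A * 2) ^ j * norm w * I)"
        by (intro mult_left_mono inner) auto
      then show ?thesis by (simp add: abs_mult mult_ac)
    qed
  qed
  also have "\<dots> = (C * (A * 2) ^ j * I) * (\<integral>w. \<bar>K k w\<bar> * norm w \<partial>lborel)"
    by simp
  also have "\<dots> \<le> (C * (A * 2) ^ j * I) * (C * V * (q / 2) ^ k)"
    using C A_pos I0 by (intro mult_left_mono integral_K_norm_le) auto
  \<comment> \<open>The split-off factor \<open>(q / 2) ^ j\<close> cancels the \<open>2 ^ j\<close>
    of the Lipschitz constant and leaves \<open>(A * q) ^ j\<close>. This is the origin of the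
    normalisation of \<open>e j\<close>.\<close>
  also have "(q / 2) ^ k = (q / 2) ^ (k - j) * (q / 2) ^ j"
    using assms by (simp flip: power_add)
  also have "(C * (A * 2) ^ j * I) * (C * V * ((q / 2) ^ (k - j) * (q / 2) ^ j))
      = C\<^sup>2 * V * (q / 2) ^ (k - j) * ((A * q) ^ j * I)"
    by (simp add: power_mult_distrib power_divide power2_eq_square)
  finally show ?thesis by (simp add: e_def I_def)
qed

lemma T_integrable: "integrable lborel (\<lambda>z. K j z * u (x - z))"
  using integrable_conv_bounded_support[OF _ u u2 K_bound K_outside, where c = 0] by simp

lemma T_measurable[measurable]: "T j \<in> borel_measurable borel"
  unfolding T_def by measurable

text \<open>The summed kernel is again odd, so the energy identity applies to it and expands into
  the terms \<open>form j k\<close>. Arbitrary finite index sets are allowed so that blocks of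
  partial sums are controlled by tails of \<open>e\<close>.\<close>

lemma energy_sum:
  assumes "finite I"
  shows "integrable lborel (\<lambda>x. (\<Sum>j\<in>I. T j x)\<^sup>2)"
    and "(\<integral>x. (\<Sum>j\<in>I. T j x)\<^sup>2 \<partial>lborel) \<le> C\<^sup>2 * V / (1 - q / 2) * (\<Sum>j\<in>I. e j)"
proof -
  define H where "H z = (\<Sum>j\<in>I. K j z)" for z
  have H: "integrable lborel H" unfolding H_def by simp
  have H_odd: "H (- z) = - H z" for z by (simp add: H_def odd sum_negf)
  have F: "(\<Sum>j\<in>I. T j x) = (\<integral>z. H z * u (x - z) \<partial>lborel)" for x
    using T_integrable by (simp add: T_def H_def sum_distrib_right)
  show "integrable lborel (\<lambda>x. (\<Sum>j\<in>I. T j x)\<^sup>2)"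
    unfolding F by (rule energy_identity[OF u u2 H H_odd])
  have inner: "(\<integral>z. H z * sq_shift u (z - w) \<partial>lborel) = (\<Sum>j\<in>I. \<integral>z. K j z * sq_shift u (z - w) \<partial>lborel)" for w
    using integrable_kernel(1)[OF K_integrable] by (simp add: H_def sum_distrib_right)
  have i: "integrable lborel (\<lambda>w. K k w * (\<integral>z. K j z * sq_shift u (z - w) \<partial>lborel))" for j k
  proof -
    have "integrable (lborel \<Otimes>\<^sub>M lborel) (\<lambda>(w, z). K k w * K j z * (\<lambda>(w, z). sq_shift u (z - w)) (w, z))"
      using rho_nonneg sq_shift_le[OF u u2]
      by (intro integrable_pair_kernel[OF u u2, where M = "4 * (\<integral>x. (u x)\<^sup>2 \<partial>lborel)"]) auto
    then have "integrable lborel (\<lambda>w. \<integral>z. K k w * K j z * sq_shift u (z - w) \<partial>lborel)"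
      by (intro lborel_pair.integrable_fst) simp
    then show ?thesis by (simp add: mult.assoc)
  qed
  have "(\<integral>w. H w * (\<integral>z. H z * sq_shift u (z - w) \<partial>lborel) \<partial>lborel)
      = (\<integral>w. (\<Sum>j\<in>I. \<Sum>k\<in>I. K k w * (\<integral>z. K j z * sq_shift u (z - w) \<partial>lborel)) \<partial>lborel)"
    by (simp only: inner, simp only: H_def sum_distrib_left sum_distrib_right)
  also have "\<dots> = (\<Sum>j\<in>I. \<Sum>k\<in>I. form j k)"
    using i by (simp add: form_def)
  finally have "(\<integral>x. (\<Sum>j\<in>I. T j x)\<^sup>2 \<partial>lborel) = - (\<Sum>j\<in>I. \<Sum>k\<in>I. form j k) / 2"
    unfolding F by (subst energy_identity(2)[OF u u2 H H_odd]) simp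
  also have "\<dots> \<le> (\<Sum>j\<in>I. \<Sum>k\<in>I. \<bar>form j k\<bar>) / 2"
  proof -
    have "- (\<Sum>j\<in>I. \<Sum>k\<in>I. form j k) = (\<Sum>j\<in>I. \<Sum>k\<in>I. - form j k)" by (simp add: sum_negf)
    also have "\<dots> \<le> (\<Sum>j\<in>I. \<Sum>k\<in>I. \<bar>form j k\<bar>)" by (intro sum_mono) simp
    finally show ?thesis by simp
  qed
  also have "\<dots> \<le> (2 * (C\<^sup>2 * V) / (1 - q / 2) * (\<Sum>j\<in>I. e j)) / 2"
    using q C V_nonneg e_nonneg form_bound form_sym assms
    by (intro divide_right_mono sum_geometric_offdiagonal_le) auto
  finally show "(\<integral>x. (\<Sum>j\<in>I. T j x)\<^sup>2 \<partial>lborel) \<le> C\<^sup>2 * V / (1 - q / 2) * (\<Sum>j\<in>I. e j)"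
    using q by (simp add: field_simps)
qed

end

section \<open>Limits in \<open>L\<^sup>2\<close> and Lebesgue differentiation\<close>

text \<open>Riesz--Fischer with a rate, stated for differences and for honest functions. A fast
  subsequence converges almost everywhere, and Fatou's lemma carries the bound
  \<open>\<eta> m\<close> over to its limit.\<close>

lemma L2_Cauchy_limit:
  fixes f :: "nat \<Rightarrow> 'a \<Rightarrow> real"
  assumes [measurable]: "\<And>n. f n \<in> borel_measurable M"
    and int: "\<And>m n. integrable M (\<lambda>x. (f m x - f n x)\<^sup>2)"
    and le: "\<And>m n. m \<le> n \<Longrightarrow> (\<integral>x. (f m x - f n x)\<^sup>2 \<partial>M) \<le> \<eta> m"
    and \<eta>: "\<eta> \<longlonglongrightarrow> (0::real)"
  obtains g where "g \<in> borel_measurable M" "\<And>m. integrable M (\<lambda>x. (f m x - g x)\<^sup>2)"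
    "\<And>m. (\<integral>x. (f m x - g x)\<^sup>2 \<partial>M) \<le> \<eta> m"
proof -
  have "\<exists>n. \<forall>m\<ge>n. \<eta> m \<le> (1 / 4) ^ k" for k
    using order_tendstoD(2)[OF \<eta>, of "(1 / 4) ^ k"] by (auto simp: eventually_sequentially intro: less_imp_le)
  then obtain n where n: "\<And>k m. n k \<le> m \<Longrightarrow> \<eta> m \<le> (1 / 4) ^ k" by metis
  \<comment> \<open>Summation makes \<open>r\<close> monotone and at least \<open>n k\<close>; the
    added \<open>k\<close> makes it at least \<open>k\<close>, so it passes every index
    \<open>m\<close> in the Fatou argument.\<close>
  define r where "r k = (\<Sum>i\<le>k. n i) + k" for k
  have r_le: "r k \<le> r (Suc k)" for k by (simp add: r_def)
  have r_ge: "k \<le> r k" for k by (simp add: r_def)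
  have r_eta: "\<eta> (r k) \<le> (1 / 4) ^ k" for k
    using member_le_sum[of k "{..k}" n] by (intro n) (simp add: r_def)
  define d where "d k x = f (r k) x - f (r (Suc k)) x" for k x
  have [measurable]: "d k \<in> borel_measurable M" for k unfolding d_def by measurable
  \<comment> \<open>The weight \<open>2 ^ k\<close> serves two needs. Against
    \<open>\<eta> (r k) \<le> (1 / 4) ^ k\<close> the weighted squares keep a summable integral, and
    pointwise \<open>\<bar>d\<bar> \<le> (1 / 2) ^ k + 2 ^ k * d\<^sup>2\<close> then bounds the
    increments by a summable sequence.\<close>
  have "(\<integral>\<^sup>+x. (\<Sum>k. ennreal (2 ^ k * (d k x)\<^sup>2)) \<partial>M) = (\<Sum>k. \<integral>\<^sup>+x. ennreal (2 ^ k * (d k x)\<^sup>2) \<partial>M)"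
    by (rule nn_integral_suminf) measurable
  also have "\<dots> \<le> (\<Sum>k. ennreal ((1 / 2) ^ k))"
  proof (intro suminf_le)
    fix k
    have "(\<integral>x. 2 ^ k * (d k x)\<^sup>2 \<partial>M) \<le> 2 ^ k * (1 / 4) ^ k"
      using le[OF r_le, of k] r_eta[of k] by (simp add: d_def)
    also have "\<dots> = (1 / 2) ^ k" by (simp flip: power_mult_distrib)
    finally show "(\<integral>\<^sup>+x. ennreal (2 ^ k * (d k x)\<^sup>2) \<partial>M) \<le> ennreal ((1 / 2) ^ k)"
      using int by (subst nn_integral_eq_integral) (auto simp: d_def ennreal_leI)
  qed auto
  also have "\<dots> < \<infinity>"
    by (subst suminf_ennreal2) (auto intro: summable_geometric)
  finally have "(\<integral>\<^sup>+x. (\<Sum>k. ennreal (2 ^ k * (d k x)\<^sup>2)) \<partial>M) \<noteq> \<infinity>" by simp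
  then have "AE x in M. (\<Sum>k. ennreal (2 ^ k * (d k x)\<^sup>2)) \<noteq> \<infinity>"
    by (intro nn_integral_PInf_AE) measurable
  then have conv: "AE x in M. convergent (\<lambda>k. f (r k) x)"
  proof eventually_elim
    case (elim x)
    then have "summable (\<lambda>k. 2 ^ k * (d k x)\<^sup>2)"
      by (intro summable_suminf_not_top) auto
    then have "summable (\<lambda>k. (1 / 2) ^ k + 2 ^ k * (d k x)\<^sup>2)"
      by (intro summable_add summable_geometric) auto
    moreover have "norm (d k x) \<le> (1 / 2) ^ k + 2 ^ k * (d k x)\<^sup>2" for k
      using mult_left_mono[OF abs_le_one_plus_square[of "2 ^ k * d k x"], of "(1 / 2) ^ k"]
      by (simp add: abs_mult distrib_left power_mult_distrib field_simps power2_eq_square)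
    ultimately have "summable (\<lambda>k. d k x)"
      by (intro summable_comparison_test[of "\<lambda>k. d k x"]) auto
    then have "convergent (\<lambda>m. \<Sum>k<m. d k x)"
      by (simp add: summable_iff_convergent)
    moreover have "(\<Sum>k<m. d k x) = f (r 0) x - f (r m) x" for m
      unfolding d_def by (rule sum_lessThan_telescope')
    ultimately have "convergent (\<lambda>m. f (r 0) x - f (r m) x)" by simp
    then obtain l where "(\<lambda>m. f (r 0) x - f (r m) x) \<longlonglongrightarrow> l" by (auto simp: convergent_def)
    then have "(\<lambda>m. f (r 0) x - (f (r 0) x - f (r m) x)) \<longlonglongrightarrow> f (r 0) x - l"
      by (intro tendsto_diff tendsto_const)
    then show ?case by (auto simp: convergent_def)
  qed
  \<comment> \<open>On the null set where the subsequence diverges, \<open>lim\<close> takes some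
    unspecified value; \<open>g\<close> is measurable all the same.\<close>
  define g where "g x = lim (\<lambda>k. f (r k) x)" for x
  have g[measurable]: "g \<in> borel_measurable M" unfolding g_def by measurable
  have bound: "(\<integral>\<^sup>+x. ennreal ((f m x - g x)\<^sup>2) \<partial>M) \<le> ennreal (\<eta> m)" for m
  proof -
    have "(\<integral>\<^sup>+x. ennreal ((f m x - g x)\<^sup>2) \<partial>M)
        = (\<integral>\<^sup>+x. liminf (\<lambda>k. ennreal ((f m x - f (r k) x)\<^sup>2)) \<partial>M)"
    proof (rule nn_integral_cong_AE)
      show "AE x in M. ennreal ((f m x - g x)\<^sup>2) = liminf (\<lambda>k. ennreal ((f m x - f (r k) x)\<^sup>2))"
        using conv
      proof eventually_elim
        case (elim x)
        then have "(\<lambda>k. f (r k) x) \<longlonglongrightarrow> g x" by (simp add: g_def convergent_LIMSEQ_iff)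
        then have "(\<lambda>k. ennreal ((f m x - f (r k) x)\<^sup>2)) \<longlonglongrightarrow> ennreal ((f m x - g x)\<^sup>2)"
          by (intro tendsto_intros)
        from lim_imp_Liminf[OF _ this] show ?case by simp
      qed
    qed
    also have "\<dots> \<le> liminf (\<lambda>k. \<integral>\<^sup>+x. ennreal ((f m x - f (r k) x)\<^sup>2) \<partial>M)"
      by (rule nn_integral_liminf) measurable
    also have "\<dots> \<le> liminf (\<lambda>k. ennreal (\<eta> m))"
    proof (rule Liminf_mono)
      show "\<forall>\<^sub>F k in sequentially. (\<integral>\<^sup>+x. ennreal ((f m x - f (r k) x)\<^sup>2) \<partial>M) \<le> ennreal (\<eta> m)"
        using eventually_ge_at_top[of m]
      proof eventually_elim
        case (elim k)
        then have "m \<le> r k" using r_ge[of k] by simp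
        from le[OF this] show ?case using int by (subst nn_integral_eq_integral) (auto simp: ennreal_leI)
      qed
    qed
    also have "\<dots> = ennreal (\<eta> m)" by (simp add: Liminf_const)
    finally show ?thesis .
  qed
  have \<eta>0: "0 \<le> \<eta> m" for m using le[of m m] by simp
  have ig: "integrable M (\<lambda>x. (f m x - g x)\<^sup>2)" for m
    using bound[of m] by (intro integrableI_nonneg) (auto simp: le_less_trans)
  have "(\<integral>x. (f m x - g x)\<^sup>2 \<partial>M) \<le> \<eta> m" for m
    using bound[of m] ig[of m] \<eta>0[of m] by (subst (asm) nn_integral_eq_integral) auto
  with g ig show thesis by (rule that)
qed

lemma abs_le_weighted_square:
  fixes a \<theta> :: real
  assumes "0 < \<theta>" shows "\<bar>a\<bar> \<le> \<theta> + a\<^sup>2 / \<theta>"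
  using mult_left_mono[OF abs_le_one_plus_square[of "a / \<theta>"], of \<theta>] assms
  by (simp add: distrib_left power_divide power2_eq_square)

text \<open>Replaces Cauchy--Schwarz in passing to limits: a bound valid for every
  \<open>\<theta>\<close> behaves like one by the square root of \<open>g\<close>. The parameter is
  fixed first to make \<open>\<theta> * c\<close> small, and then \<open>g\<close> tends to
  0.\<close>

lemma tendsto_0_if_le_weighted:
  fixes f g :: "'a \<Rightarrow> real"
  assumes g: "(g \<longlongrightarrow> 0) F" and f: "\<And>x. 0 \<le> f x"
    and le: "\<And>x \<theta>. 0 < \<theta> \<Longrightarrow> f x \<le> \<theta> * c + g x / \<theta> * d"
  shows "(f \<longlongrightarrow> 0) F"
proof (rule tendstoI)
  fix \<epsilon> :: real assume "0 < \<epsilon>"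
  define \<theta> where "\<theta> = \<epsilon> / (2 * (\<bar>c\<bar> + 1))"
  have \<theta>: "0 < \<theta>" using \<open>0 < \<epsilon>\<close> by (simp add: \<theta>_def)
  have "\<theta> * c \<le> \<theta> * (\<bar>c\<bar> + 1)" using \<theta> by (intro mult_left_mono) auto
  also have "\<dots> = \<epsilon> / 2" by (simp add: \<theta>_def field_simps)
  finally have c: "\<theta> * c \<le> \<epsilon> / 2" .
  have "((\<lambda>x. g x / \<theta> * d) \<longlongrightarrow> 0 / \<theta> * d) F"
    using \<theta> by (intro tendsto_intros g) auto
  then have "\<forall>\<^sub>F x in F. g x / \<theta> * d < \<epsilon> / 2"
    using \<open>0 < \<epsilon>\<close> by (intro order_tendstoD) auto
  then show "\<forall>\<^sub>F x in F. dist (f x) 0 < \<epsilon>"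
  proof eventually_elim
    case (elim x)
    then show ?case using le[OF \<theta>, of x] c f[of x] unfolding dist_norm real_norm_def by linarith
  qed
qed

text \<open>The weights \<open>2 ^ j / 2 ^ n\<close> have total mass below 1, and any fixed initial
  block of them dies out. Such averages arise because a coarse scale \<open>j\<close> varies by a
  factor \<open>2 ^ j / 2 ^ n\<close> over distance \<open>1 / 2 ^ n\<close>.\<close>

lemma tendsto_geometric_average_0:
  fixes a :: "nat \<Rightarrow> real"
  assumes a: "a \<longlonglongrightarrow> 0" and a0: "\<And>j. 0 \<le> a j"
  shows "(\<lambda>n. (\<Sum>j<n. 2 ^ j * a j) / 2 ^ n) \<longlonglongrightarrow> 0"
proof (rule tendstoI)
  fix \<epsilon> :: real assume \<epsilon>: "0 < \<epsilon>"
  then obtain N where N: "\<And>j. N \<le> j \<Longrightarrow> a j < \<epsilon> / 2"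
    using order_tendstoD(2)[OF a, of "\<epsilon> / 2"] by (auto simp: eventually_sequentially)
  define S where "S = (\<Sum>j<N. 2 ^ j * a j)"
  have "(\<lambda>n. S / 2 ^ n) \<longlonglongrightarrow> 0"
    using tendsto_mult_right_zero[OF LIMSEQ_power_zero[of "1 / 2 :: real"], of S] by (simp add: power_divide)
  then have "\<forall>\<^sub>F n in sequentially. S / 2 ^ n < \<epsilon> / 2"
    using \<epsilon> by (intro order_tendstoD) auto
  then show "\<forall>\<^sub>F n in sequentially. dist ((\<Sum>j<n. 2 ^ j * a j) / 2 ^ n) 0 < \<epsilon>"
    using eventually_ge_at_top[of N]
  proof eventually_elim
    case (elim n)
    have "(\<Sum>j<n. 2 ^ j * a j) = S + (\<Sum>j=N..<n. 2 ^ j * a j)"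
      using elim(2) by (simp add: S_def sum.atLeastLessThan_concat flip: atLeast0LessThan)
    also have "(\<Sum>j=N..<n. 2 ^ j * a j) \<le> (\<Sum>j=N..<n. 2 ^ j * (\<epsilon> / 2))"
      using N by (intro sum_mono mult_left_mono) (auto intro: less_imp_le)
    also have "\<dots> \<le> (\<Sum>j<n. 2 ^ j * (\<epsilon> / 2))"
      using \<epsilon> by (intro sum_mono2) auto
    also have "\<dots> = (2 ^ n - 1) * (\<epsilon> / 2)"
      unfolding sum_distrib_right[symmetric] by (simp add: geometric_sum)
    also have "\<dots> \<le> 2 ^ n * (\<epsilon> / 2)" using \<epsilon> by simp
    finally have "(\<Sum>j<n. 2 ^ j * a j) / 2 ^ n \<le> (S + 2 ^ n * (\<epsilon> / 2)) / 2 ^ n"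
      by (intro divide_right_mono) auto
    also have "\<dots> = S / 2 ^ n + \<epsilon> / 2" by (simp add: add_divide_distrib)
    finally have "(\<Sum>j<n. 2 ^ j * a j) / 2 ^ n < \<epsilon>" using elim(1) by linarith
    moreover have "0 \<le> (\<Sum>j<n. 2 ^ j * a j) / 2 ^ n" using a0 by (intro divide_nonneg_pos sum_nonneg) auto
    ultimately show ?case by simp
  qed
qed

section \<open>Differentiation along kernels carried by cubes\<close>

lemma norm_le_cbox_One:
  fixes w :: "'a::euclidean_space"
  assumes "w \<in> cbox 0 (h *\<^sub>R One)"
  shows "norm w \<le> real DIM('a) * h"
proof -
  have "norm w \<le> (\<Sum>b\<in>Basis. \<bar>w \<bullet> b\<bar>)" by (rule norm_le_l1)
  also have "\<dots> \<le> (\<Sum>b\<in>(Basis::'a set). h)"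
    using assms by (intro sum_mono) (simp add: mem_box)
  finally show ?thesis by simp
qed

text \<open>A kernel of height at most \<open>D\<close> over the volume of its cube is dominated by
  the mean over that cube. The support is reflected so that \<open>x - w\<close> runs through cubes
  with a corner at \<open>x\<close>, along which the integral is differentiated.\<close>

lemma lebesgue_differentiation_kernel:
  fixes g :: "'a::euclidean_space \<Rightarrow> real" and \<phi> :: "nat \<Rightarrow> 'a \<Rightarrow> real"
  assumes [measurable]: "g \<in> borel_measurable borel" and g2: "integrable lborel (\<lambda>x. (g x)\<^sup>2)"
    and [measurable]: "\<And>j. \<phi> j \<in> borel_measurable borel"
    and bound: "\<And>j w. \<bar>\<phi> j w\<bar> \<le> D * (2 ^ DIM('a)) ^ j"
    and supp: "\<And>j w. - w \<notin> cbox 0 ((1 / 2 ^ j) *\<^sub>R One) \<Longrightarrow> \<phi> j w = 0"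
    and int1: "\<And>j. (\<integral>w. \<phi> j w \<partial>lborel) = 1"
  shows "AE x in lborel. (\<lambda>j. \<integral>w. \<phi> j w * g (x - w) \<partial>lborel) \<longlonglongrightarrow> g x"
proof -
  have D: "0 \<le> D" using bound[of 0 0] by simp
  have iset: "integrable lborel (\<lambda>y. indicator (cbox a b) y * \<bar>g y - c\<bar>)" for a b :: 'a and c
  proof (rule Bochner_Integration.integrable_bound)
    show "integrable lborel (\<lambda>y. (1 + \<bar>c\<bar>) * indicator (cbox a b) y + (g y)\<^sup>2)"
      using emeasure_lborel_cbox_finite[of a b]
      by (intro Bochner_Integration.integrable_add integrable_mult_right g2 integrable_real_indicator) auto
    show "AE y in lborel. norm (indicator (cbox a b) y * \<bar>g y - c\<bar>) \<le> norm ((1 + \<bar>c\<bar>) * indicator (cbox a b) y + (g y)\<^sup>2)"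
    proof (intro AE_I2)
      fix y
      show "norm (indicator (cbox a b) y * \<bar>g y - c\<bar>) \<le> norm ((1 + \<bar>c\<bar>) * indicator (cbox a b) y + (g y)\<^sup>2)"
        using abs_le_one_plus_square[of "g y"] by (cases "y \<in> cbox a b") auto
    qed
  qed simp
  have seti: "set_integrable lborel (cbox a b) (\<lambda>y. \<bar>g y - c\<bar>)" for a b :: 'a and c
    using iset by (simp add: set_integrable_def)
  have HK: "(\<lambda>y. \<bar>g y - c\<bar>) integrable_on cbox a b" for a b :: 'a and c
    using set_borel_integral_eq_integral(1)[OF seti] .
  have HK_eq: "integral (cbox a b) (\<lambda>y. \<bar>g y - c\<bar>) = (\<integral>y. indicator (cbox a b) y * \<bar>g y - c\<bar> \<partial>lborel)" for a b :: 'a and c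
    using set_borel_integral_eq_integral(2)[OF seti, of a b c] by (simp add: set_lebesgue_integral_def)
  have "\<exists>N. negligible N \<and> (\<forall>x e. x \<notin> N \<longrightarrow> 0 < e \<longrightarrow> (\<exists>d>0. \<forall>h. 0 < h \<and> h < d \<longrightarrow>
      norm (integral (cbox x (x + h *\<^sub>R One)) (\<lambda>y. \<bar>g y - c\<bar>) /\<^sub>R h ^ DIM('a) - \<bar>g x - c\<bar>) < e))" for c
    using integrable_ccontinuous_explicit[OF HK, of c] by metis
  then obtain N where N: "\<And>c. negligible (N c)"
    "\<And>c x e. x \<notin> N c \<Longrightarrow> 0 < e \<Longrightarrow> \<exists>d>0. \<forall>h. 0 < h \<and> h < d \<longrightarrow>
      norm (integral (cbox x (x + h *\<^sub>R One)) (\<lambda>y. \<bar>g y - c\<bar>) /\<^sub>R h ^ DIM('a) - \<bar>g x - c\<bar>) < e"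
    by metis
  \<comment> \<open>The exceptional set depends on \<open>c\<close>. Rational \<open>c\<close> keep
    the union negligible, and a rational close to \<open>g x\<close> turns the statements about
    \<open>\<bar>g - c\<bar>\<close> into the Lebesgue point property at \<open>x\<close>.\<close>
  have "negligible (\<Union>c\<in>\<rat>. N c)"
    using N(1) by (intro negligible_countable_Union) (auto simp: countable_rat)
  then have "AE x in lebesgue. x \<notin> (\<Union>c\<in>\<rat>. N c)"
    unfolding negligible_iff_null_sets by (rule AE_not_in)
  then have "AE x in lborel. x \<notin> (\<Union>c\<in>\<rat>. N c)"
    by (simp add: AE_completion_iff)
  then show ?thesis
  proof eventually_elim
    case (elim x)
    show ?case
    proof (rule tendstoI)
      fix \<epsilon> :: real assume "0 < \<epsilon>"
      \<comment> \<open>The error will be at most \<open>D * (2 * \<epsilon>')\<close> from the mean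
        over the cube plus less than \<open>\<epsilon>'\<close> from replacing \<open>g x\<close> by
        a rational.\<close>
      define \<epsilon>' where "\<epsilon>' = \<epsilon> / (2 * D + 2)"
      have \<epsilon>': "0 < \<epsilon>'" and \<epsilon>'_eq: "(2 * D + 2) * \<epsilon>' = \<epsilon>" using \<open>0 < \<epsilon>\<close> D by (auto simp: \<epsilon>'_def)
      obtain c where c: "c \<in> \<rat>" "\<bar>g x - c\<bar> < \<epsilon>'"
        using Rats_dense_in_real[of "g x - \<epsilon>'" "g x + \<epsilon>'"] \<epsilon>' by (auto simp: abs_less_iff)
      with elim have "x \<notin> N c" by auto
      from N(2)[OF this \<epsilon>'] obtain d where d: "0 < d" "\<And>h. 0 < h \<Longrightarrow> h < d \<Longrightarrow>
        norm (integral (cbox x (x + h *\<^sub>R One)) (\<lambda>y. \<bar>g y - c\<bar>) /\<^sub>R h ^ DIM('a) - \<bar>g x - c\<bar>) < \<epsilon>'" by auto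
      have "(\<lambda>j. (1 / 2 :: real) ^ j) \<longlonglongrightarrow> 0" by (intro LIMSEQ_power_zero) simp
      then have "\<forall>\<^sub>F j in sequentially. (1 / 2 :: real) ^ j < d"
        using d(1) by (rule order_tendstoD)
      then show "\<forall>\<^sub>F j in sequentially. dist (\<integral>w. \<phi> j w * g (x - w) \<partial>lborel) (g x) < \<epsilon>"
      proof eventually_elim
        case (elim j)
        define Q where "Q = cbox x (x + (1 / 2 ^ j) *\<^sub>R One)"
        define I where "I = (\<integral>y. indicator Q y * \<bar>g y - c\<bar> \<partial>lborel)"
        have "norm (I /\<^sub>R (1 / 2 ^ j) ^ DIM('a) - \<bar>g x - c\<bar>) < \<epsilon>'"
          using d(2)[of "1 / 2 ^ j"] elim by (simp add: I_def Q_def HK_eq power_one_over)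
        moreover have "I /\<^sub>R (1 / 2 ^ j) ^ DIM('a) = (2 ^ DIM('a)) ^ j * I"
          by (simp add: power_one_over inverse_eq_divide mult.commute flip: power_mult)
        ultimately have "\<bar>(2 ^ DIM('a)) ^ j * I - \<bar>g x - c\<bar>\<bar> < \<epsilon>'"
          by (simp only: real_norm_def)
        then have avg: "(2 ^ DIM('a)) ^ j * I < 2 * \<epsilon>'" using c by linarith
        have x_in: "x - w \<notin> Q \<Longrightarrow> \<phi> j w = 0" for w
        proof (rule supp)
          assume "x - w \<notin> Q"
          then obtain b where "b \<in> Basis" "\<not> (x \<bullet> b \<le> (x - w) \<bullet> b \<and> (x - w) \<bullet> b \<le> (x + (1 / 2 ^ j) *\<^sub>R One) \<bullet> b)"
            unfolding Q_def mem_box by blast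
          then show "- w \<notin> cbox 0 ((1 / 2 ^ j) *\<^sub>R One)"
            by (fastforce simp: mem_box inner_diff_left inner_add_left)
        qed
        have le: "\<bar>\<phi> j w * (g (x - w) - c)\<bar> \<le> D * (2 ^ DIM('a)) ^ j * (indicator Q (x - w) * \<bar>g (x - w) - c\<bar>)" for w
          using bound[of j w] x_in[of w] by (cases "x - w \<in> Q") (auto simp: abs_mult mult_right_mono)
        have iQ: "integrable lborel (\<lambda>w. indicator Q (x - w) * \<bar>g (x - w) - c\<bar>)"
          using integrable_lborel_reflect_iff[of "\<lambda>y. indicator Q y * \<bar>g y - c\<bar>" x] iset by (simp add: Q_def)
        have b0: "\<phi> j w = 0" if "w \<notin> cball 0 (real DIM('a) * (1 / 2 ^ j))" for w
          using that norm_le_cbox_One[of "- w" "1 / 2 ^ j"] by (intro supp) auto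
        have i1: "integrable lborel (\<lambda>w. \<phi> j w * (g (x - w) - c))"
          by (rule integrable_conv_bounded_support[OF _ _ g2 bound b0]) auto
        have i2: "integrable lborel (\<phi> j)"
          by (rule integrable_bounded_support[OF _ bound b0]) auto
        have "(\<integral>w. \<phi> j w * g (x - w) \<partial>lborel) = (\<integral>w. \<phi> j w * (g (x - w) - c) + c * \<phi> j w \<partial>lborel)"
          by (simp add: algebra_simps)
        also have "\<dots> = (\<integral>w. \<phi> j w * (g (x - w) - c) \<partial>lborel) + c"
          using i1 i2 int1[of j] by simp
        finally have "\<bar>(\<integral>w. \<phi> j w * g (x - w) \<partial>lborel) - g x\<bar>
            \<le> \<bar>\<integral>w. \<phi> j w * (g (x - w) - c) \<partial>lborel\<bar> + \<bar>g x - c\<bar>" by linarith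
        also have "\<bar>\<integral>w. \<phi> j w * (g (x - w) - c) \<partial>lborel\<bar>
            \<le> (\<integral>w. D * (2 ^ DIM('a)) ^ j * (indicator Q (x - w) * \<bar>g (x - w) - c\<bar>) \<partial>lborel)"
          by (intro abs_integral_le integrable_mult_right iQ le)
        also have "\<dots> = D * ((2 ^ DIM('a)) ^ j * I)"
          using integral_lborel_reflect[of "\<lambda>y. indicator Q y * \<bar>g y - c\<bar>" x]
          by (simp add: I_def Q_def mult.assoc)
        also have "\<dots> \<le> D * (2 * \<epsilon>')" using avg D by (intro mult_left_mono) auto
        finally have "\<bar>(\<integral>w. \<phi> j w * g (x - w) \<partial>lborel) - g x\<bar> < (2 * D + 2) * \<epsilon>'"
          using c \<epsilon>' by (simp add: algebra_simps)
        then show ?case by (simp add: dist_real_def \<epsilon>'_eq)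
      qed
    qed
  qed
qed

text \<open>Dilates of one Lipschitz tent, normalised to integral 1. Sharp averages over cubes would
  do for differentiation; the Lipschitz bound is there because the fine scales are tested against
  increments of the averaging kernel.\<close>

lemma bump_kernels_exist:
  obtains \<phi> :: "nat \<Rightarrow> 'a::euclidean_space \<Rightarrow> real" and D :: real where
    "0 \<le> D" "\<And>j w. 0 \<le> \<phi> j w" "\<And>j w. \<phi> j w \<le> D * (2 ^ DIM('a)) ^ j"
    "\<And>j w z. \<bar>\<phi> j w - \<phi> j z\<bar> \<le> D * (2 ^ DIM('a) * 2) ^ j * norm (w - z)"
    "\<And>j w. - w \<notin> cbox 0 ((1 / 2 ^ j) *\<^sub>R One) \<Longrightarrow> \<phi> j w = 0"
    "\<And>j. (\<integral>w. \<phi> j w \<partial>lborel) = 1"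
proof -
  \<comment> \<open>\<open>- m\<close> is the centre of the reflected unit cube, and the tent of
    radius \<open>1 / 2\<close> around it fits inside.\<close>
  define m :: 'a where "m = (1 / 2) *\<^sub>R One"
  define p where "p w = max 0 (1 / 2 - norm (w + m))" for w :: 'a
  have p0: "0 \<le> p w" and p1: "p w \<le> 1" for w by (auto simp: p_def intro: order_trans[of _ "1 / 2"])
  have p_lip: "\<bar>p w - p z\<bar> \<le> norm (w - z)" for w z
    using norm_triangle_ineq3[of "w + m" "z + m"] by (auto simp: p_def max_def)
  have p_supp: "p w = 0" if "- w \<notin> cbox 0 One" for w
  proof (rule ccontr)
    assume "p w \<noteq> 0"
    then have "norm (w + m) < 1 / 2" by (auto simp: p_def max_def split: if_splits)
    then have "\<bar>(w + m) \<bullet> b\<bar> < 1 / 2" if "b \<in> Basis" for b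
      using Basis_le_norm[OF that, of "w + m"] by linarith
    then have "\<bar>w \<bullet> b + 1 / 2\<bar> < 1 / 2" if "b \<in> Basis" for b
      using that by (simp add: m_def inner_add_left)
    then have "0 \<le> - (w \<bullet> b) \<and> - (w \<bullet> b) \<le> 1" if "b \<in> Basis" for b
      using that by (smt (verit) field_sum_of_halves)
    then have "- w \<in> cbox 0 One" by (simp add: mem_box)
    with that show False by simp
  qed
  have p_cont: "continuous_on UNIV p" unfolding p_def by (intro continuous_intros)
  have [measurable]: "p \<in> borel_measurable borel"
    by (rule borel_measurable_continuous_onI[OF p_cont])
  have ip: "integrable lborel p"
  proof (rule integrable_bounded_support)
    show "\<bar>p w\<bar> \<le> 1" for w using p0[of w] p1[of w] by simp
    show "p w = 0" if "w \<notin> cball 0 (real DIM('a) * 1)" for w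
      using that norm_le_cbox_One[of "- w" 1] by (intro p_supp) auto
  qed simp
  define c where "c = (\<integral>w. p w \<partial>lborel)"
  have "0 < c"
  proof -
    have "(\<integral>w. 1 / 4 * indicator (cball (- m) (1 / 4)) w \<partial>lborel) \<le> c"
      unfolding c_def
    proof (intro integral_mono ip integrable_mult_right integrable_real_indicator)
      show "1 / 4 * indicator (cball (- m) (1 / 4)) w \<le> p w" for w
        by (auto simp: p_def indicator_def dist_norm norm_minus_commute add.commute max_def)
    qed (use emeasure_lborel_cball_finite[of "- m" "1 / 4"] in auto)
    then have "1 / 4 * measure lborel (cball (- m) (1 / 4)) \<le> c" by simp
    moreover have "0 < measure lborel (cball (- m) (1 / 4))" by (subst content_cball_gt_0_iff) simp
    ultimately show ?thesis by linarith
  qed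
  define \<phi> where "\<phi> j w = (2 ^ DIM('a)) ^ j / c * p (2 ^ j *\<^sub>R w)" for j :: nat and w
  show thesis
  proof (rule that[of "1 / c" \<phi>])
    show "0 \<le> \<phi> j w" "\<phi> j w \<le> 1 / c * (2 ^ DIM('a)) ^ j" for j w
      using p0 p1[of "2 ^ j *\<^sub>R w"] \<open>0 < c\<close> by (auto simp: \<phi>_def divide_right_mono)
    show "\<bar>\<phi> j w - \<phi> j z\<bar> \<le> 1 / c * (2 ^ DIM('a) * 2) ^ j * norm (w - z)" for j w z
    proof -
      have "\<bar>\<phi> j w - \<phi> j z\<bar> = (2 ^ DIM('a)) ^ j / c * \<bar>p (2 ^ j *\<^sub>R w) - p (2 ^ j *\<^sub>R z)\<bar>"
        using \<open>0 < c\<close> by (simp add: \<phi>_def abs_mult abs_divide flip: right_diff_distrib diff_divide_distrib)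
      also have "\<dots> \<le> (2 ^ DIM('a)) ^ j / c * (2 ^ j * norm (w - z))"
        using p_lip[of "2 ^ j *\<^sub>R w" "2 ^ j *\<^sub>R z"] \<open>0 < c\<close>
        by (intro mult_left_mono) (auto simp flip: scaleR_diff_right)
      finally show ?thesis by (simp add: power_mult_distrib)
    qed
    show "\<phi> j w = 0" if "- w \<notin> cbox 0 ((1 / 2 ^ j) *\<^sub>R One)" for j w
    proof -
      have "- (2 ^ j *\<^sub>R w) \<notin> cbox 0 One"
      proof -
        have "\<exists>b\<in>Basis. \<not> (0 \<le> - (w \<bullet> b) \<and> - (w \<bullet> b) \<le> 1 / 2 ^ j)"
          by (rule ccontr) (use that in \<open>simp add: mem_box\<close>)
        then obtain b where b: "b \<in> Basis" "\<not> (0 \<le> - (w \<bullet> b) \<and> - (w \<bullet> b) \<le> 1 / 2 ^ j)" ..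
        then have "\<not> (0 \<le> - (2 ^ j * (w \<bullet> b)) \<and> - (2 ^ j * (w \<bullet> b)) \<le> 1)"
          by (auto simp: field_simps mult_le_0_iff not_le)
        with b(1) show ?thesis by (auto simp: mem_box)
      qed
      then show ?thesis by (simp add: \<phi>_def p_supp)
    qed
    show "(\<integral>w. \<phi> j w \<partial>lborel) = 1" for j
    proof -
      have "c = (\<integral>w. p w \<partial>density (distr lborel borel (\<lambda>w. 0 + 2 ^ j *\<^sub>R w)) (\<lambda>_. ennreal (\<bar>2 ^ j\<bar> ^ DIM('a))))"
        unfolding c_def by (subst (1) lborel_affine[of "2 ^ j" 0]) auto
      also have "\<dots> = (\<integral>w. \<bar>2 ^ j\<bar> ^ DIM('a) * p (2 ^ j *\<^sub>R w) \<partial>lborel)"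
        by (subst integral_density) (auto simp: integral_distr)
      finally show ?thesis
        using \<open>0 < c\<close> by (auto simp: \<phi>_def power_mult[symmetric] mult.commute)
    qed
  qed (use \<open>0 < c\<close> in auto)
qed

section \<open>Pointwise control by oscillations\<close>

context dyadic_kernels_fun
begin

lemma ball_dyadic_borel[measurable]: "ball_dyadic j \<in> sets borel" by simp

definition S where "S J x = (\<Sum>j<J. T j x)"

text \<open>Up to the constant \<open>V\<close> this is \<open>q ^ j\<close> times the mean of
  \<open>\<bar>u (x - z) - u x\<bar>\<close> over the ball. The squared version \<open>osc2\<close>
  has the weight \<open>q ^ (2 * j)\<close> instead, which makes its integral over \<open>x\<close>
  equal to \<open>e j\<close>.\<close>

definition osc where
  "osc j x = A ^ j * (\<integral>z. indicator (ball_dyadic j) z * \<bar>u (x - z) - u x\<bar> \<partial>lborel)"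

definition osc2 where
  "osc2 j x = (A * q) ^ j * (\<integral>z. indicator (ball_dyadic j) z * (u (x - z) - u x)\<^sup>2 \<partial>lborel)"

lemma integrable_ball_diff:
  shows "integrable lborel (\<lambda>z. indicator (ball_dyadic j) z * \<bar>u (x - z) - u x\<bar>)"
    and "integrable lborel (\<lambda>z. indicator (ball_dyadic j) z * (u (x - z) - u x)\<^sup>2)"
proof -
  have i: "integrable lborel (\<lambda>z. indicator (ball_dyadic j) z * (u (x - z) - c))" for c
    by (rule integrable_conv_bounded_support[where M = 1 and \<rho> = "R / 2 ^ j"])
      (auto simp: u2 indicator_def)
  have "integrable lborel (\<lambda>z. \<bar>indicator (ball_dyadic j) z * (u (x - z) - u x)\<bar>)"
    by (intro integrable_abs i)
  then show "integrable lborel (\<lambda>z. indicator (ball_dyadic j) z * \<bar>u (x - z) - u x\<bar>)"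
    by (simp add: abs_mult)
  have "integrable lborel (\<lambda>z. indicator (ball_dyadic j) z * (u (x - z))\<^sup>2)"
  proof (rule Bochner_Integration.integrable_bound)
    show "integrable lborel (\<lambda>z. (u (x - z))\<^sup>2)"
      using integrable_lborel_reflect_iff[of "\<lambda>y. (u y)\<^sup>2" x] u2 by simp
  qed (auto simp: indicator_def)
  moreover have "(\<lambda>z. indicator (ball_dyadic j) z * (u (x - z) - u x)\<^sup>2) =
      (\<lambda>z. indicator (ball_dyadic j) z * (u (x - z))\<^sup>2 - 2 * u x * (indicator (ball_dyadic j) z * (u (x - z) - 0))
        + (u x)\<^sup>2 * indicator (ball_dyadic j) z)"
    by (auto simp: power2_diff algebra_simps)
  ultimately show "integrable lborel (\<lambda>z. indicator (ball_dyadic j) z * (u (x - z) - u x)\<^sup>2)"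
    using i[of 0] by (simp only:) (intro Bochner_Integration.integrable_add Bochner_Integration.integrable_diff integrable_mult_right integrable_indicator_ball)
qed

lemma osc_nonneg: "0 \<le> osc j x" and osc2_nonneg: "0 \<le> osc2 j x"
  using A_pos q by (auto simp: osc_def osc2_def intro!: mult_nonneg_nonneg Bochner_Integration.integral_nonneg)

text \<open>The linearised form of \<open>osc\<^sup>2 \<le> V * osc2\<close>. The choice
  \<open>t = \<theta> / q ^ j\<close> in the proof balances the weights \<open>A ^ j\<close> and
  \<open>(A * q) ^ j\<close>.\<close>

lemma osc_le:
  assumes "0 < \<theta>"
  shows "osc j x \<le> \<theta> * V + osc2 j x / \<theta> * 1"
proof -
  define t where "t = \<theta> / q ^ j"
  have t: "0 < t" using assms q by (simp add: t_def)
  have "osc j x \<le> A ^ j * (\<integral>z. t * indicator (ball_dyadic j) z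
      + 1 / t * (indicator (ball_dyadic j) z * (u (x - z) - u x)\<^sup>2) \<partial>lborel)"
    unfolding osc_def using A_pos
  proof (intro mult_left_mono integral_mono integrable_ball_diff Bochner_Integration.integrable_add integrable_mult_right integrable_indicator_ball)
    fix z
    show "indicator (ball_dyadic j) z * \<bar>u (x - z) - u x\<bar>
        \<le> t * indicator (ball_dyadic j) z + 1 / t * (indicator (ball_dyadic j) z * (u (x - z) - u x)\<^sup>2)"
      using abs_le_weighted_square[OF t, of "u (x - z) - u x"] by (cases "z \<in> ball_dyadic j") auto
  qed auto
  also have "\<dots> = A ^ j * (t * (V / (2 ^ DIM('a)) ^ j) + 1 / t * (\<integral>z. indicator (ball_dyadic j) z * (u (x - z) - u x)\<^sup>2 \<partial>lborel))"
    using integrable_ball_diff(2)[of j x] integral_indicator_ball[of j] by simp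
  also have "\<dots> = \<theta> * V + osc2 j x / \<theta> * 1"
  proof -
    have alg: "X * Y * (\<theta> / Y * (V' / X) + 1 / (\<theta> / Y) * I) = \<theta> * V' + X * Y * Y * I / \<theta>"
      if "0 < X" "0 < Y" for X Y I V' :: real
      using that assms by (simp add: field_simps)
    show ?thesis
      using alg[of "(2 ^ DIM('a)) ^ j" "q ^ j" V] q by (simp add: osc2_def t_def A_def power_mult_distrib)
  qed
  finally show ?thesis .
qed

lemma osc_tendsto_0: "(\<lambda>j. osc2 j x) \<longlonglongrightarrow> 0 \<Longrightarrow> (\<lambda>j. osc j x) \<longlonglongrightarrow> 0"
  by (rule tendsto_0_if_le_weighted[where g = "\<lambda>j. osc2 j x" and c = V and d = 1])
    (simp_all only: osc_nonneg osc_le)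

lemma osc2_measurable[measurable]: "osc2 j \<in> borel_measurable borel"
  unfolding osc2_def by measurable

lemma nn_integral_osc2: "(\<integral>\<^sup>+x. ennreal (osc2 j x) \<partial>lborel) = ennreal (e j)"
proof -
  have Aq: "0 \<le> (A * q) ^ j" using A_pos q by simp
  have "(\<integral>\<^sup>+x. ennreal (osc2 j x) \<partial>lborel)
      = (\<integral>\<^sup>+x. ennreal ((A * q) ^ j) * (\<integral>\<^sup>+z. ennreal (indicator (ball_dyadic j) z * (u (x - z) - u x)\<^sup>2) \<partial>lborel) \<partial>lborel)"
  proof (intro nn_integral_cong)
    fix x
    show "ennreal (osc2 j x) = ennreal ((A * q) ^ j) * (\<integral>\<^sup>+z. ennreal (indicator (ball_dyadic j) z * (u (x - z) - u x)\<^sup>2) \<partial>lborel)"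
      using integrable_ball_diff(2)[of j x]
      by (subst nn_integral_eq_integral) (auto simp: osc2_def ennreal_mult'[OF Aq])
  qed
  also have "\<dots> = ennreal ((A * q) ^ j) * (\<integral>\<^sup>+x. (\<integral>\<^sup>+z. ennreal (indicator (ball_dyadic j) z * (u (x - z) - u x)\<^sup>2) \<partial>lborel) \<partial>lborel)"
    by (rule nn_integral_cmult) measurable
  also have "(\<integral>\<^sup>+x. (\<integral>\<^sup>+z. ennreal (indicator (ball_dyadic j) z * (u (x - z) - u x)\<^sup>2) \<partial>lborel) \<partial>lborel)
      = (\<integral>\<^sup>+z. (\<integral>\<^sup>+x. ennreal (indicator (ball_dyadic j) z * (u (x - z) - u x)\<^sup>2) \<partial>lborel) \<partial>lborel)"
    by (rule lborel_pair.Fubini') measurable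
  also have "\<dots> = (\<integral>\<^sup>+z. ennreal (indicator (ball_dyadic j) z * sq_shift u z) \<partial>lborel)"
  proof (intro nn_integral_cong)
    fix z
    have "(\<integral>\<^sup>+x. ennreal (indicator (ball_dyadic j) z * (u (x - z) - u x)\<^sup>2) \<partial>lborel)
        = ennreal (\<integral>x. indicator (ball_dyadic j) z * (u x - u (x - z))\<^sup>2 \<partial>lborel)"
      using integrable_sq_diff[OF u u2, of z]
      by (subst nn_integral_eq_integral[symmetric]) (auto simp: power2_commute)
    then show "(\<integral>\<^sup>+x. ennreal (indicator (ball_dyadic j) z * (u (x - z) - u x)\<^sup>2) \<partial>lborel)
        = ennreal (indicator (ball_dyadic j) z * sq_shift u z)"
      by (simp add: sq_shift_def)
  qed
  also have "\<dots> = ennreal (\<integral>z. indicator (ball_dyadic j) z * sq_shift u z \<partial>lborel)"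
    using rho_nonneg integrable_kernel(1)[of "indicator (ball_dyadic j)" 0]
    by (intro nn_integral_eq_integral) auto
  finally show ?thesis by (simp add: e_def ennreal_mult'[OF Aq])
qed

text \<open>Since \<open>osc2 j\<close> has integral \<open>e j\<close>, its sum over
  \<open>j\<close> is finite at almost every point, and the terms of a convergent series tend to
  0.\<close>

lemma AE_osc_tendsto_0:
  assumes "summable e"
  shows "AE x in lborel. (\<lambda>j. osc j x) \<longlonglongrightarrow> 0"
proof -
  have "(\<integral>\<^sup>+x. (\<Sum>j. ennreal (osc2 j x)) \<partial>lborel) = (\<Sum>j. ennreal (e j))"
    by (subst nn_integral_suminf) (auto simp: nn_integral_osc2)
  also have "\<dots> \<noteq> \<infinity>"
    using assms e_nonneg by (simp add: suminf_ennreal2)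
  finally have "AE x in lborel. (\<Sum>j. ennreal (osc2 j x)) \<noteq> \<infinity>"
    by (intro nn_integral_PInf_AE) auto
  then show ?thesis
  proof eventually_elim
    case (elim x)
    then have "summable (\<lambda>j. osc2 j x)"
      using osc2_nonneg by (intro summable_suminf_not_top) auto
    then show ?case by (intro osc_tendsto_0 summable_LIMSEQ_zero)
  qed
qed

text \<open>The shift is moved onto the kernel. The increment of the kernel has mean zero, so
  \<open>u x\<close> may be subtracted and only the oscillation remains. This is the estimate for
  scales coarser than the averaging.\<close>

lemma T_diff_le:
  assumes "norm w \<le> real DIM('a) / 2 ^ j"
  shows "\<bar>T j (x - w) - T j x\<bar> \<le> C * 2 ^ j * norm w * osc j x"
proof -
  have i1: "integrable lborel (\<lambda>z. K j (z - w) * u (x - z))"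
    using T_integrable[of j "x - w"] integrable_lborel_translate_iff[of "\<lambda>z. K j z * u (x - w - z)" w]
    by (simp add: algebra_simps)
  have iK: "integrable lborel (\<lambda>z. K j (z - w))"
    using integrable_lborel_translate_iff[of "K j" w] by simp
  have z: "(\<integral>z. K j (z - w) - K j z \<partial>lborel) = 0"
    using integral_lborel_translate[of "K j" w] iK by (simp add: integral_K)
  have "T j (x - w) = (\<integral>z. K j (z - w) * u (x - z) \<partial>lborel)"
    using integral_lborel_translate[of "\<lambda>z. K j z * u (x - w - z)" w] by (simp add: T_def algebra_simps)
  then have "T j (x - w) - T j x = (\<integral>z. (K j (z - w) - K j z) * u (x - z) \<partial>lborel) - u x * (\<integral>z. K j (z - w) - K j z \<partial>lborel)"
    using i1 T_integrable z by (simp add: T_def left_diff_distrib)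
  also have "\<dots> = (\<integral>z. (K j (z - w) - K j z) * u (x - z) - u x * (K j (z - w) - K j z) \<partial>lborel)"
    using i1 T_integrable iK by (simp add: left_diff_distrib)
  also have "\<dots> = (\<integral>z. (K j (z - w) - K j z) * (u (x - z) - u x) \<partial>lborel)"
    by (simp add: algebra_simps)
  finally have "\<bar>T j (x - w) - T j x\<bar> \<le> (\<integral>z. C * (A * 2) ^ j * norm w * (indicator (ball_dyadic j) z * \<bar>u (x - z) - u x\<bar>) \<partial>lborel)"
  proof (simp only:, intro abs_integral_le)
    show "integrable lborel (\<lambda>z. C * (A * 2) ^ j * norm w * (indicator (ball_dyadic j) z * \<bar>u (x - z) - u x\<bar>))"
      by (intro integrable_mult_right integrable_ball_diff)
    show "\<bar>(K j (z - w) - K j z) * (u (x - z) - u x)\<bar>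
        \<le> C * (A * 2) ^ j * norm w * (indicator (ball_dyadic j) z * \<bar>u (x - z) - u x\<bar>)" for z
      using mult_right_mono[OF K_increment[of "- w" j z], of "\<bar>u (x - z) - u x\<bar>"] assms
      by (simp add: abs_mult mult.assoc)
  qed
  then show ?thesis by (simp add: osc_def power_mult_distrib mult_ac)
qed

text \<open>The estimate for scales finer than the averaging. Convolutions commute, so
  \<open>K j\<close> acts on the average of \<open>u\<close> against \<open>\<phi>\<close>; that
  average is Lipschitz at scale \<open>J\<close>, and the mean-zero kernel \<open>K j\<close> sees
  only its increments.\<close>

lemma bump_T_le:
  assumes [measurable]: "\<phi> \<in> borel_measurable borel"
    and D: "0 \<le> D" and bound: "\<And>w. \<bar>\<phi> w\<bar> \<le> M"
    and lip: "\<And>w z. \<bar>\<phi> w - \<phi> z\<bar> \<le> D * (2 ^ DIM('a) * 2) ^ J * norm (w - z)"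
    and supp': "\<And>w. w \<notin> cball 0 (real DIM('a) / 2 ^ J) \<Longrightarrow> \<phi> w = 0"
    and "J \<le> j"
  shows "\<bar>\<integral>w. \<phi> w * T j (x - w) \<partial>lborel\<bar> \<le> C * V * D * (q / 2) ^ (j - J) * osc J x"
proof -
  have ip: "integrable lborel \<phi>" by (rule integrable_bounded_support[OF _ bound supp']) auto
  \<comment> \<open>\<open>K j\<close> annihilates constants, so \<open>u\<close> may be recentred
    at its value at \<open>x\<close>. This is how the oscillation about \<open>x\<close>
    enters.\<close>
  define h where "h z = u z - u x" for z
  have [measurable]: "h \<in> borel_measurable borel" unfolding h_def by measurable
  have Th: "T j y = (\<integral>z. K j z * h (y - z) \<partial>lborel)" for y
    using T_integrable[of j y] by (simp add: T_def h_def right_diff_distrib integral_K)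
  have iT: "integrable lborel (\<lambda>z. K j z * h (y - z))" for y
    using T_integrable[of j y] by (simp add: h_def right_diff_distrib)
  \<comment> \<open>The bound does not depend on \<open>y\<close>; integrated against
    \<open>\<bar>\<phi>\<bar>\<close> it gives the absolute convergence required by Fubini.\<close>
  have bd: "(\<integral>z. \<bar>K j z * h (y - z)\<bar> \<partial>lborel) \<le> (1 + \<bar>u x\<bar>) * (\<integral>z. \<bar>K j z\<bar> \<partial>lborel) + C * A ^ j * (\<integral>z. (u z)\<^sup>2 \<partial>lborel)" for y
  proof -
    have iu: "integrable lborel (\<lambda>z. (u (y - z))\<^sup>2)"
      using integrable_lborel_reflect_iff[of "\<lambda>x. (u x)\<^sup>2" y] u2 by simp
    have "(\<integral>z. \<bar>K j z * h (y - z)\<bar> \<partial>lborel) \<le> (\<integral>z. (1 + \<bar>u x\<bar>) * \<bar>K j z\<bar> + C * A ^ j * (u (y - z))\<^sup>2 \<partial>lborel)"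
    proof (intro integral_mono integrable_abs iT Bochner_Integration.integrable_add integrable_mult_right iu K_integrable)
      fix z
      have "\<bar>h (y - z)\<bar> \<le> (1 + \<bar>u x\<bar>) + (u (y - z))\<^sup>2"
        using abs_le_one_plus_square[of "u (y - z)"] by (simp add: h_def)
      then have "\<bar>K j z * h (y - z)\<bar> \<le> \<bar>K j z\<bar> * ((1 + \<bar>u x\<bar>) + (u (y - z))\<^sup>2)"
        by (simp add: abs_mult mult_left_mono)
      also have "\<dots> \<le> (1 + \<bar>u x\<bar>) * \<bar>K j z\<bar> + C * A ^ j * (u (y - z))\<^sup>2"
        using mult_right_mono[OF K_bound[of j z], of "(u (y - z))\<^sup>2"] by (simp add: algebra_simps)
      finally show "\<bar>K j z * h (y - z)\<bar> \<le> (1 + \<bar>u x\<bar>) * \<bar>K j z\<bar> + C * A ^ j * (u (y - z))\<^sup>2" .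
    qed
    also have "\<dots> = (1 + \<bar>u x\<bar>) * (\<integral>z. \<bar>K j z\<bar> \<partial>lborel) + C * A ^ j * (\<integral>z. (u z)\<^sup>2 \<partial>lborel)"
      using integral_lborel_reflect[of "\<lambda>x. (u x)\<^sup>2" y] iu by simp
    finally show ?thesis .
  qed
  have i2: "integrable (lborel \<Otimes>\<^sub>M lborel) (\<lambda>(w, z). \<phi> w * (K j z * h (x - w - z)))"
  proof (rule lborel_pair.Fubini_integrable[rotated])
    show "AE w in lborel. integrable lborel (\<lambda>z. case (w, z) of (w, z) \<Rightarrow> \<phi> w * (K j z * h (x - w - z)))"
      using iT by simp
    show "integrable lborel (\<lambda>w. \<integral>z. norm (case (w, z) of (w, z) \<Rightarrow> \<phi> w * (K j z * h (x - w - z))) \<partial>lborel)"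
    proof (rule Bochner_Integration.integrable_bound)
      show "integrable lborel (\<lambda>w. ((1 + \<bar>u x\<bar>) * (\<integral>z. \<bar>K j z\<bar> \<partial>lborel) + C * A ^ j * (\<integral>z. (u z)\<^sup>2 \<partial>lborel)) * \<phi> w)"
        using ip by (rule integrable_mult_right)
      show "AE w in lborel. norm (\<integral>z. norm (case (w, z) of (w, z) \<Rightarrow> \<phi> w * (K j z * h (x - w - z))) \<partial>lborel)
          \<le> norm (((1 + \<bar>u x\<bar>) * (\<integral>z. \<bar>K j z\<bar> \<partial>lborel) + C * A ^ j * (\<integral>z. (u z)\<^sup>2 \<partial>lborel)) * \<phi> w)"
      proof (intro AE_I2)
        fix w
        have "(\<integral>z. norm (\<phi> w * (K j z * h (x - w - z))) \<partial>lborel) = \<bar>\<phi> w\<bar> * (\<integral>z. \<bar>K j z * h (x - w - z)\<bar> \<partial>lborel)"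
          by (subst integral_mult_right_zero[symmetric]) (simp add: abs_mult)
        also have "\<dots> \<le> \<bar>\<phi> w\<bar> * ((1 + \<bar>u x\<bar>) * (\<integral>z. \<bar>K j z\<bar> \<partial>lborel) + C * A ^ j * (\<integral>z. (u z)\<^sup>2 \<partial>lborel))"
          by (intro mult_left_mono bd) auto
        also have "\<dots> \<le> norm (((1 + \<bar>u x\<bar>) * (\<integral>z. \<bar>K j z\<bar> \<partial>lborel) + C * A ^ j * (\<integral>z. (u z)\<^sup>2 \<partial>lborel)) * \<phi> w)"
          by (simp add: abs_mult mult.commute[of "\<bar>\<phi> w\<bar>"] mult_right_mono)
        finally show "norm (\<integral>z. norm (case (w, z) of (w, z) \<Rightarrow> \<phi> w * (K j z * h (x - w - z))) \<partial>lborel)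
          \<le> norm (((1 + \<bar>u x\<bar>) * (\<integral>z. \<bar>K j z\<bar> \<partial>lborel) + C * A ^ j * (\<integral>z. (u z)\<^sup>2 \<partial>lborel)) * \<phi> w)"
          by simp
      qed
    qed measurable
  qed measurable
  have J: "1 / 2 ^ j \<le> (1 / 2 ^ J :: real)"
    using \<open>J \<le> j\<close> by (intro divide_left_mono power_increasing) auto
  have ih: "integrable lborel (\<lambda>w. k w * h (x - w))" if "k \<in> borel_measurable borel" "\<And>w. \<bar>k w\<bar> \<le> M'"
      "\<And>w. w \<notin> cball 0 \<rho> \<Longrightarrow> k w = 0" for k M' \<rho>
    unfolding h_def using that by (intro integrable_conv_bounded_support[OF _ _ u2, where M = M' and \<rho> = \<rho>]) auto
  define c where "c = (\<integral>w. \<phi> w * h (x - w) \<partial>lborel)"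
  have inner: "\<bar>(\<integral>w. \<phi> w * h (x - w - z) \<partial>lborel) - c\<bar> \<le> D * 2 ^ J / q ^ J * osc J x * norm z"
    if z: "norm z \<le> 1 / 2 ^ j" for z
  proof -
    have out: "\<phi> (w - z) = 0" "\<phi> w = 0" if "w \<notin> ball_dyadic J" for w
    proof -
      have "R / 2 ^ J < norm w" using that by simp
      then have *: "real DIM('a) / 2 ^ J + 1 / 2 ^ J < norm w" by (simp add: R_def add_divide_distrib)
      then have "real DIM('a) / 2 ^ J < norm (w - z)"
        using norm_triangle_ineq2[of w z] z J by linarith
      then show "\<phi> (w - z) = 0" by (intro supp') auto
      have "0 \<le> 1 / (2::real) ^ J" by simp
      then have "real DIM('a) / 2 ^ J < norm w" using * by linarith
      then show "\<phi> w = 0" by (intro supp') auto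
    qed
    have i1: "integrable lborel (\<lambda>w. \<phi> (w - z) * h (x - w))"
      using bound out by (intro ih[where M' = M and \<rho> = "R / 2 ^ J"]) auto
    have i2: "integrable lborel (\<lambda>w. \<phi> w * h (x - w))"
      using bound out by (intro ih[where M' = M and \<rho> = "R / 2 ^ J"]) auto
    have "(\<integral>w. \<phi> w * h (x - w - z) \<partial>lborel) = (\<integral>w. \<phi> (w - z) * h (x - w) \<partial>lborel)"
      using integral_lborel_translate[of "\<lambda>w. \<phi> w * h (x - w - z)" z] by (simp add: algebra_simps)
    then have "(\<integral>w. \<phi> w * h (x - w - z) \<partial>lborel) - c = (\<integral>w. (\<phi> (w - z) - \<phi> w) * h (x - w) \<partial>lborel)"
      using i1 i2 by (simp add: c_def left_diff_distrib)
    then have "\<bar>(\<integral>w. \<phi> w * h (x - w - z) \<partial>lborel) - c\<bar> = \<bar>\<integral>w. (\<phi> (w - z) - \<phi> w) * h (x - w) \<partial>lborel\<bar>"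
      by simp
    also have "\<dots> \<le> (\<integral>w. D * (2 ^ DIM('a) * 2) ^ J * norm z * (indicator (ball_dyadic J) w * \<bar>u (x - w) - u x\<bar>) \<partial>lborel)"
    proof (intro abs_integral_le integrable_mult_right integrable_ball_diff)
      fix w
      show "\<bar>(\<phi> (w - z) - \<phi> w) * h (x - w)\<bar>
          \<le> D * (2 ^ DIM('a) * 2) ^ J * norm z * (indicator (ball_dyadic J) w * \<bar>u (x - w) - u x\<bar>)"
        using out[of w] mult_right_mono[OF lip[of "w - z" w], of "\<bar>h (x - w)\<bar>"]
        by (cases "w \<in> ball_dyadic J") (auto simp: abs_mult h_def)
    qed
    also have "\<dots> = D * 2 ^ J / q ^ J * osc J x * norm z"
      using q by (simp add: osc_def A_def power_mult_distrib)
    finally show ?thesis .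
  qed
  have "(\<integral>w. \<phi> w * T j (x - w) \<partial>lborel) = (\<integral>w. \<integral>z. \<phi> w * (K j z * h (x - w - z)) \<partial>lborel \<partial>lborel)"
    by (simp add: Th)
  also have "\<dots> = (\<integral>z. \<integral>w. \<phi> w * (K j z * h (x - w - z)) \<partial>lborel \<partial>lborel)"
    by (rule lborel_pair.Fubini_integral[OF i2, symmetric])
  also have "\<dots> = (\<integral>z. \<integral>w. K j z * (\<phi> w * h (x - w - z)) \<partial>lborel \<partial>lborel)"
    by (intro Bochner_Integration.integral_cong refl) (simp add: mult_ac)
  also have "\<dots> = (\<integral>z. K j z * (\<integral>w. \<phi> w * h (x - w - z) \<partial>lborel) \<partial>lborel) - c * (\<integral>z. K j z \<partial>lborel)"
    by (simp add: integral_K)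
  also have "\<dots> = (\<integral>z. K j z * ((\<integral>w. \<phi> w * h (x - w - z) \<partial>lborel) - c) \<partial>lborel)"
  proof -
    have "integrable lborel (\<lambda>z. \<integral>w. \<phi> w * (K j z * h (x - w - z)) \<partial>lborel)"
      by (rule lborel_pair.integrable_snd[OF i2])
    also have "(\<lambda>z. \<integral>w. \<phi> w * (K j z * h (x - w - z)) \<partial>lborel) = (\<lambda>z. \<integral>w. K j z * (\<phi> w * h (x - w - z)) \<partial>lborel)"
      by (intro ext Bochner_Integration.integral_cong refl) (simp add: mult_ac)
    finally have "integrable lborel (\<lambda>z. K j z * (\<integral>w. \<phi> w * h (x - w - z) \<partial>lborel))" by simp
    then show ?thesis by (simp add: right_diff_distrib mult.commute[of _ c])
  qed
  finally have "\<bar>\<integral>w. \<phi> w * T j (x - w) \<partial>lborel\<bar> \<le> (\<integral>z. D * 2 ^ J / q ^ J * osc J x * (\<bar>K j z\<bar> * norm z) \<partial>lborel)"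
  proof (simp only:, intro abs_integral_le integrable_mult_right integrable_K_norm)
    fix z
    show "\<bar>K j z * ((\<integral>w. \<phi> w * h (x - w - z) \<partial>lborel) - c)\<bar> \<le> D * 2 ^ J / q ^ J * osc J x * (\<bar>K j z\<bar> * norm z)"
    proof (cases "1 / 2 ^ j < norm z")
      case True
      then show ?thesis by (simp add: supp)
    next
      case False
      then show ?thesis
        using mult_left_mono[OF inner[of z], of "\<bar>K j z\<bar>"] by (simp add: abs_mult mult_ac)
    qed
  qed
  also have "\<dots> = D * 2 ^ J / q ^ J * osc J x * (\<integral>z. \<bar>K j z\<bar> * norm z \<partial>lborel)" by simp
  also have "\<dots> \<le> D * 2 ^ J / q ^ J * osc J x * (C * V * (q / 2) ^ j)"
    using D q osc_nonneg by (intro mult_left_mono integral_K_norm_le) auto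
  \<comment> \<open>The factor \<open>1 / q ^ J\<close> came from expressing the increment through
    \<open>osc J x\<close>, whose weight is \<open>A ^ J\<close>. With \<open>2 ^ J\<close> and the
    split-off \<open>(q / 2) ^ J\<close> it multiplies to 1.\<close>
  also have "(q / 2) ^ j = (q / 2) ^ (j - J) * (q / 2) ^ J"
    using \<open>J \<le> j\<close> by (simp flip: power_add)
  also have "D * 2 ^ J / q ^ J * osc J x * (C * V * ((q / 2) ^ (j - J) * (q / 2) ^ J))
      = C * V * D * (q / 2) ^ (j - J) * osc J x"
    using q by (simp add: power_divide)
  finally show ?thesis .
qed

section \<open>From L2 convergence to pointwise convergence of the partial sums\<close>

lemma S_measurable[measurable]: "S J \<in> borel_measurable borel"
  unfolding S_def by measurable

lemma T_square_integrable: "integrable lborel (\<lambda>x. (T j x)\<^sup>2)"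
  using energy_sum(1)[of "{j}"] by simp

lemma S_diff_eq: "m \<le> n \<Longrightarrow> S n x - S m x = (\<Sum>j=m..<n. T j x)"
  by (simp add: S_def sum_diff_nat_ivl flip: atLeast0LessThan)

lemma S_diff_integrable: "integrable lborel (\<lambda>x. (S m x - S n x)\<^sup>2)"
proof (cases "m \<le> n")
  case True
  then have "(\<lambda>x. (S m x - S n x)\<^sup>2) = (\<lambda>x. (\<Sum>j=m..<n. T j x)\<^sup>2)"
    by (simp add: S_diff_eq[symmetric] power2_commute)
  then show ?thesis using energy_sum(1)[of "{m..<n}"] by simp
next
  case False
  then have "(\<lambda>x. (S m x - S n x)\<^sup>2) = (\<lambda>x. (\<Sum>j=n..<m. T j x)\<^sup>2)"
    by (simp add: S_diff_eq)
  then show ?thesis using energy_sum(1)[of "{n..<m}"] by simp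
qed

text \<open>The bound does not depend on \<open>n\<close>, which permits passing to the L2 limit.
  Scales \<open>j < J\<close> hardly vary over the support of the bump and give a geometric average
  of oscillations; scales from \<open>J\<close> on nearly cancel and give a geometric series in
  \<open>q / 2\<close>.\<close>

lemma bump_S_le:
  fixes \<phi> :: "nat \<Rightarrow> 'a \<Rightarrow> real"
  assumes D: "0 \<le> D" and \<phi>0: "\<And>j w. 0 \<le> \<phi> j w" and \<phi>1: "\<And>j w. \<phi> j w \<le> D * (2 ^ DIM('a)) ^ j"
    and lip: "\<And>j w z. \<bar>\<phi> j w - \<phi> j z\<bar> \<le> D * (2 ^ DIM('a) * 2) ^ j * norm (w - z)"
    and out: "\<And>j w. w \<notin> cball 0 (real DIM('a) / 2 ^ j) \<Longrightarrow> \<phi> j w = 0"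
    and int1: "\<And>j. (\<integral>w. \<phi> j w \<partial>lborel) = 1"
    and "J \<le> n"
  shows "\<bar>(\<integral>w. \<phi> J w * S n (x - w) \<partial>lborel) - S J x\<bar>
    \<le> C * real DIM('a) * ((\<Sum>j<J. 2 ^ j * osc j x) / 2 ^ J) + C * V * D / (1 - q / 2) * osc J x"
proof -
  have [measurable]: "\<phi> j \<in> borel_measurable borel" for j
    using lip D by (intro borel_measurable_lipschitz[of "\<phi> j" "D * (2 ^ DIM('a) * 2) ^ j"]) auto
  have bound: "\<bar>\<phi> j w\<bar> \<le> D * (2 ^ DIM('a)) ^ j" for j w using \<phi>0 \<phi>1 by simp
  have i: "integrable lborel (\<phi> J)"
    by (rule integrable_bounded_support[OF _ bound out]) auto
  have iT: "integrable lborel (\<lambda>w. \<phi> J w * (T j (x - w) - c))" for j c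
    by (rule integrable_conv_bounded_support[OF _ _ T_square_integrable bound out]) auto
  have iT0: "integrable lborel (\<lambda>w. \<phi> J w * T j (x - w))" for j
    using iT[of j 0] by simp
  have coarse: "\<bar>(\<integral>w. \<phi> J w * T j (x - w) \<partial>lborel) - T j x\<bar> \<le> C * real DIM('a) / 2 ^ J * (2 ^ j * osc j x)"
    if "j < J" for j
  proof -
    have "(\<integral>w. \<phi> J w * T j (x - w) \<partial>lborel) - T j x = (\<integral>w. \<phi> J w * T j (x - w) \<partial>lborel) - T j x * (\<integral>w. \<phi> J w \<partial>lborel)"
      by (simp add: int1)
    also have "\<dots> = (\<integral>w. \<phi> J w * (T j (x - w) - T j x) \<partial>lborel)"
      using i iT0 by (simp add: right_diff_distrib mult.commute[of _ "T j x"])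
    finally have "\<bar>(\<integral>w. \<phi> J w * T j (x - w) \<partial>lborel) - T j x\<bar>
        = \<bar>\<integral>w. \<phi> J w * (T j (x - w) - T j x) \<partial>lborel\<bar>" by simp
    also have "\<dots> \<le> (\<integral>w. C * real DIM('a) / 2 ^ J * (2 ^ j * osc j x) * \<phi> J w \<partial>lborel)"
    proof (intro abs_integral_le integrable_mult_right i)
      fix w
      show "\<bar>\<phi> J w * (T j (x - w) - T j x)\<bar> \<le> C * real DIM('a) / 2 ^ J * (2 ^ j * osc j x) * \<phi> J w"
      proof (cases "w \<in> cball 0 (real DIM('a) / 2 ^ J)")
        case True
        then have w: "norm w \<le> real DIM('a) / 2 ^ J" by simp
        also have "\<dots> \<le> real DIM('a) / 2 ^ j"
          using \<open>j < J\<close> by (intro divide_left_mono power_increasing) auto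
        finally have "\<bar>T j (x - w) - T j x\<bar> \<le> C * 2 ^ j * norm w * osc j x" by (rule T_diff_le)
        also have "\<dots> \<le> C * 2 ^ j * (real DIM('a) / 2 ^ J) * osc j x"
          using w C osc_nonneg by (intro mult_right_mono mult_left_mono) auto
        also have "\<dots> = C * real DIM('a) / 2 ^ J * (2 ^ j * osc j x)" by simp
        finally show ?thesis
          using mult_right_mono[OF _ \<phi>0[of J w]] \<phi>0[of J w]
          by (simp only: abs_mult abs_of_nonneg mult.commute[of "\<phi> J w"])
      next
        case False
        have "\<phi> J w = 0" using False by (rule out)
        then show ?thesis by simp
      qed
    qed
    finally show ?thesis by (simp add: int1)
  qed
  have fine: "\<bar>\<integral>w. \<phi> J w * T j (x - w) \<partial>lborel\<bar> \<le> C * V * D * osc J x * (q / 2) ^ (j - J)" if "J \<le> j" for j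
    using bump_T_le[OF _ D bound lip out that] by (simp add: mult_ac)
  have "(\<integral>w. \<phi> J w * S n (x - w) \<partial>lborel) = (\<Sum>j<n. \<integral>w. \<phi> J w * T j (x - w) \<partial>lborel)"
    using iT0 by (simp add: S_def sum_distrib_left)
  also have "\<dots> = (\<Sum>j<J. \<integral>w. \<phi> J w * T j (x - w) \<partial>lborel) + (\<Sum>j=J..<n. \<integral>w. \<phi> J w * T j (x - w) \<partial>lborel)"
    using \<open>J \<le> n\<close> by (simp add: sum.atLeastLessThan_concat flip: atLeast0LessThan)
  finally have "(\<integral>w. \<phi> J w * S n (x - w) \<partial>lborel) - S J x
      = (\<Sum>j<J. (\<integral>w. \<phi> J w * T j (x - w) \<partial>lborel) - T j x) + (\<Sum>j=J..<n. \<integral>w. \<phi> J w * T j (x - w) \<partial>lborel)"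
    by (simp add: S_def sum_subtractf)
  then have "\<bar>(\<integral>w. \<phi> J w * S n (x - w) \<partial>lborel) - S J x\<bar>
      \<le> \<bar>\<Sum>j<J. (\<integral>w. \<phi> J w * T j (x - w) \<partial>lborel) - T j x\<bar> + \<bar>\<Sum>j=J..<n. \<integral>w. \<phi> J w * T j (x - w) \<partial>lborel\<bar>"
    by (simp only: abs_triangle_ineq)
  also have "\<bar>\<Sum>j<J. (\<integral>w. \<phi> J w * T j (x - w) \<partial>lborel) - T j x\<bar> \<le> (\<Sum>j<J. C * real DIM('a) / 2 ^ J * (2 ^ j * osc j x))"
    using coarse by (intro order_trans[OF sum_abs] sum_mono) auto
  also have "\<dots> = C * real DIM('a) * ((\<Sum>j<J. 2 ^ j * osc j x) / 2 ^ J)"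
    by (simp add: sum_distrib_left sum_divide_distrib mult_ac)
  also have "\<bar>\<Sum>j=J..<n. \<integral>w. \<phi> J w * T j (x - w) \<partial>lborel\<bar> \<le> (\<Sum>j=J..<n. C * V * D * osc J x * (q / 2) ^ (j - J))"
    using fine by (intro order_trans[OF sum_abs] sum_mono) auto
  also have "\<dots> = C * V * D * osc J x * (\<Sum>j<n - J. (q / 2) ^ j)"
    using \<open>J \<le> n\<close> sum.shift_bounds_nat_ivl[of "\<lambda>j. (q / 2) ^ (j - J)" 0 J "n - J"]
    by (simp add: atLeast0LessThan flip: sum_distrib_left)
  also have "\<dots> \<le> C * V * D * osc J x * (1 / (1 - q / 2))"
  proof (intro mult_left_mono)
    have "(\<Sum>j<n - J. (q / 2) ^ j) \<le> (\<Sum>j. (q / 2) ^ j)"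
      using q by (intro sum_le_suminf summable_geometric) auto
    also have "\<dots> = 1 / (1 - q / 2)" using q by (intro suminf_geometric) auto
    finally show "(\<Sum>j<n - J. (q / 2) ^ j) \<le> 1 / (1 - q / 2)" .
  qed (use C V_nonneg D osc_nonneg in auto)
  finally show ?thesis by (simp add: mult_ac)
qed

theorem AE_S_convergent:
  assumes e: "summable e"
  shows "AE x in lborel. convergent (\<lambda>J. S J x) \<and> (\<lambda>j. osc j x) \<longlonglongrightarrow> 0"
proof -
  obtain \<phi> :: "nat \<Rightarrow> 'a \<Rightarrow> real" and D where D: "0 \<le> D" and \<phi>0: "\<And>j w. 0 \<le> \<phi> j w"
    and \<phi>1: "\<And>j w. \<phi> j w \<le> D * (2 ^ DIM('a)) ^ j"
    and lip: "\<And>j w z. \<bar>\<phi> j w - \<phi> j z\<bar> \<le> D * (2 ^ DIM('a) * 2) ^ j * norm (w - z)"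
    and cube: "\<And>j w. - w \<notin> cbox 0 ((1 / 2 ^ j) *\<^sub>R One) \<Longrightarrow> \<phi> j w = 0"
    and int1: "\<And>j. (\<integral>w. \<phi> j w \<partial>lborel) = 1"
    by (rule bump_kernels_exist[where 'a = 'a]) (rule that)
  have [measurable]: "\<phi> j \<in> borel_measurable borel" for j
    using lip D by (intro borel_measurable_lipschitz[of "\<phi> j" "D * (2 ^ DIM('a) * 2) ^ j"]) auto
  have bound: "\<bar>\<phi> j w\<bar> \<le> D * (2 ^ DIM('a)) ^ j" for j w using \<phi>0 \<phi>1 by simp
  have out: "\<phi> j w = 0" if "w \<notin> cball 0 (real DIM('a) / 2 ^ j)" for j w
    using that norm_le_cbox_One[of "- w" "1 / 2 ^ j"] by (intro cube) auto
  define c where "c = C\<^sup>2 * V / (1 - q / 2)"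
  have c: "0 \<le> c" using V_nonneg q by (simp add: c_def)
  \<comment> \<open>The tail of the energy series, up to the constant of
    \<open>energy_sum\<close>.\<close>
  define \<eta> where "\<eta> m = c * (suminf e - (\<Sum>j<m. e j))" for m
  have "\<eta> \<longlonglongrightarrow> c * (suminf e - suminf e)"
    unfolding \<eta>_def using summable_LIMSEQ[OF e] by (intro tendsto_intros)
  then have \<eta>: "\<eta> \<longlonglongrightarrow> 0" by simp
  have cauchy: "(\<integral>x. (S m x - S n x)\<^sup>2 \<partial>lborel) \<le> \<eta> m" if "m \<le> n" for m n
  proof -
    have "(\<integral>x. (S m x - S n x)\<^sup>2 \<partial>lborel) = (\<integral>x. (\<Sum>j=m..<n. T j x)\<^sup>2 \<partial>lborel)"
      using that by (simp add: S_diff_eq[symmetric] power2_commute)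
    also have "\<dots> \<le> c * (\<Sum>j=m..<n. e j)"
      unfolding c_def by (rule energy_sum) simp
    also have "\<dots> = c * ((\<Sum>j<n. e j) - (\<Sum>j<m. e j))"
      using that by (simp add: sum_diff_nat_ivl flip: atLeast0LessThan)
    also have "\<dots> \<le> \<eta> m"
      unfolding \<eta>_def using e e_nonneg c by (intro mult_left_mono diff_right_mono sum_le_suminf) auto
    finally show ?thesis .
  qed
  obtain g where g[measurable]: "g \<in> borel_measurable lborel"
    and ig: "\<And>m. integrable lborel (\<lambda>x. (S m x - g x)\<^sup>2)" and g_le: "\<And>m. (\<integral>x. (S m x - g x)\<^sup>2 \<partial>lborel) \<le> \<eta> m"
  proof (rule L2_Cauchy_limit[of S lborel \<eta>])
    show "S n \<in> borel_measurable lborel" for n by simp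
  qed (simp_all only: S_diff_integrable cauchy \<eta>)
  \<comment> \<open>\<open>S 0\<close> is the empty sum, so the difference at index 0 is
    \<open>g\<close> up to sign.\<close>
  have g2: "integrable lborel (\<lambda>x. (g x)\<^sup>2)" using ig[of 0] by (simp add: S_def)
  have close: "\<bar>(\<integral>w. \<phi> J w * g (x - w) \<partial>lborel) - S J x\<bar>
      \<le> C * real DIM('a) * ((\<Sum>j<J. 2 ^ j * osc j x) / 2 ^ J) + C * V * D / (1 - q / 2) * osc J x" (is "_ \<le> ?\<omega>") for J x
  proof -
    define d where "d n = \<bar>(\<integral>w. \<phi> J w * S n (x - w) \<partial>lborel) - (\<integral>w. \<phi> J w * g (x - w) \<partial>lborel)\<bar>" for n
    define M where "M = D * (2 ^ DIM('a)) ^ J"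
    have M: "0 \<le> M" using D by (simp add: M_def)
    have iS: "integrable lborel (\<lambda>w. \<phi> J w * S n (x - w))" for n
    proof -
      have "integrable lborel (\<lambda>y. (S n y)\<^sup>2)"
        using S_diff_integrable[of n 0] by (simp add: S_def[of 0])
      from integrable_conv_bounded_support[OF _ _ this bound out, where c = 0] show ?thesis by simp
    qed
    have iG: "integrable lborel (\<lambda>w. \<phi> J w * g (x - w))"
      using integrable_conv_bounded_support[OF _ _ g2 bound out, where c = 0] by simp
    \<comment> \<open>\<open>J\<close> and \<open>x\<close> are fixed here and \<open>M\<close> is a
      constant. The two terms of the weighted bound are paid by the unit mass of
      \<open>\<phi> J\<close> and by the L2 rate \<open>\<eta> n\<close>.\<close>
    have "d \<longlonglongrightarrow> 0"
    proof (rule tendsto_0_if_le_weighted[where g = \<eta> and c = 1 and d = M])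
      show "\<eta> \<longlonglongrightarrow> 0" by (rule \<eta>)
      show "0 \<le> d n" for n by (simp add: d_def)
      show "d n \<le> \<theta> * 1 + \<eta> n / \<theta> * M" if "0 < \<theta>" for n \<theta>
      proof -
        have i2: "integrable lborel (\<lambda>w. (S n (x - w) - g (x - w))\<^sup>2)"
          using integrable_lborel_reflect_iff[of "\<lambda>y. (S n y - g y)\<^sup>2" x] ig[of n] by simp
        have ip: "integrable lborel (\<phi> J)"
          by (rule integrable_bounded_support[OF _ bound out]) auto
        have "d n = \<bar>\<integral>w. \<phi> J w * (S n (x - w) - g (x - w)) \<partial>lborel\<bar>"
          using iS iG by (simp add: d_def right_diff_distrib)
        also have "\<dots> \<le> (\<integral>w. \<theta> * \<phi> J w + M / \<theta> * (S n (x - w) - g (x - w))\<^sup>2 \<partial>lborel)"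
        proof (intro abs_integral_le Bochner_Integration.integrable_add integrable_mult_right ip i2)
          fix w
          have "\<bar>\<phi> J w * (S n (x - w) - g (x - w))\<bar> \<le> \<phi> J w * (\<theta> + (S n (x - w) - g (x - w))\<^sup>2 / \<theta>)"
            using mult_left_mono[OF abs_le_weighted_square[OF \<open>0 < \<theta>\<close>] \<phi>0] \<phi>0[of J w] by (simp add: abs_mult)
          also have "\<dots> \<le> \<theta> * \<phi> J w + M / \<theta> * (S n (x - w) - g (x - w))\<^sup>2"
            using mult_right_mono[OF \<phi>1[of J w], of "(S n (x - w) - g (x - w))\<^sup>2 / \<theta>"] \<open>0 < \<theta>\<close>
            by (simp add: M_def distrib_left mult.commute)
          finally show "\<bar>\<phi> J w * (S n (x - w) - g (x - w))\<bar> \<le> \<theta> * \<phi> J w + M / \<theta> * (S n (x - w) - g (x - w))\<^sup>2" .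
        qed
        also have "\<dots> = \<theta> + M / \<theta> * (\<integral>x. (S n x - g x)\<^sup>2 \<partial>lborel)"
          using ip i2 integral_lborel_reflect[of "\<lambda>y. (S n y - g y)\<^sup>2" x] by (simp add: int1)
        also have "\<dots> \<le> \<theta> + M / \<theta> * \<eta> n"
          using g_le[of n] M \<open>0 < \<theta>\<close> by (intro add_left_mono mult_left_mono) auto
        finally show ?thesis by (simp add: mult.commute)
      qed
    qed
    then have lim: "(\<lambda>n. ?\<omega> + d n) \<longlonglongrightarrow> ?\<omega>"
      using tendsto_add[OF tendsto_const[of ?\<omega>]] by fastforce
    have le: "\<forall>n\<ge>J. \<bar>(\<integral>w. \<phi> J w * g (x - w) \<partial>lborel) - S J x\<bar> \<le> ?\<omega> + d n"
    proof (intro allI impI)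
      fix n assume "J \<le> n"
      from bump_S_le[OF D \<phi>0 \<phi>1 lip out int1 this, of x]
      show "\<bar>(\<integral>w. \<phi> J w * g (x - w) \<partial>lborel) - S J x\<bar> \<le> ?\<omega> + d n"
        unfolding d_def by linarith
    qed
    show ?thesis using le by (intro LIMSEQ_le_const[OF lim] exI[of _ J])
  qed
  have "AE x in lborel. (\<lambda>j. \<integral>w. \<phi> j w * g (x - w) \<partial>lborel) \<longlonglongrightarrow> g x"
    by (rule lebesgue_differentiation_kernel[OF _ g2 _ bound cube int1]) auto
  with AE_osc_tendsto_0[OF e] show ?thesis
  proof eventually_elim
    case (elim x)
    have "(\<lambda>J. (\<Sum>j<J. 2 ^ j * osc j x) / 2 ^ J) \<longlonglongrightarrow> 0"
      by (rule tendsto_geometric_average_0[OF elim(1) osc_nonneg])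
    from tendsto_add[OF tendsto_mult_right_zero[OF this, of "C * real DIM('a)"]
      tendsto_mult_right_zero[OF elim(1), of "C * V * D / (1 - q / 2)"]]
    have "(\<lambda>J. C * real DIM('a) * ((\<Sum>j<J. 2 ^ j * osc j x) / 2 ^ J) + C * V * D / (1 - q / 2) * osc J x) \<longlonglongrightarrow> 0"
      by simp
    then have "(\<lambda>J. (\<integral>w. \<phi> J w * g (x - w) \<partial>lborel) - S J x) \<longlonglongrightarrow> 0"
      by (rule Lim_null_comparison[OF always_eventually, rotated]) (use close in \<open>unfold real_norm_def, blast\<close>)
    from tendsto_diff[OF elim(2) this] have "(\<lambda>J. S J x) \<longlonglongrightarrow> g x" by simp
    with elim show ?case by (auto simp: convergent_def)
  qed
qed

end

section \<open>The kernel of the fractional gradient\<close>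

lemma powr_neg_lipschitz:
  fixes a b p :: real
  assumes "1 / 2 \<le> a" "1 / 2 \<le> b" "0 \<le> p"
  shows "\<bar>a powr - p - b powr - p\<bar> \<le> p * 2 powr (p + 1) * \<bar>a - b\<bar>"
proof -
  have "norm (a powr - p - b powr - p) \<le> p * 2 powr (p + 1) * norm (a - b)"
  proof (rule field_differentiable_bound[of "{1 / 2..}"])
    fix x :: real assume x: "x \<in> {1 / 2..}"
    show "((\<lambda>x. x powr - p) has_field_derivative (- p * x powr (- p - 1))) (at x within {1 / 2..})"
      using x by (auto intro!: derivative_eq_intros)
    have "x powr (- p - 1) \<le> (1 / 2) powr (- p - 1)"
      using x assms by (intro powr_mono2') auto
    also have "\<dots> = 2 powr (p + 1)" by (simp add: powr_divide powr_minus_divide powr_diff powr_add field_simps)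
    finally show "norm (- p * x powr (- p - 1)) \<le> p * 2 powr (p + 1)"
      using assms by (simp add: abs_mult mult_left_mono)
  qed (use assms in auto)
  then show ?thesis by simp
qed

text \<open>A dyadic decomposition of the kernel \<open>(z \<bullet> b) / norm z powr p\<close>. Truncating the power with \<open>max\<close>
  keeps every piece Lipschitz, and the sum telescopes.\<close>

definition riesz_piece :: "real \<Rightarrow> 'a::euclidean_space \<Rightarrow> nat \<Rightarrow> 'a \<Rightarrow> real" where
  "riesz_piece p b j z = (z \<bullet> b) * (max (norm z) (1 / 2 ^ Suc j) powr - p - max (norm z) (1 / 2 ^ j) powr - p)"

text \<open>The product rule. One of the two points may be taken in the unit ball, where
  \<open>\<bar>z \<bullet> b\<bar> \<le> 1\<close>. The radial factor is a difference of two
  truncated powers, whence \<open>2 * L\<close>, and it is bounded by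
  \<open>2 powr p\<close>.\<close>

lemma riesz_piece_0_lipschitz:
  fixes b :: "'a::euclidean_space"
  assumes b: "b \<in> Basis" and p: "0 \<le> p"
  shows "\<bar>riesz_piece p b 0 z - riesz_piece p b 0 w\<bar> \<le> (2 * (p * 2 powr (p + 1)) + 2 powr p) * norm (z - w)"
proof -
  define \<psi> where "\<psi> t = max t (1 / 2) powr - p - max t 1 powr - p" for t :: real
  define L where "L = p * 2 powr (p + 1)"
  have L: "0 \<le> L" using p by (simp add: L_def)
  have eq: "riesz_piece p b 0 z = (z \<bullet> b) * \<psi> (norm z)" for z by (simp add: riesz_piece_def \<psi>_def)
  have lip: "\<bar>\<psi> t - \<psi> t'\<bar> \<le> 2 * L * \<bar>t - t'\<bar>" for t t'
  proof -
    have "\<bar>max t c powr - p - max t' c powr - p\<bar> \<le> L * \<bar>t - t'\<bar>" if "1 / 2 \<le> c" for c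
    proof -
      have "\<bar>max t c powr - p - max t' c powr - p\<bar> \<le> L * \<bar>max t c - max t' c\<bar>"
        unfolding L_def using that p by (intro powr_neg_lipschitz) auto
      also have "\<dots> \<le> L * \<bar>t - t'\<bar>" using L by (intro mult_left_mono) auto
      finally show ?thesis .
    qed
    from this[of "1 / 2"] this[of 1] show ?thesis unfolding \<psi>_def mult.assoc by linarith
  qed
  have bd: "\<bar>\<psi> t\<bar> \<le> 2 powr p" for t
  proof -
    have "max t 1 powr - p \<le> max t (1 / 2) powr - p" using p by (intro powr_mono2') auto
    moreover have "max t (1 / 2) powr - p \<le> (1 / 2) powr - p" using p by (intro powr_mono2') auto
    moreover have "(1 / 2) powr - p = 2 powr p" by (simp add: powr_divide powr_minus_divide)
    moreover have "0 \<le> max t 1 powr - p" by simp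
    ultimately show ?thesis unfolding \<psi>_def by linarith
  qed
  have zero: "\<psi> t = 0" if "1 \<le> t" for t using that by (simp add: \<psi>_def)
  have main: "\<bar>riesz_piece p b 0 z - riesz_piece p b 0 w\<bar> \<le> (2 * L + 2 powr p) * norm (z - w)"
    if "norm z \<le> 1" for z w
  proof -
    have "riesz_piece p b 0 z - riesz_piece p b 0 w = (z \<bullet> b) * (\<psi> (norm z) - \<psi> (norm w)) + \<psi> (norm w) * ((z - w) \<bullet> b)"
      by (simp add: eq inner_diff_left algebra_simps)
    also have "\<bar>\<dots>\<bar> \<le> \<bar>z \<bullet> b\<bar> * \<bar>\<psi> (norm z) - \<psi> (norm w)\<bar> + \<bar>\<psi> (norm w)\<bar> * \<bar>(z - w) \<bullet> b\<bar>"
      by (metis abs_mult abs_triangle_ineq)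
    also have "\<dots> \<le> 1 * (2 * L * norm (z - w)) + 2 powr p * norm (z - w)"
    proof (intro add_mono mult_mono)
      show "\<bar>z \<bullet> b\<bar> \<le> 1" using Basis_le_norm[OF b, of z] that by linarith
      have "\<bar>\<psi> (norm z) - \<psi> (norm w)\<bar> \<le> 2 * L * \<bar>norm z - norm w\<bar>" by (rule lip)
      also have "\<dots> \<le> 2 * L * norm (z - w)" using L norm_triangle_ineq3[of z w] by (intro mult_left_mono) auto
      finally show "\<bar>\<psi> (norm z) - \<psi> (norm w)\<bar> \<le> 2 * L * norm (z - w)" .
    qed (use bd Basis_le_norm[OF b] in auto)
    finally show ?thesis by (simp add: algebra_simps)
  qed
  consider "norm z \<le> 1" | "norm w \<le> 1" | "1 \<le> norm z" "1 \<le> norm w" by linarith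
  then have "\<bar>riesz_piece p b 0 z - riesz_piece p b 0 w\<bar> \<le> (2 * L + 2 powr p) * norm (z - w)"
  proof cases
    case 1
    then show ?thesis by (rule main)
  next
    case 2
    then show ?thesis using main[of w z] by (simp add: norm_minus_commute abs_minus_commute)
  next
    case 3
    then show ?thesis using L by (simp add: eq zero)
  qed
  then show ?thesis by (simp add: L_def)
qed

text \<open>Homogeneity of degree \<open>1 - p = - (DIM('a) + s)\<close>: the power contributes
  \<open>2 powr (j * p)\<close>, and the linear factor takes back \<open>2 ^ j\<close>.\<close>

lemma riesz_piece_scale:
  fixes b :: "'a::euclidean_space"
  assumes p: "p = real DIM('a) + s + 1"
  shows "riesz_piece p b j z = (2 ^ DIM('a) * 2 powr s) ^ j * riesz_piece p b 0 (2 ^ j *\<^sub>R z)"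
proof -
  have m: "max (norm z) (c / 2 ^ j) powr - p = (2 ^ j) powr p * max (2 ^ j * norm z) c powr - p" if "0 \<le> c" for c
  proof -
    have "max (norm z) (c / 2 ^ j) = max (2 ^ j * norm z) c / 2 ^ j"
      by (auto simp: max_def field_simps)
    then show ?thesis using that by (simp add: powr_divide powr_minus_divide max.coboundedI2)
  qed
  have "(2 ^ j :: real) powr p = 2 powr (real j * p)" by (simp add: powr_powr powr_realpow[symmetric])
  also have "real j * p = real (DIM('a) * j) + s * real j + real j" by (simp add: p algebra_simps)
  also have "2 powr \<dots> = (2 ^ DIM('a)) ^ j * (2 powr s) ^ j * 2 ^ j"
    by (simp only: powr_add powr_realpow[of 2] zero_less_numeral powr_powr[symmetric] power_mult)
       (simp add: powr_realpow)
  finally have pw: "(2 ^ j :: real) powr p = (2 ^ DIM('a) * 2 powr s) ^ j * 2 ^ j" by (simp add: power_mult_distrib)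
  show ?thesis
    using m[of "1 / 2"] m[of 1] pw by (simp add: riesz_piece_def right_diff_distrib mult_ac)
qed

text \<open>The range \<open>0 < s < 1\<close> becomes \<open>1 < q < 2\<close> for
  \<open>q = 2 powr s\<close>. By scaling, the Lipschitz constant of the piece at
  \<open>j = 0\<close> serves all scales.\<close>

lemma dyadic_kernels_riesz:
  fixes b :: "'a::euclidean_space"
  assumes s: "0 < s" "s < 1" and b: "b \<in> Basis" and p: "p = real DIM('a) + s + 1"
  shows "dyadic_kernels (riesz_piece p b) (2 powr s) (2 * (p * 2 powr (p + 1)) + 2 powr p)"
proof
  have p0: "0 \<le> p" using s by (simp add: p)
  show "1 \<le> 2 powr s" using s by (simp add: ge_one_powr_ge_zero)
  show "2 powr s < 2" using s powr_less_mono[of s 1 2] by simp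
  show "0 \<le> 2 * (p * 2 powr (p + 1)) + 2 powr p" using p0 by simp
  show "riesz_piece p b j (- z) = - riesz_piece p b j z" for j z by (simp add: riesz_piece_def)
  show "riesz_piece p b j z = 0" if "1 / 2 ^ j < norm z" for j z
  proof -
    have "1 / 2 ^ Suc j \<le> (1 / 2 ^ j :: real)" by (simp add: field_simps)
    with that show ?thesis by (simp add: riesz_piece_def max_absorb1)
  qed
  show "\<bar>riesz_piece p b j z - riesz_piece p b j w\<bar>
      \<le> (2 * (p * 2 powr (p + 1)) + 2 powr p) * (2 ^ DIM('a) * 2 powr s * 2) ^ j * norm (z - w)" for j z w
  proof -
    have "\<bar>riesz_piece p b j z - riesz_piece p b j w\<bar>
        = (2 ^ DIM('a) * 2 powr s) ^ j * \<bar>riesz_piece p b 0 (2 ^ j *\<^sub>R z) - riesz_piece p b 0 (2 ^ j *\<^sub>R w)\<bar>"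
      by (subst (1 2) riesz_piece_scale[OF p]) (simp add: abs_mult flip: right_diff_distrib)
    also have "\<dots> \<le> (2 ^ DIM('a) * 2 powr s) ^ j * ((2 * (p * 2 powr (p + 1)) + 2 powr p) * norm (2 ^ j *\<^sub>R z - 2 ^ j *\<^sub>R w))"
      by (intro mult_left_mono riesz_piece_0_lipschitz b p0) auto
    also have "norm (2 ^ j *\<^sub>R z - 2 ^ j *\<^sub>R w) = 2 ^ j * norm (z - w)"
      by (simp flip: scaleR_diff_right)
    finally show ?thesis by (simp add: power_mult_distrib mult_ac)
  qed
qed

lemma sum_riesz_piece:
  "(\<Sum>j<J. riesz_piece p b j z) = (z \<bullet> b) * (max (norm z) (1 / 2 ^ J) powr - p - max (norm z) 1 powr - p)"
  by (induction J) (simp_all add: riesz_piece_def algebra_simps)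

section \<open>Integrability away from the singularity, and the dyadic form of the Gagliardo
  energy\<close>

lemma integrable_tail_weight:
  fixes s :: real
  assumes s: "0 < s"
  shows "integrable lborel (\<lambda>z::'a::euclidean_space. max (norm z) 1 powr - (real DIM('a) + s))"
proof (rule integrableI_nonneg)
  let ?N = "real DIM('a)"
  define v where "v = measure lborel (cball (0::'a) 2)"
  have pw: "(2 ^ m :: real) powr - (?N + s) = (2 powr - s) ^ m / (2 ^ DIM('a)) ^ m" for m
  proof -
    have eq: "- (?N + s) = - s - ?N" by simp
    have "(2 ^ m :: real) powr - (?N + s) = (2 powr (- s - ?N)) ^ m"
      unfolding eq by (simp add: powr_powr mult.commute flip: powr_realpow)
    also have "2 powr (- s - ?N) = 2 powr - s / (2 ^ DIM('a) :: real)"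
      by (simp only: powr_diff powr_realpow zero_less_numeral)
    finally show ?thesis by (simp add: power_divide)
  qed
  have le: "ennreal (max (norm z) 1 powr - (?N + s)) \<le> (\<Sum>m. ennreal ((2 ^ m) powr - (?N + s)) * indicator (cball 0 (2 * 2 ^ m)) z)" for z :: 'a
  proof -
    define t where "t = max (norm z) 1"
    obtain n where n: "t < 2 ^ n" using real_arch_pow[of 2 t] by auto
    \<comment> \<open>With \<open>Suc\<close> in the condition,
      \<open>2 ^ m \<le> t < 2 ^ Suc m\<close> also holds for \<open>m = 0\<close>, because
      \<open>1 \<le> t\<close>.\<close>
    define m where "m = (LEAST n. t < 2 ^ Suc n)"
    have ex: "\<exists>n. t < 2 ^ Suc n" using n by (intro exI[of _ n]) (auto simp: t_def)
    have up: "t < 2 ^ Suc m" unfolding m_def using ex by (rule LeastI_ex)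
    have lo: "2 ^ m \<le> t"
    proof (cases m)
      case 0 then show ?thesis by (simp add: t_def)
    next
      case (Suc k)
      then have "\<not> t < 2 ^ Suc k" unfolding m_def by (intro not_less_Least) simp
      then show ?thesis using Suc by simp
    qed
    define F where "F m = ennreal ((2 ^ m) powr - (?N + s)) * indicator (cball 0 (2 * 2 ^ m)) z" for m
    have "ennreal (t powr - (?N + s)) \<le> F m"
      using lo up s by (auto simp: F_def indicator_def t_def intro!: ennreal_leI powr_mono2')
    also have "\<dots> \<le> (\<Sum>m. F m)"
      using sum_le_suminf[of F "{m}"] by simp
    finally show ?thesis unfolding F_def t_def .
  qed
  have "(\<integral>\<^sup>+z. ennreal (max (norm (z::'a)) 1 powr - (?N + s)) \<partial>lborel)
      \<le> (\<integral>\<^sup>+z. (\<Sum>m. ennreal ((2 ^ m) powr - (?N + s)) * indicator (cball 0 (2 * 2 ^ m)) z) \<partial>(lborel::'a measure))"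
    by (intro nn_integral_mono le)
  also have "\<dots> = (\<Sum>m. \<integral>\<^sup>+z. ennreal ((2 ^ m) powr - (?N + s)) * indicator (cball 0 (2 * 2 ^ m)) z \<partial>(lborel::'a measure))"
    by (rule nn_integral_suminf) (intro borel_measurable_times_ennreal borel_measurable_const borel_measurable_indicator, simp)
  also have "\<dots> = (\<Sum>m. ennreal ((2 ^ m) powr - (?N + s)) * emeasure lborel (cball (0::'a) (2 * 2 ^ m)))"
    by (intro suminf_cong nn_integral_cmult_indicator) simp
  \<comment> \<open>The volumes grow like \<open>(2 ^ DIM('a)) ^ m\<close> and cancel that power in
    the weight. The remaining ratio \<open>2 powr - s\<close> is below 1 since
    \<open>0 < s\<close>.\<close>
  also have "\<dots> = (\<Sum>m. ennreal (v * (2 powr - s) ^ m))"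
  proof (intro suminf_cong)
    fix m :: nat
    have "measure lborel (cball (0::'a) (2 * 2 ^ m)) = v * (2 ^ DIM('a)) ^ m"
      by (simp add: v_def content_cball power_mult_distrib mult.commute flip: power_mult)
    moreover have "emeasure lborel (cball (0::'a) (2 * 2 ^ m)) = ennreal (measure lborel (cball (0::'a) (2 * 2 ^ m)))"
      using emeasure_lborel_cball_finite[of "0::'a" "2 * 2 ^ m"] by (intro emeasure_eq_ennreal_measure) auto
    moreover have "(2 ^ m) powr - (?N + s) * (v * (2 ^ DIM('a)) ^ m) = v * (2 powr - s) ^ m"
      unfolding pw by simp
    ultimately show "ennreal ((2 ^ m) powr - (?N + s)) * emeasure lborel (cball (0::'a) (2 * 2 ^ m)) = ennreal (v * (2 powr - s) ^ m)"
      by (metis ennreal_mult' powr_ge_zero)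
  qed
  also have "\<dots> < \<infinity>"
  proof -
    have "2 powr - s < 1" using s by (simp add: powr_less_one)
    then have "summable (\<lambda>m. v * (2 powr - s) ^ m)" by (intro summable_mult summable_geometric) simp
    then show ?thesis by (subst suminf_ennreal2) (auto simp: v_def)
  qed
  finally show "(\<integral>\<^sup>+z. ennreal (max (norm (z::'a)) 1 powr - (?N + s)) \<partial>lborel) < \<infinity>" .
qed auto

text \<open>By \<open>\<bar>a\<bar> \<le> 1 + a\<^sup>2\<close> once more: the constant part is
  carried by the integrable weight, the square by the square integrability of \<open>u\<close>, as
  the weight is at most 1.\<close>

lemma integrable_tail_kernel:
  fixes u k :: "'a::euclidean_space \<Rightarrow> real"
  assumes [measurable]: "u \<in> borel_measurable borel" "k \<in> borel_measurable borel"
    and u2: "integrable lborel (\<lambda>x. (u x)\<^sup>2)" and s: "0 < s"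
    and k: "\<And>z. \<bar>k z\<bar> \<le> c * max (norm z) 1 powr - (real DIM('a) + s)"
  shows "integrable lborel (\<lambda>z. k z * (u x - u (x - z)))"
proof (rule Bochner_Integration.integrable_bound)
  let ?w = "\<lambda>z::'a. max (norm z) 1 powr - (real DIM('a) + s)"
  have c: "0 \<le> c" using k[of 0] by simp
  have "integrable lborel (\<lambda>z. (u (x - z))\<^sup>2)"
    using integrable_lborel_reflect_iff[of "\<lambda>x. (u x)\<^sup>2" x] u2 by simp
  then show "integrable lborel (\<lambda>z. (1 + \<bar>u x\<bar>) * c * ?w z + c * (u (x - z))\<^sup>2)"
    using integrable_tail_weight[OF s] by (intro Bochner_Integration.integrable_add integrable_mult_right)
  show "AE z in lborel. norm (k z * (u x - u (x - z))) \<le> norm ((1 + \<bar>u x\<bar>) * c * ?w z + c * (u (x - z))\<^sup>2)"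
  proof (intro AE_I2)
    fix z
    have w1: "?w z \<le> 1" using powr_mono2'[of "- (real DIM('a) + s)" 1 "max (norm z) 1"] s by simp
    have "\<bar>u x - u (x - z)\<bar> \<le> (1 + \<bar>u x\<bar>) + (u (x - z))\<^sup>2"
      using abs_le_one_plus_square[of "u (x - z)"] by linarith
    then have "norm (k z * (u x - u (x - z))) \<le> (c * ?w z) * ((1 + \<bar>u x\<bar>) + (u (x - z))\<^sup>2)"
      unfolding real_norm_def abs_mult using k[of z] c by (intro mult_mono) auto
    also have "\<dots> \<le> (1 + \<bar>u x\<bar>) * c * ?w z + c * (u (x - z))\<^sup>2"
      using mult_left_mono[OF w1, of "c * (u (x - z))\<^sup>2"] c by (simp add: algebra_simps)
    finally show "norm (k z * (u x - u (x - z))) \<le> norm ((1 + \<bar>u x\<bar>) * c * ?w z + c * (u (x - z))\<^sup>2)" by simp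
  qed
qed simp

text \<open>From \<open>1 \<le> P\<close> follows \<open>2 \<le> a\<close>, so a geometric sum is at
  most twice its last term; the last scale counted has \<open>2 ^ j \<le> \<rho>\<close>.\<close>

lemma sum_dyadic_powers_le:
  fixes a \<rho> P :: real
  assumes a: "a = 2 powr P" and P: "1 \<le> P" and \<rho>: "0 \<le> \<rho>"
  shows "(\<Sum>j<n. a ^ j * (if 2 ^ j \<le> \<rho> then 1 else 0)) \<le> 2 * \<rho> powr P"
proof (induction n)
  case (Suc n)
  have a2: "2 \<le> a" using powr_mono[of 1 P 2] P by (simp add: a)
  show ?case
  proof (cases "2 ^ n \<le> \<rho>")
    case True
    have geo: "(\<Sum>j<Suc n. a ^ j) \<le> 2 * a ^ n" for n
    proof (induction n)
      case (Suc n)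
      have "2 * a ^ n \<le> a * a ^ n" using a2 by (intro mult_right_mono) auto
      with Suc show ?case by simp
    qed simp
    have "(\<Sum>j<Suc n. a ^ j * (if 2 ^ j \<le> \<rho> then 1 else 0)) \<le> (\<Sum>j<Suc n. a ^ j)"
      using a2 by (intro sum_mono) auto
    also have "\<dots> \<le> 2 * a ^ n" by (rule geo)
    also have "a ^ n = (2 ^ n) powr P" by (simp add: a powr_powr mult.commute flip: powr_realpow)
    also have "\<dots> \<le> \<rho> powr P" using True P by (intro powr_mono2) auto
    finally show ?thesis by simp
  next
    case False
    then show ?thesis using Suc by simp
  qed
qed simp

text \<open>For fixed \<open>z\<close> the balls containing it are those with
  \<open>2 ^ j \<le> R / norm z\<close>, and the sum of their weights is comparable to the Gagliardo
  kernel at \<open>z\<close>.\<close>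

lemma nn_integral_dyadic_oscillation_le:
  fixes u :: "'a::euclidean_space \<Rightarrow> real"
  assumes [measurable]: "u \<in> borel_measurable borel" and s: "0 < s" and R: "0 \<le> R"
  shows "(\<integral>\<^sup>+z. (\<Sum>j. ennreal ((2 powr (real DIM('a) + 2 * s)) ^ j * (indicator (cball 0 (R / 2 ^ j)) z * (u (x - z) - u x)\<^sup>2))) \<partial>lborel)
    \<le> ennreal (2 * R powr (real DIM('a) + 2 * s)) * (\<integral>\<^sup>+y. ennreal ((u x - u y)\<^sup>2 / norm (x - y) powr (real DIM('a) + 2 * s)) \<partial>lborel)"
proof -
  define P where "P = real DIM('a) + 2 * s"
  have P: "1 \<le> P" using s DIM_positive[where 'a = 'a] by (simp add: P_def Suc_le_eq del: DIM_positive)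
  have pt: "(\<Sum>j. ennreal ((2 powr P) ^ j * (indicator (cball 0 (R / 2 ^ j)) z * (u (x - z) - u x)\<^sup>2)))
      \<le> ennreal (2 * R powr P) * ennreal ((u x - u (x - z))\<^sup>2 / norm (x - (x - z)) powr P)" for z
  proof (cases "z = 0")
    case False
    define d where "d = (u x - u (x - z))\<^sup>2"
    have "(\<Sum>j. ennreal ((2 powr P) ^ j * (indicator (cball 0 (R / 2 ^ j)) z * d))) \<le> ennreal (2 * (R / norm z) powr P * d)"
    proof (rule suminf_le_const[OF summableI])
      fix n
      have "(\<Sum>j<n. ennreal ((2 powr P) ^ j * (indicator (cball 0 (R / 2 ^ j)) z * d)))
          = ennreal (\<Sum>j<n. (2 powr P) ^ j * (indicator (cball 0 (R / 2 ^ j)) z * d))"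
        by (intro sum_ennreal) (simp add: d_def)
      also have "(\<Sum>j<n. (2 powr P) ^ j * (indicator (cball 0 (R / 2 ^ j)) z * d))
          = (\<Sum>j<n. (2 powr P) ^ j * (if 2 ^ j \<le> R / norm z then 1 else 0)) * d"
        unfolding sum_distrib_right using False by (intro sum.cong refl) (auto simp: indicator_def field_simps)
      also have "\<dots> \<le> 2 * (R / norm z) powr P * d"
        using sum_dyadic_powers_le[OF refl P, of "R / norm z" n] R by (intro mult_right_mono) (auto simp: d_def)
      finally show "(\<Sum>j<n. ennreal ((2 powr P) ^ j * (indicator (cball 0 (R / 2 ^ j)) z * d))) \<le> ennreal (2 * (R / norm z) powr P * d)"
        by (simp add: ennreal_leI)
    qed
    also have "2 * (R / norm z) powr P * d = (2 * R powr P) * (d / norm z powr P)"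
      using R by (simp add: powr_divide)
    finally show ?thesis by (simp add: d_def power2_commute ennreal_mult'[symmetric])
  qed simp
  have "(\<integral>\<^sup>+z. (\<Sum>j. ennreal ((2 powr P) ^ j * (indicator (cball 0 (R / 2 ^ j)) z * (u (x - z) - u x)\<^sup>2))) \<partial>lborel)
      \<le> (\<integral>\<^sup>+z. ennreal (2 * R powr P) * ennreal ((u x - u (x - z))\<^sup>2 / norm (x - (x - z)) powr P) \<partial>lborel)"
    by (intro nn_integral_mono pt)
  also have "\<dots> = (\<integral>\<^sup>+y. ennreal (2 * R powr P) * ennreal ((u x - u y)\<^sup>2 / norm (x - y) powr P) \<partial>lborel)"
    by (rule nn_integral_lborel_reflect[of "\<lambda>y. ennreal (2 * R powr P) * ennreal ((u x - u y)\<^sup>2 / norm (x - y) powr P)"]) measurable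
  also have "\<dots> = ennreal (2 * R powr P) * (\<integral>\<^sup>+y. ennreal ((u x - u y)\<^sup>2 / norm (x - y) powr P) \<partial>lborel)"
    by (rule nn_integral_cmult) measurable
  finally show ?thesis by (simp add: P_def)
qed

text \<open>The Gagliardo bound enters as summability of \<open>e\<close>: here \<open>A * q\<close>
  is \<open>2 powr (DIM('a) + 2 * s)\<close>, so the energies \<open>e j\<close> sum to at most a
  multiple of it. Convergence then passes from the partial sums to the sharp cutoffs.\<close>

theorem AE_riesz_truncations_converge:
  fixes u :: "'a::euclidean_space \<Rightarrow> real"
  assumes u[measurable]: "u \<in> borel_measurable borel" and u2: "integrable lborel (\<lambda>x. (u x)\<^sup>2)"
    and s: "0 < s" "s < 1" and b: "b \<in> Basis"
    and gag: "(\<integral>\<^sup>+x. \<integral>\<^sup>+y. ennreal ((u x - u y)\<^sup>2 / norm (x - y) powr (real DIM('a) + 2 * s)) \<partial>lborel \<partial>lborel) < \<infinity>"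
  defines "k \<equiv> \<lambda>z. (z \<bullet> b) * norm z powr - (real DIM('a) + s + 1)"
  shows "AE x in lborel. \<exists>I. ((\<lambda>\<epsilon>. \<integral>z. indicator {z. \<epsilon> < norm z} z * (k z * (u x - u (x - z))) \<partial>lborel) \<longlongrightarrow> I) (at_right 0)"
    and "\<And>x \<epsilon>. 0 < \<epsilon> \<Longrightarrow> integrable lborel (\<lambda>z. indicator {z. \<epsilon> < norm z} z * (k z * (u x - u (x - z))))"
proof -
  define p where "p = real DIM('a) + s + 1"
  define C where "C = 2 * (p * 2 powr (p + 1)) + 2 powr p"
  interpret dyadic_kernels_fun "riesz_piece p b" "2 powr s" C u
  proof -
    interpret dyadic_kernels "riesz_piece p b" "2 powr s" C
      unfolding C_def by (rule dyadic_kernels_riesz[OF s b p_def])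
    show "dyadic_kernels_fun (riesz_piece p b) (2 powr s) C u"
      by unfold_locales (rule u u2)+
  qed
  have Aq: "A * 2 powr s = 2 powr (real DIM('a) + 2 * s)"
    by (simp only: A_def powr_add powr_realpow zero_less_numeral mult_2 mult.assoc)
  have "(\<Sum>j. ennreal (e j)) = (\<Sum>j. \<integral>\<^sup>+x. ennreal (osc2 j x) \<partial>lborel)"
    by (simp add: nn_integral_osc2)
  also have "\<dots> = (\<integral>\<^sup>+x. (\<Sum>j. ennreal (osc2 j x)) \<partial>lborel)"
    by (rule nn_integral_suminf[symmetric]) measurable
  also have "\<dots> \<le> (\<integral>\<^sup>+x. ennreal (2 * R powr (real DIM('a) + 2 * s)) * (\<integral>\<^sup>+y. ennreal ((u x - u y)\<^sup>2 / norm (x - y) powr (real DIM('a) + 2 * s)) \<partial>lborel) \<partial>lborel)"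
  proof (rule nn_integral_mono)
    fix x
    have "(\<Sum>j. ennreal (osc2 j x)) = (\<Sum>j. \<integral>\<^sup>+z. ennreal ((A * 2 powr s) ^ j * (indicator (ball_dyadic j) z * (u (x - z) - u x)\<^sup>2)) \<partial>lborel)"
      unfolding osc2_def using integrable_ball_diff(2)[of _ x] A_pos
      by (intro suminf_cong) (subst nn_integral_eq_integral, auto)
    also have "\<dots> = (\<integral>\<^sup>+z. (\<Sum>j. ennreal ((A * 2 powr s) ^ j * (indicator (ball_dyadic j) z * (u (x - z) - u x)\<^sup>2))) \<partial>lborel)"
      by (rule nn_integral_suminf[symmetric]) measurable
    also have "\<dots> \<le> ennreal (2 * R powr (real DIM('a) + 2 * s)) * (\<integral>\<^sup>+y. ennreal ((u x - u y)\<^sup>2 / norm (x - y) powr (real DIM('a) + 2 * s)) \<partial>lborel)"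
      unfolding Aq by (rule nn_integral_dyadic_oscillation_le[OF u s(1)]) (use R_ge in linarith)
    finally show "(\<Sum>j. ennreal (osc2 j x)) \<le> ennreal (2 * R powr (real DIM('a) + 2 * s)) * (\<integral>\<^sup>+y. ennreal ((u x - u y)\<^sup>2 / norm (x - y) powr (real DIM('a) + 2 * s)) \<partial>lborel)" .
  qed
  also have "\<dots> = ennreal (2 * R powr (real DIM('a) + 2 * s)) * (\<integral>\<^sup>+x. (\<integral>\<^sup>+y. ennreal ((u x - u y)\<^sup>2 / norm (x - y) powr (real DIM('a) + 2 * s)) \<partial>lborel) \<partial>lborel)"
    by (rule nn_integral_cmult) measurable
  also have "\<dots> < \<infinity>" using gag by (simp add: ennreal_mult_less_top)
  finally have "summable e" using e_nonneg by (intro summable_suminf_not_top) auto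
  then have conv: "AE x in lborel. convergent (\<lambda>J. S J x) \<and> (\<lambda>j. osc j x) \<longlonglongrightarrow> 0"
    by (rule AE_S_convergent)
  \<comment> \<open>The pieces telescope from scale 1 downwards, so their sum misses this bounded
    kernel, which agrees with \<open>k\<close> outside the unit ball. For each \<open>x\<close> it
    contributes a constant.\<close>
  define k1 where "k1 z = (z \<bullet> b) * max (norm z) 1 powr - p" for z
  have k[measurable]: "k \<in> borel_measurable borel" unfolding k_def by measurable
  have k1[measurable]: "k1 \<in> borel_measurable borel" unfolding k1_def by measurable
  have k_eq: "k z = (z \<bullet> b) * norm z powr - p" for z by (simp add: k_def p_def)
  have k_le: "\<bar>(z \<bullet> b) * t powr - p\<bar> \<le> t powr - (real DIM('a) + s)" if "norm z \<le> t" "0 < t" for z t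
  proof -
    have "\<bar>(z \<bullet> b) * t powr - p\<bar> \<le> t * t powr - p"
      using Basis_le_norm[OF b, of z] that by (simp add: abs_mult mult_right_mono)
    also have "\<dots> = t powr (1 + - p)" unfolding powr_add using that by simp
    finally show ?thesis by (simp add: p_def)
  qed
  have i1: "integrable lborel (\<lambda>z. k1 z * (u x - u (x - z)))" for x
  proof (rule integrable_tail_kernel[where c = 1 and s = s])
    show "\<bar>k1 z\<bar> \<le> 1 * max (norm z) 1 powr - (real DIM('a) + s)" for z
      unfolding k1_def mult_1 by (rule k_le) auto
  qed (use u2 s in auto)
  show i2: "integrable lborel (\<lambda>z. indicator {z. \<epsilon> < norm z} z * (k z * (u x - u (x - z))))" if "0 < \<epsilon>" for x \<epsilon>
  proof -
    \<comment> \<open>With \<open>\<epsilon>' \<le> 1\<close> the comparison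
      \<open>\<epsilon>' * max (norm z) 1 \<le> norm z\<close> holds on all of
      \<open>\<epsilon> < norm z\<close>, also inside the unit ball.\<close>
    define \<epsilon>' where "\<epsilon>' = min \<epsilon> 1"
    have \<epsilon>': "0 < \<epsilon>'" "\<epsilon>' \<le> 1" "\<epsilon>' \<le> \<epsilon>" using that by (auto simp: \<epsilon>'_def)
    have "\<bar>indicator {z. \<epsilon> < norm z} z * k z\<bar> \<le> \<epsilon>' powr - (real DIM('a) + s) * max (norm z) 1 powr - (real DIM('a) + s)" for z
    proof (cases "\<epsilon> < norm z")
      case True
      then have nz: "0 < norm z" using that by linarith
      have "\<epsilon>' * max (norm z) 1 \<le> norm z"
      proof (cases "1 \<le> norm z")
        case True
        then show ?thesis using mult_right_mono[OF \<epsilon>'(2), of "norm z"] by (simp add: max_absorb1)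
      next
        case False
        then show ?thesis using True \<epsilon>' by (simp add: max_absorb2)
      qed
      then have "norm z powr - (real DIM('a) + s) \<le> (\<epsilon>' * max (norm z) 1) powr - (real DIM('a) + s)"
        using \<epsilon>' s by (intro powr_mono2') auto
      also have "\<dots> = \<epsilon>' powr - (real DIM('a) + s) * max (norm z) 1 powr - (real DIM('a) + s)"
        by (rule powr_mult)
      finally show ?thesis using k_le[of z "norm z"] nz True by (simp add: k_eq)
    qed simp
    then have "integrable lborel (\<lambda>z. (indicator {z. \<epsilon> < norm z} z * k z) * (u x - u (x - z)))"
      by (intro integrable_tail_kernel[where s = s] u2 s) auto
    then show ?thesis by (simp add: mult.assoc)
  qed
  \<comment> \<open>Each piece has mean zero, so convolving with \<open>u (x - z)\<close> equals
    convolving with \<open>u (x - z) - u x\<close>, whence the minus sign.\<close>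
  have S_eq: "S J x = - (\<integral>z. (z \<bullet> b) * (max (norm z) (1 / 2 ^ J) powr - p) * (u x - u (x - z)) - k1 z * (u x - u (x - z)) \<partial>lborel)"
    and iS: "integrable lborel (\<lambda>z. (z \<bullet> b) * (max (norm z) (1 / 2 ^ J) powr - p) * (u x - u (x - z)))" for J x
  proof -
    have eq: "(\<lambda>z. (\<Sum>j<J. riesz_piece p b j z) * (u x - u (x - z)))
        = (\<lambda>z. (z \<bullet> b) * (max (norm z) (1 / 2 ^ J) powr - p) * (u x - u (x - z)) - k1 z * (u x - u (x - z)))"
      unfolding sum_riesz_piece k1_def by (simp add: algebra_simps)
    have iK: "integrable lborel (\<lambda>z. riesz_piece p b j z * (u x - u (x - z)))" for j
      using T_integrable[of j x] K_integrable[of j] by (simp add: right_diff_distrib)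
    have "(\<integral>z. (\<Sum>j<J. riesz_piece p b j z) * (u x - u (x - z)) \<partial>lborel) = (\<Sum>j<J. \<integral>z. riesz_piece p b j z * (u x - u (x - z)) \<partial>lborel)"
      using iK by (simp add: sum_distrib_right)
    also have "\<dots> = - S J x"
      using T_integrable[of _ x] K_integrable by (simp add: S_def T_def right_diff_distrib integral_K sum_negf)
    finally show "S J x = - (\<integral>z. (z \<bullet> b) * (max (norm z) (1 / 2 ^ J) powr - p) * (u x - u (x - z)) - k1 z * (u x - u (x - z)) \<partial>lborel)"
      unfolding eq by linarith
    have "integrable lborel (\<lambda>z. (\<Sum>j<J. riesz_piece p b j z) * (u x - u (x - z)))"
      using iK by (simp add: sum_distrib_right)
    from Bochner_Integration.integrable_add[OF this[unfolded eq] i1[of x]]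
    show "integrable lborel (\<lambda>z. (z \<bullet> b) * (max (norm z) (1 / 2 ^ J) powr - p) * (u x - u (x - z)))" by simp
  qed
  define G where "G x \<epsilon> = (\<integral>z. indicator {z. \<epsilon> < norm z} z * (k z * (u x - u (x - z))) \<partial>lborel)" for x \<epsilon>
  define c where "c x = (\<integral>z. k1 z * (u x - u (x - z)) \<partial>lborel)" for x
  have A_pow: "(1 / 2 ^ J) powr - (real DIM('a) + s) = A ^ J" for J
  proof -
    have "(1 / 2 ^ J :: real) powr - X = (2 powr X) ^ J" for X :: real
      by (simp add: powr_divide powr_minus_divide powr_powr mult.commute flip: powr_realpow)
    from this[of "real DIM('a) + s"]
    have "(1 / 2 ^ J :: real) powr - (real DIM('a) + s) = (2 powr (real DIM('a) + s)) ^ J" .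
    also have "2 powr (real DIM('a) + s) = A"
      by (simp only: A_def powr_add powr_realpow zero_less_numeral)
    finally show ?thesis .
  qed
  \<comment> \<open>Beyond \<open>\<epsilon>\<close> the kernel cut off by \<open>max\<close> agrees
    with \<open>k\<close>. Within \<open>\<epsilon> < 2 / 2 ^ J \<le> R / 2 ^ J\<close> only the
    former is left, and it is at most \<open>A ^ J\<close>, the weight of
    \<open>osc J x\<close>.\<close>
  have err: "\<bar>G x \<epsilon> - (c x - S J x)\<bar> \<le> osc J x" if \<epsilon>: "1 / 2 ^ J \<le> \<epsilon>" "\<epsilon> < 2 / 2 ^ J" for x \<epsilon> J
  proof -
    have e0: "0 < \<epsilon>" using \<epsilon>(1) by (rule less_le_trans[rotated]) simp
    define M where "M z = (z \<bullet> b) * max (norm z) (1 / 2 ^ J) powr - p" for z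
    have "c x - S J x = (\<integral>z. M z * (u x - u (x - z)) \<partial>lborel)"
      using i1[of x] iS[of J x] by (simp add: S_eq c_def M_def)
    then have "G x \<epsilon> - (c x - S J x) = (\<integral>z. indicator {z. \<epsilon> < norm z} z * (k z * (u x - u (x - z))) - M z * (u x - u (x - z)) \<partial>lborel)"
      using i2[OF e0, of x] iS[of J x] by (simp add: G_def M_def)
    then have "\<bar>G x \<epsilon> - (c x - S J x)\<bar>
        = \<bar>\<integral>z. indicator {z. \<epsilon> < norm z} z * (k z * (u x - u (x - z))) - M z * (u x - u (x - z)) \<partial>lborel\<bar>"
      by simp
    also have "\<dots> \<le> (\<integral>z. A ^ J * (indicator (ball_dyadic J) z * \<bar>u (x - z) - u x\<bar>) \<partial>lborel)"
    proof (intro abs_integral_le integrable_mult_right integrable_ball_diff)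
      fix z
      show "\<bar>indicator {z. \<epsilon> < norm z} z * (k z * (u x - u (x - z))) - M z * (u x - u (x - z))\<bar>
          \<le> A ^ J * (indicator (ball_dyadic J) z * \<bar>u (x - z) - u x\<bar>)"
      proof (cases "\<epsilon> < norm z")
        case True
        then have "M z = k z" using \<epsilon> by (simp add: M_def k_eq max_absorb1)
        then show ?thesis using True A_pos by simp
      next
        case False
        have "2 / 2 ^ J \<le> R / 2 ^ J" using R_ge by (intro divide_right_mono) auto
        then have z: "z \<in> ball_dyadic J" using False \<epsilon> by simp
        have "\<bar>M z\<bar> \<le> max (norm z) (1 / 2 ^ J) powr - (real DIM('a) + s)"
          unfolding M_def by (rule k_le) (auto simp: less_max_iff_disj)
        also have "\<dots> \<le> (1 / 2 ^ J) powr - (real DIM('a) + s)"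
          using s by (intro powr_mono2') auto
        finally have "\<bar>M z\<bar> \<le> A ^ J" by (simp only: A_pow)
        then have "\<bar>M z\<bar> * \<bar>u (x - z) - u x\<bar> \<le> A ^ J * \<bar>u (x - z) - u x\<bar>" by (rule mult_right_mono) simp
        then show ?thesis using False z by (simp add: abs_mult abs_minus_commute)
      qed
    qed
    also have "\<dots> = osc J x" by (simp add: osc_def)
    finally show ?thesis .
  qed
  show "AE x in lborel. \<exists>I. ((\<lambda>\<epsilon>. \<integral>z. indicator {z. \<epsilon> < norm z} z * (k z * (u x - u (x - z))) \<partial>lborel) \<longlongrightarrow> I) (at_right 0)"
    using conv
  proof eventually_elim
    case (elim x)
    then obtain l where l: "(\<lambda>J. S J x) \<longlonglongrightarrow> l" by (auto simp: convergent_def)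
    have "(G x \<longlongrightarrow> c x - l) (at_right 0)"
    proof (rule tendstoI)
      fix \<delta> :: real assume "0 < \<delta>"
      then have "0 < \<delta> / 2" by simp
      from tendstoD[OF l this] tendstoD[OF conjunct2[OF elim] this]
      have "\<forall>\<^sub>F J in sequentially. dist (S J x) l < \<delta> / 2 \<and> dist (osc J x) 0 < \<delta> / 2"
        by (rule eventually_conj)
      then obtain J0 where J0: "\<And>J. J0 \<le> J \<Longrightarrow> dist (S J x) l < \<delta> / 2 \<and> dist (osc J x) 0 < \<delta> / 2"
        by (auto simp: eventually_sequentially)
      have "dist (G x \<epsilon>) (c x - l) < \<delta>" if \<epsilon>: "0 < \<epsilon>" "\<epsilon> < 1 / 2 ^ J0" for \<epsilon>
      proof -
        \<comment> \<open>The dyadic scale just below \<open>\<epsilon>\<close>. Since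
          \<open>\<epsilon> < 1 / 2 ^ J0\<close>, it lies beyond \<open>J0\<close>; in particular it
          has a predecessor, whose failure gives \<open>\<epsilon> < 2 / 2 ^ J\<close>.\<close>
        define J where "J = (LEAST n. 1 / 2 ^ n \<le> \<epsilon>)"
        obtain n where "(1 / 2) ^ n < \<epsilon>" using real_arch_pow_inv[of \<epsilon> "1 / 2"] \<epsilon> by auto
        then have ex: "\<exists>n. 1 / 2 ^ n \<le> \<epsilon>" by (auto simp: power_one_over intro: less_imp_le)
        have lo: "1 / 2 ^ J \<le> \<epsilon>" unfolding J_def using ex by (rule LeastI_ex)
        have "J0 < J"
        proof (rule ccontr)
          assume "\<not> J0 < J"
          then have "1 / 2 ^ J0 \<le> (1 / 2 ^ J :: real)" by (intro divide_left_mono power_increasing) auto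
          with lo \<epsilon> show False by linarith
        qed
        then obtain m where m: "J = Suc m" by (cases J) auto
        then have "\<not> 1 / 2 ^ m \<le> \<epsilon>" unfolding J_def by (intro not_less_Least) simp
        then have "\<epsilon> < 2 / 2 ^ J" by (simp add: m)
        from err[OF lo this, of x] J0[of J] \<open>J0 < J\<close> show ?thesis
          unfolding dist_real_def by linarith
      qed
      moreover have "0 < (1 / 2 ^ J0 :: real)" by simp
      ultimately show "\<forall>\<^sub>F \<epsilon> in at_right 0. dist (G x \<epsilon>) (c x - l) < \<delta>"
        unfolding eventually_at_right_field by blast
    qed
    then show ?case by (auto simp: G_def[abs_def])
  qed
qed

section \<open>Principal values\<close>

lemma has_pv_integral_unique:
  assumes "has_pv_integral f I x" "has_pv_integral f J x"
  shows "I = J"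
  using assms tendsto_unique[of "at_right (0::real)"] unfolding has_pv_integral_def
  by (metis trivial_limit_at_right_real)

lemma pv_integral_eq: "has_pv_integral f I x \<Longrightarrow> pv_integral f x = I"
  unfolding pv_integral_def by (blast intro: the_equality has_pv_integral_unique)

lemma has_pv_integral_scaleR_left:
  fixes f :: "'a::euclidean_space \<Rightarrow> real" and c :: "'b::{banach, second_countable_topology}"
  assumes "has_pv_integral f I x"
  shows "has_pv_integral (\<lambda>y. f y *\<^sub>R c) (I *\<^sub>R c) x"
  unfolding has_pv_integral_def
proof
  show "\<forall>\<epsilon>>0. set_integrable lebesgue {y. \<epsilon> < norm (x - y)} (\<lambda>y. f y *\<^sub>R c)"
    using assms by (simp add: has_pv_integral_def set_integrable_def)
  have "set_lebesgue_integral lebesgue {y. \<epsilon> < norm (x - y)} (\<lambda>y. f y *\<^sub>R c)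
      = set_lebesgue_integral lebesgue {y. \<epsilon> < norm (x - y)} f *\<^sub>R c" if "0 < \<epsilon>" for \<epsilon>
    using assms that by (simp add: has_pv_integral_def set_integrable_def set_lebesgue_integral_def)
  then have eq: "\<forall>\<^sub>F \<epsilon> in at_right 0. set_lebesgue_integral lebesgue {y. \<epsilon> < norm (x - y)} f *\<^sub>R c
      = set_lebesgue_integral lebesgue {y. \<epsilon> < norm (x - y)} (\<lambda>y. f y *\<^sub>R c)"
    by (auto simp: eventually_at_right_field intro: exI[of _ 1])
  have "((\<lambda>\<epsilon>. set_lebesgue_integral lebesgue {y. \<epsilon> < norm (x - y)} f *\<^sub>R c) \<longlongrightarrow> I *\<^sub>R c) (at_right 0)"
    using assms by (intro tendsto_scaleR tendsto_const) (simp add: has_pv_integral_def)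
  then show "((\<lambda>\<epsilon>. set_lebesgue_integral lebesgue {y. \<epsilon> < norm (x - y)} (\<lambda>y. f y *\<^sub>R c)) \<longlongrightarrow> I *\<^sub>R c) (at_right 0)"
    using eq by (rule Lim_transform_eventually)
qed

lemma has_pv_integral_sum:
  assumes "finite A" and pv: "\<And>i. i \<in> A \<Longrightarrow> has_pv_integral (f i) (I i) x"
  shows "has_pv_integral (\<lambda>y. \<Sum>i\<in>A. f i y) (\<Sum>i\<in>A. I i) x"
  unfolding has_pv_integral_def
proof
  show "\<forall>\<epsilon>>0. set_integrable lebesgue {y. \<epsilon> < norm (x - y)} (\<lambda>y. \<Sum>i\<in>A. f i y)"
    using pv unfolding has_pv_integral_def set_integrable_def scaleR_sum_right
    by (intro allI impI Bochner_Integration.integrable_sum) simp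
  have "set_lebesgue_integral lebesgue {y. \<epsilon> < norm (x - y)} (\<lambda>y. \<Sum>i\<in>A. f i y)
      = (\<Sum>i\<in>A. set_lebesgue_integral lebesgue {y. \<epsilon> < norm (x - y)} (f i))" if "0 < \<epsilon>" for \<epsilon>
    using pv that unfolding has_pv_integral_def set_integrable_def set_lebesgue_integral_def scaleR_sum_right
    by (intro Bochner_Integration.integral_sum) simp
  then have eq: "\<forall>\<^sub>F \<epsilon> in at_right 0. (\<Sum>i\<in>A. set_lebesgue_integral lebesgue {y. \<epsilon> < norm (x - y)} (f i))
      = set_lebesgue_integral lebesgue {y. \<epsilon> < norm (x - y)} (\<lambda>y. \<Sum>i\<in>A. f i y)"
    by (auto simp: eventually_at_right_field intro: exI[of _ 1])
  have "((\<lambda>\<epsilon>. \<Sum>i\<in>A. set_lebesgue_integral lebesgue {y. \<epsilon> < norm (x - y)} (f i)) \<longlongrightarrow> (\<Sum>i\<in>A. I i)) (at_right 0)"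
    using pv by (intro tendsto_sum) (simp add: has_pv_integral_def)
  then show "((\<lambda>\<epsilon>. set_lebesgue_integral lebesgue {y. \<epsilon> < norm (x - y)} (\<lambda>y. \<Sum>i\<in>A. f i y)) \<longlongrightarrow> (\<Sum>i\<in>A. I i)) (at_right 0)"
    using eq by (rule Lim_transform_eventually)
qed

text \<open>For exchanging a Lebesgue measurable function under the integral for a Borel version
  while the point \<open>x\<close> stays fixed.\<close>

lemma has_pv_integral_cong_AE:
  assumes f: "f \<in> borel_measurable lebesgue" and g: "g \<in> borel_measurable lebesgue"
    and ae: "AE y in lebesgue. f y = g y" and pv: "has_pv_integral f I x"
  shows "has_pv_integral g I x"
proof -
  have set: "{y. \<epsilon> < norm (x - y)} \<in> sets lebesgue" for \<epsilon>
  proof -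
    have "{y. \<epsilon> < norm (x - y)} \<in> sets borel" by measurable
    then show ?thesis by simp
  qed
  have m: "(\<lambda>y. indicat_real {y. \<epsilon> < norm (x - y)} y *\<^sub>R f y) \<in> borel_measurable lebesgue"
    "(\<lambda>y. indicat_real {y. \<epsilon> < norm (x - y)} y *\<^sub>R g y) \<in> borel_measurable lebesgue" for \<epsilon>
    using f g set by (auto intro!: borel_measurable_scaleR borel_measurable_indicator)
  have e: "AE y in lebesgue. indicat_real {y. \<epsilon> < norm (x - y)} y *\<^sub>R f y = indicat_real {y. \<epsilon> < norm (x - y)} y *\<^sub>R g y" for \<epsilon>
    using ae by eventually_elim simp
  have "set_integrable lebesgue {y. \<epsilon> < norm (x - y)} f \<longleftrightarrow> set_integrable lebesgue {y. \<epsilon> < norm (x - y)} g" for \<epsilon>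
    unfolding set_integrable_def by (rule integrable_cong_AE[OF m e])
  moreover have "set_lebesgue_integral lebesgue {y. \<epsilon> < norm (x - y)} f = set_lebesgue_integral lebesgue {y. \<epsilon> < norm (x - y)} g" for \<epsilon>
    unfolding set_lebesgue_integral_def by (rule integral_cong_AE[OF m e])
  ultimately show ?thesis using pv by (simp add: has_pv_integral_def)
qed

text \<open>For \<open>\<epsilon> < \<delta>\<close> the truncation removes the tail beyond
  \<open>\<delta>\<close>, which does not depend on \<open>\<epsilon>\<close>; the limit is shifted
  by it. The passage \<open>\<delta> \<rightarrow> \<infinity>\<close> thereby concerns absolutely
  convergent integrals only.\<close>

lemma has_pv_integral_truncated:
  fixes f :: "'a::euclidean_space \<Rightarrow> 'b::{banach, second_countable_topology}"
  assumes pv: "has_pv_integral f I x" and \<delta>: "0 < \<delta>"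
  shows "has_pv_integral (\<lambda>y. indicat_real {y. norm (x - y) \<le> \<delta>} y *\<^sub>R f y)
    (I - set_lebesgue_integral lebesgue {y. \<delta> < norm (x - y)} f) x"
proof -
  let ?g = "\<lambda>y. indicat_real {y. norm (x - y) \<le> \<delta>} y *\<^sub>R f y"
  have int: "integrable lebesgue (\<lambda>y. indicat_real {y. \<epsilon> < norm (x - y)} y *\<^sub>R f y)" if "0 < \<epsilon>" for \<epsilon>
    using pv that by (simp add: has_pv_integral_def set_integrable_def)
  \<comment> \<open>With \<open>max\<close> the identity covers
    \<open>\<epsilon> \<ge> \<delta>\<close> too, where both sides vanish; integrability is required
    for every positive \<open>\<epsilon>\<close>.\<close>
  have eq: "indicat_real {y. \<epsilon> < norm (x - y)} y *\<^sub>R ?g y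
      = indicat_real {y. \<epsilon> < norm (x - y)} y *\<^sub>R f y - indicat_real {y. max \<epsilon> \<delta> < norm (x - y)} y *\<^sub>R f y" for \<epsilon> y
    by (auto simp: indicator_def)
  have cut: "set_lebesgue_integral lebesgue {y. \<epsilon> < norm (x - y)} ?g
      = set_lebesgue_integral lebesgue {y. \<epsilon> < norm (x - y)} f - set_lebesgue_integral lebesgue {y. \<delta> < norm (x - y)} f"
    if "0 < \<epsilon>" "\<epsilon> < \<delta>" for \<epsilon>
    using int[of \<epsilon>] int[of \<delta>] that \<delta> unfolding set_lebesgue_integral_def eq by (simp add: max_absorb2)
  have ev: "\<forall>\<^sub>F \<epsilon> in at_right 0. set_lebesgue_integral lebesgue {y. \<epsilon> < norm (x - y)} f - set_lebesgue_integral lebesgue {y. \<delta> < norm (x - y)} f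
      = set_lebesgue_integral lebesgue {y. \<epsilon> < norm (x - y)} ?g"
    using eventually_at_right_real[OF \<delta>] by eventually_elim (rule cut[symmetric], auto)
  have "((\<lambda>\<epsilon>. set_lebesgue_integral lebesgue {y. \<epsilon> < norm (x - y)} f - set_lebesgue_integral lebesgue {y. \<delta> < norm (x - y)} f)
      \<longlongrightarrow> I - set_lebesgue_integral lebesgue {y. \<delta> < norm (x - y)} f) (at_right 0)"
    using pv by (intro tendsto_diff tendsto_const) (simp add: has_pv_integral_def)
  then have lim: "((\<lambda>\<epsilon>. set_lebesgue_integral lebesgue {y. \<epsilon> < norm (x - y)} ?g)
      \<longlongrightarrow> I - set_lebesgue_integral lebesgue {y. \<delta> < norm (x - y)} f) (at_right 0)"
    using ev by (rule Lim_transform_eventually)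
  have "set_integrable lebesgue {y. \<epsilon> < norm (x - y)} ?g" if "0 < \<epsilon>" for \<epsilon>
    unfolding set_integrable_def eq using that \<delta> by (intro Bochner_Integration.integrable_diff int) auto
  with lim show ?thesis by (simp add: has_pv_integral_def)
qed

lemma pv_integral_truncated_tendsto:
  fixes f :: "'a::euclidean_space \<Rightarrow> 'b::{banach, second_countable_topology}"
  assumes "pv_integrable f x"
  shows "\<forall>\<delta>>0. pv_integrable (\<lambda>y. indicat_real {y. norm (x - y) \<le> \<delta>} y *\<^sub>R f y) x"
    and "((\<lambda>\<delta>. pv_integral (\<lambda>y. indicat_real {y. norm (x - y) \<le> \<delta>} y *\<^sub>R f y) x) \<longlongrightarrow> pv_integral f x) at_top"
proof -
  obtain I where I: "has_pv_integral f I x" using assms by (auto simp: pv_integrable_def)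
  show "\<forall>\<delta>>0. pv_integrable (\<lambda>y. indicat_real {y. norm (x - y) \<le> \<delta>} y *\<^sub>R f y) x"
    using has_pv_integral_truncated[OF I] by (auto simp: pv_integrable_def)
  have int: "integrable lebesgue (\<lambda>y. indicat_real {y. \<epsilon> < norm (x - y)} y *\<^sub>R f y)" if "0 < \<epsilon>" for \<epsilon>
    using I that by (simp add: has_pv_integral_def set_integrable_def)
  \<comment> \<open>The \<open>max\<close> keeps the region inside \<open>1 < norm (x - y)\<close>
    for every real \<open>\<delta>\<close>, so one integrable majorant serves throughout.\<close>
  have "((\<lambda>\<delta>. \<integral>y. indicat_real {y. max 1 \<delta> < norm (x - y)} y *\<^sub>R f y \<partial>lebesgue) \<longlongrightarrow> (\<integral>y. 0 \<partial>(lebesgue :: 'a measure))) at_top"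
  proof (rule integral_dominated_convergence_at_top[where w = "\<lambda>y. norm (indicat_real {y. 1 < norm (x - y)} y *\<^sub>R f y)"])
    show "(\<lambda>y. indicat_real {y. max 1 \<delta> < norm (x - y)} y *\<^sub>R f y) \<in> borel_measurable lebesgue" for \<delta>
      by (rule borel_measurable_integrable[OF int]) simp
    show "integrable lebesgue (\<lambda>y. norm (indicat_real {y. 1 < norm (x - y)} y *\<^sub>R f y))"
      by (rule integrable_norm[OF int]) simp
    show "\<forall>\<^sub>F \<delta> in at_top. AE y in lebesgue. norm (indicat_real {y. max 1 \<delta> < norm (x - y)} y *\<^sub>R f y)
        \<le> norm (indicat_real {y. 1 < norm (x - y)} y *\<^sub>R f y)"
      by (intro always_eventually allI AE_I2) (simp add: indicator_def)
    show "AE y in lebesgue. ((\<lambda>\<delta>. indicat_real {y. max 1 \<delta> < norm (x - y)} y *\<^sub>R f y) \<longlongrightarrow> 0) at_top"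
    proof (intro AE_I2)
      fix y
      have "\<forall>\<^sub>F \<delta> in at_top. 0 = indicat_real {y. max 1 \<delta> < norm (x - y)} y *\<^sub>R f y"
        using eventually_ge_at_top[of "norm (x - y)"] by eventually_elim simp
      then show "((\<lambda>\<delta>. indicat_real {y. max 1 \<delta> < norm (x - y)} y *\<^sub>R f y) \<longlongrightarrow> 0) at_top"
        by (rule Lim_transform_eventually[OF tendsto_const])
    qed
  qed simp
  then have "((\<lambda>\<delta>. I - (\<integral>y. indicat_real {y. max 1 \<delta> < norm (x - y)} y *\<^sub>R f y \<partial>lebesgue)) \<longlongrightarrow> I - 0) at_top"
    by (intro tendsto_diff tendsto_const) simp
  moreover have "\<forall>\<^sub>F \<delta> in at_top. I - (\<integral>y. indicat_real {y. max 1 \<delta> < norm (x - y)} y *\<^sub>R f y \<partial>lebesgue)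
      = pv_integral (\<lambda>y. indicat_real {y. norm (x - y) \<le> \<delta>} y *\<^sub>R f y) x"
    using eventually_ge_at_top[of 1]
  proof eventually_elim
    case (elim \<delta>)
    then show ?case
      using pv_integral_eq[OF has_pv_integral_truncated[OF I, of \<delta>]]
      by (simp add: set_lebesgue_integral_def max_absorb2)
  qed
  ultimately have "((\<lambda>\<delta>. pv_integral (\<lambda>y. indicat_real {y. norm (x - y) \<le> \<delta>} y *\<^sub>R f y) x) \<longlongrightarrow> I - 0) at_top"
    by (rule Lim_transform_eventually)
  then show "((\<lambda>\<delta>. pv_integral (\<lambda>y. indicat_real {y. norm (x - y) \<le> \<delta>} y *\<^sub>R f y) x) \<longlongrightarrow> pv_integral f x) at_top"
    by (simp add: pv_integral_eq[OF I])
qed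

section \<open>Existence of scalar principal values almost everywhere\<close>

lemma AE_pv_integrable_riesz_borel:
  fixes u :: "'a::euclidean_space \<Rightarrow> real"
  assumes u[measurable]: "u \<in> borel_measurable borel" and u2: "integrable lborel (\<lambda>x. (u x)\<^sup>2)"
    and s: "0 < s" "s < 1" and b: "b \<in> Basis"
    and gag: "(\<integral>\<^sup>+x. \<integral>\<^sup>+y. ennreal ((u x - u y)\<^sup>2 / norm (x - y) powr (real DIM('a) + 2 * s)) \<partial>lborel \<partial>lborel) < \<infinity>"
  shows "AE x in lborel. pv_integrable
    (\<lambda>y. ((x - y) \<bullet> b) * norm (x - y) powr - (real DIM('a) + s + 1) * (u x - u y)) x"
  using AE_riesz_truncations_converge(1)[OF u u2 s b gag]
proof eventually_elim
  case (elim x)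
  define f where "f y = ((x - y) \<bullet> b) * norm (x - y) powr - (real DIM('a) + s + 1) * (u x - u y)" for y
  have [measurable]: "f \<in> borel_measurable borel" unfolding f_def by measurable
  have F[measurable]: "(\<lambda>y. indicat_real {y. \<epsilon> < norm (x - y)} y *\<^sub>R f y) \<in> borel_measurable borel" for \<epsilon>
    by measurable
  have refl_eq: "indicat_real {y. \<epsilon> < norm (x - y)} (x - z) *\<^sub>R f (x - z)
      = indicator {z. \<epsilon> < norm z} z * ((z \<bullet> b) * norm z powr - (real DIM('a) + s + 1) * (u x - u (x - z)))" for \<epsilon> z
    by (simp add: f_def indicator_def)
  have "set_integrable lebesgue {y. \<epsilon> < norm (x - y)} f" if "0 < \<epsilon>" for \<epsilon>
  proof -
    have "integrable lborel (\<lambda>z. indicat_real {y. \<epsilon> < norm (x - y)} (x - z) *\<^sub>R f (x - z))"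
      unfolding refl_eq by (rule AE_riesz_truncations_converge(2)[OF u u2 s b gag that])
    then have "integrable lborel (\<lambda>y. indicat_real {y. \<epsilon> < norm (x - y)} y *\<^sub>R f y)"
      by (subst (asm) integrable_lborel_reflect_iff[OF F])
    then show ?thesis
      unfolding set_integrable_def by (subst integrable_completion) auto
  qed
  moreover have "set_lebesgue_integral lebesgue {y. \<epsilon> < norm (x - y)} f
      = (\<integral>z. indicator {z. \<epsilon> < norm z} z * ((z \<bullet> b) * norm z powr - (real DIM('a) + s + 1) * (u x - u (x - z))) \<partial>lborel)" for \<epsilon>
  proof -
    have "set_lebesgue_integral lebesgue {y. \<epsilon> < norm (x - y)} f = (\<integral>y. indicat_real {y. \<epsilon> < norm (x - y)} y *\<^sub>R f y \<partial>lborel)"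
      unfolding set_lebesgue_integral_def by (rule integral_completion) simp
    also have "\<dots> = (\<integral>z. indicat_real {y. \<epsilon> < norm (x - y)} (x - z) *\<^sub>R f (x - z) \<partial>lborel)"
      by (rule integral_lborel_reflect[OF F, symmetric])
    finally show ?thesis unfolding refl_eq .
  qed
  ultimately have "pv_integrable f x"
    using elim unfolding pv_integrable_def has_pv_integral_def by simp
  then show ?case by (simp add: f_def[abs_def])
qed

text \<open>Passes to a Borel version \<open>u'\<close>. Null sets in \<open>y\<close> do not affect
  the integrals, but the integrand also contains the value \<open>u x\<close>, so the points where
  \<open>u x\<close> and \<open>u' x\<close> differ join the exceptional set.\<close>

lemma AE_pv_integrable_riesz:
  fixes u :: "real ^ 'n \<Rightarrow> real"
  assumes s: "0 < s" "s < 1" and u: "u \<in> Hs s"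
  shows "AE x in lebesgue. pv_integrable
    (\<lambda>y. (x $ i - y $ i) * norm (x - y) powr - (real CARD('n) + s + 1) * (u x - u y)) x"
proof -
  have um: "u \<in> borel_measurable lebesgue" and u2: "integrable lebesgue (\<lambda>x. (u x)\<^sup>2)"
    and gag: "(\<integral>\<^sup>+x. \<integral>\<^sup>+y. ennreal ((u x - u y)\<^sup>2 / norm (x - y) powr (real CARD('n) + 2 * s)) \<partial>lebesgue \<partial>lebesgue) < \<infinity>"
    using u by (auto simp: Hs_def)
  obtain u' where u'[measurable]: "u' \<in> borel_measurable borel" and ae: "AE x in lborel. u x = u' x"
    using completion_ex_borel_measurable_real[OF um] by auto
  have ae': "AE x in lebesgue. u x = u' x" using ae by (simp add: AE_completion_iff)
  have u'l: "u' \<in> borel_measurable lebesgue" by (rule measurable_completion) simp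
  have "integrable lebesgue (\<lambda>x. (u' x)\<^sup>2)"
  proof (rule integrable_cong_AE_imp[OF u2])
    show "(\<lambda>x. (u' x)\<^sup>2) \<in> borel_measurable lebesgue" using u'l by (rule borel_measurable_power)
    show "AE x in lebesgue. (u x)\<^sup>2 = (u' x)\<^sup>2" using ae' by eventually_elim simp
  qed
  then have u'2: "integrable lborel (\<lambda>x. (u' x)\<^sup>2)" by (subst (asm) integrable_completion) auto
  have "(\<integral>\<^sup>+x. \<integral>\<^sup>+y. ennreal ((u' x - u' y)\<^sup>2 / norm (x - y) powr (real DIM(real ^ 'n) + 2 * s)) \<partial>lborel \<partial>lborel)
      = (\<integral>\<^sup>+x. \<integral>\<^sup>+y. ennreal ((u x - u y)\<^sup>2 / norm (x - y) powr (real CARD('n) + 2 * s)) \<partial>lborel \<partial>lborel)"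
  proof (rule nn_integral_cong_AE)
    show "AE x in lborel. (\<integral>\<^sup>+y. ennreal ((u' x - u' y)\<^sup>2 / norm (x - y) powr (real DIM(real ^ 'n) + 2 * s)) \<partial>lborel)
      = (\<integral>\<^sup>+y. ennreal ((u x - u y)\<^sup>2 / norm (x - y) powr (real CARD('n) + 2 * s)) \<partial>lborel)"
      using ae
    proof eventually_elim
      case (elim x)
      show ?case
        by (rule nn_integral_cong_AE) (use ae in \<open>eventually_elim, simp add: elim\<close>)
    qed
  qed
  also have "\<dots> < \<infinity>" using gag by (simp only: nn_integral_completion)
  finally have gag': "(\<integral>\<^sup>+x. \<integral>\<^sup>+y. ennreal ((u' x - u' y)\<^sup>2 / norm (x - y) powr (real DIM(real ^ 'n) + 2 * s)) \<partial>lborel \<partial>lborel) < \<infinity>" .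
  have "axis i 1 \<in> (Basis :: (real ^ 'n) set)" by simp
  from AE_pv_integrable_riesz_borel[OF u' u'2 s this gag']
  have "AE x in lborel. pv_integrable
    (\<lambda>y. (x $ i - y $ i) * norm (x - y) powr - (real CARD('n) + s + 1) * (u' x - u' y)) x"
    by (simp add: inner_axis)
  then have "AE x in lebesgue. pv_integrable
    (\<lambda>y. (x $ i - y $ i) * norm (x - y) powr - (real CARD('n) + s + 1) * (u' x - u' y)) x"
    by (simp add: AE_completion_iff)
  with ae' show ?thesis
  proof eventually_elim
    case (elim x)
    have k: "(\<lambda>y. (x $ i - y $ i) * norm (x - y) powr - (real CARD('n) + s + 1)) \<in> borel_measurable lebesgue"
      by (rule measurable_completion) measurable
    obtain I where "has_pv_integral (\<lambda>y. (x $ i - y $ i) * norm (x - y) powr - (real CARD('n) + s + 1) * (u' x - u' y)) I x"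
      using elim(2) by (auto simp: pv_integrable_def)
    then have "has_pv_integral (\<lambda>y. (x $ i - y $ i) * norm (x - y) powr - (real CARD('n) + s + 1) * (u x - u y)) I x"
    proof (rule has_pv_integral_cong_AE[rotated 3])
      show "(\<lambda>y. (x $ i - y $ i) * norm (x - y) powr - (real CARD('n) + s + 1) * (u' x - u' y)) \<in> borel_measurable lebesgue"
        "(\<lambda>y. (x $ i - y $ i) * norm (x - y) powr - (real CARD('n) + s + 1) * (u x - u y)) \<in> borel_measurable lebesgue"
        by (intro borel_measurable_times k borel_measurable_diff borel_measurable_const u'l um)+
      show "AE y in lebesgue. (x $ i - y $ i) * norm (x - y) powr - (real CARD('n) + s + 1) * (u' x - u' y)
          = (x $ i - y $ i) * norm (x - y) powr - (real CARD('n) + s + 1) * (u x - u y)"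
        using ae' by eventually_elim (simp add: elim(1))
    qed
    then show ?case by (auto simp: pv_integrable_def)
  qed
qed

section \<open>Reduction of gradient and divergence to scalar components\<close>

lemma grad_integrand_nth:
  fixes u :: "real ^ 'n \<Rightarrow> real"
  shows "grad_integrand s u x y $ i = (x $ i - y $ i) * norm (x - y) powr - (real CARD('n) + s + 1) * (u x - u y)"
proof (cases "x = y")
  case False
  then have "norm (x - y) powr - (real CARD('n) + s + 1) = inverse (norm (x - y) powr (real CARD('n) + s)) * inverse (norm (x - y))"
    unfolding powr_minus powr_add[of _ _ 1] by simp
  then show ?thesis by (simp add: grad_integrand_def divide_inverse)
qed (simp add: grad_integrand_def)

text \<open>The divergence is the trace of the gradients of the components, which reduces it to the
  scalar case.\<close>

lemma div_integrand_eq_sum: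
  fixes v :: "real ^ 'n \<Rightarrow> real ^ 'n"
  shows "div_integrand s v x y = (\<Sum>i\<in>UNIV. grad_integrand s (\<lambda>x. v x $ i) x y $ i)"
  by (simp add: div_integrand_def grad_integrand_def inner_vec_def sum_divide_distrib mult.assoc)

theorem theorem3p5:
  fixes s :: real and u :: "real ^ 'n \<Rightarrow> real" and v :: "real ^ 'n \<Rightarrow> real ^ 'n"
  assumes "0 < s" and "s < 1"
    and "u \<in> Hs s" and "v \<in> Hs_vec s"
  shows "AE x in lebesgue.
      pv_integrable (div_integrand s v x) x \<and>
      (\<forall>\<delta>>0. pv_integrable (div_integrand_trunc \<delta> s v x) x) \<and>
      ((\<lambda>\<delta>. frac_div_trunc \<delta> s v x) \<longlongrightarrow> frac_div s v x) at_top \<and>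
      pv_integrable (grad_integrand s u x) x \<and>
      (\<forall>\<delta>>0. pv_integrable (grad_integrand_trunc \<delta> s u x) x) \<and>
      ((\<lambda>\<delta>. frac_grad_trunc \<delta> s u x) \<longlongrightarrow> frac_grad s u x) at_top"
proof -
  have component: "AE x in lebesgue. \<forall>i. pv_integrable (\<lambda>y. grad_integrand s w x y $ i) x" if "w \<in> Hs s" for w :: "real ^ 'n \<Rightarrow> real"
    using AE_pv_integrable_riesz[OF assms(1,2) that] unfolding grad_integrand_nth
    by (simp add: AE_all_countable)
  have "AE x in lebesgue. \<forall>i. \<forall>j. pv_integrable (\<lambda>y. grad_integrand s (\<lambda>x. v x $ i) x y $ j) x"
    using component assms(4) by (simp add: AE_all_countable Hs_vec_def)
  with component[OF assms(3)] show ?thesis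
  proof eventually_elim
    case (elim x)
    from elim(2) have "\<forall>i. \<exists>I. has_pv_integral (\<lambda>y. grad_integrand s (\<lambda>x. v x $ i) x y $ i) I x"
      by (auto simp: pv_integrable_def)
    then obtain I where "\<And>i. has_pv_integral (\<lambda>y. grad_integrand s (\<lambda>x. v x $ i) x y $ i) (I i) x" by metis
    then have "has_pv_integral (\<lambda>y. \<Sum>i\<in>UNIV. grad_integrand s (\<lambda>x. v x $ i) x y $ i) (\<Sum>i\<in>UNIV. I i) x"
      by (intro has_pv_integral_sum) auto
    then have d: "pv_integrable (div_integrand s v x) x"
      unfolding div_integrand_eq_sum[abs_def] by (auto simp: pv_integrable_def)
    from elim(1) obtain J where "\<And>i. has_pv_integral (\<lambda>y. grad_integrand s u x y $ i) (J i) x"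
      unfolding pv_integrable_def by metis
    \<comment> \<open>The vector-valued principal value is assembled from its coordinates along the
      standard basis.\<close>
    then have "has_pv_integral (\<lambda>y. \<Sum>i\<in>UNIV. grad_integrand s u x y $ i *\<^sub>R axis i (1::real)) (\<Sum>i\<in>UNIV. J i *\<^sub>R axis i 1) x"
      by (intro has_pv_integral_sum has_pv_integral_scaleR_left) auto
    moreover have "(\<Sum>i\<in>UNIV. w $ i *\<^sub>R axis i 1) = w" for w :: "real ^ 'n"
      using basis_expansion[of w] by (simp add: scalar_mult_eq_scaleR)
    ultimately have g: "pv_integrable (grad_integrand s u x) x"
      by (auto simp: pv_integrable_def)
    show ?case
      using d g pv_integral_truncated_tendsto[OF d] pv_integral_truncated_tendsto[OF g]
      by (simp add: frac_div_def frac_grad_def frac_div_trunc_def frac_grad_trunc_def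
          div_integrand_trunc_def[abs_def] grad_integrand_trunc_def[abs_def])
  qed
qed

end
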